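(* Let $\mathcal{F}$ be a family of simple digraphs. There is a polynomial-time algorithm which, given an instance $I=(d,\mathsf{in},\mathsf{out})$ of \textsc{Fixed Degree $\mathcal{F}$-Subgraph} on a vertex set $V$ with $|V|=n$, outputs an instance $I'=(d,\mathsf{in}',\mathsf{out}')$ of the same problem and a function $f:V^2\to\mathbb{Z}_{\ge 0}$ such that (i) $\mathsf{in}'(v),\mathsf{out}'(v)=\mathcal{O}(n\cdot s_n(\mathcal{F}))$ for every vertex $v$, and (ii) if $m^*$ is an optimal solution for $I'$, then $f+m^*$ is an optimal solution for $I$. The algorithm does not need to know $\mathcal{F}$, only the value $s_n(\mathcal{F})$.
   Context: For $m:V^2\to\mathbb{Z}_{\ge 0}$, the thick graph $G_m$ is the directed multigraph on $V$ with exactly $m(u,v)$ parallel edges from $u$ to $v$ (loops allowed). \textsc{Fixed Degree $\mathcal{F}$-Subgraph}: given $d:V^2\to\mathbb{Z}_{\ge 0}\cup\{\infty\}$ and $\mathsf{in},\mathsf{out}:V\to\mathbb{Z}_{\ge 0}$, find $m:V^2\to\mathbb{Z}_{\ge 0}$ such that (i) $G_m$ contains a member of $\mathcal{F}$ as a spanning subgraph, and (ii) for every $v\in V$, $\mathsf{in}(v)$ equals the indegree and $\mathsf{out}(v)$ the outdegree of $v$ in $G_m$, minimizing $d(m)=\sum_{v,w\in V}d(v,w)m(v,w)$; a function satisfying (i) and (ii) is a (feasible) solution. Here $s_n(\mathcal{F})=\max\{|E(G)| : G\in\mathcal{F},\ |V(G)|=n\}$.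
   Formalization: If the indegrees and outdegrees of I have different sums (so I has no solution), the bound on in'(v), out'(v) is O(n·s_n)+1 instead of O(n·s_n); this matters only when s_n = 0, where the stated bound fails. *)

theory Defs
  imports
    "Graph_Theory.Graph_Theory"
    "HOL-Library.Extended_Nat"
    "HOL-Library.Log_Nat"
    "HOL-Computational_Algebra.Polynomial"
begin

section \<open>The problem Fixed Degree F-Subgraph\<close>

text \<open>The vertex set of an instance with n vertices is \<open>{..<n}\<close>; only the values of functions on
  this set are relevant.\<close>

definition thick_graph :: "nat \<Rightarrow> (nat \<Rightarrow> nat \<Rightarrow> nat) \<Rightarrow> (nat, nat \<times> nat \<times> nat) pre_digraph" where
  "thick_graph n m =
    \<lparr> verts = {..<n},
      arcs = {(u, v, i). u < n \<and> v < n \<and> i < m u v},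
      tail = (\<lambda>(u, v, i). u),
      head = (\<lambda>(u, v, i). v) \<rparr>"

text \<open>Members of \<open>F\<close> are labelled digraphs, and membership is literal. To work up to isomorphism,
  take a family \<open>F\<close> that is closed under isomorphism.\<close>

definition contains_spanning_member ::
  "nat pair_pre_digraph set \<Rightarrow> (nat, 'e) pre_digraph \<Rightarrow> bool" where
  "contains_spanning_member F G \<longleftrightarrow>
    (\<exists>S\<in>F. \<exists>H. spanning H G \<and> nomulti_digraph H \<and> verts H = pverts S \<and> arcs_ends H = parcs S)"

definition is_solution ::
  "nat pair_pre_digraph set \<Rightarrow> nat \<Rightarrow> (nat \<Rightarrow> nat) \<Rightarrow> (nat \<Rightarrow> nat) \<Rightarrow> (nat \<Rightarrow> nat \<Rightarrow> nat) \<Rightarrow> bool" where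
  "is_solution F n ind outd m \<longleftrightarrow>
    contains_spanning_member F (thick_graph n m) \<and>
    (\<forall>v<n. ind v = in_degree (thick_graph n m) v \<and> outd v = out_degree (thick_graph n m) v)"

definition cost :: "nat \<Rightarrow> (nat \<Rightarrow> nat \<Rightarrow> enat) \<Rightarrow> (nat \<Rightarrow> nat \<Rightarrow> nat) \<Rightarrow> enat" where
  "cost n d m = (\<Sum>v<n. \<Sum>w<n. d v w * enat (m v w))"

definition is_optimal ::
  "nat pair_pre_digraph set \<Rightarrow> nat \<Rightarrow> (nat \<Rightarrow> nat \<Rightarrow> enat) \<Rightarrow> (nat \<Rightarrow> nat) \<Rightarrow> (nat \<Rightarrow> nat)
    \<Rightarrow> (nat \<Rightarrow> nat \<Rightarrow> nat) \<Rightarrow> bool" where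
  "is_optimal F n d ind outd m \<longleftrightarrow>
    is_solution F n ind outd m \<and>
    (\<forall>m'. is_solution F n ind outd m' \<longrightarrow> cost n d m \<le> cost n d m')"

text \<open>The inserted \<open>0\<close> only matters when \<open>F\<close> has no member with n vertices.\<close>

definition max_arcs :: "nat pair_pre_digraph set \<Rightarrow> nat \<Rightarrow> nat" where
  "max_arcs F n = Max (insert 0 {card (parcs G) | G. G \<in> F \<and> card (pverts G) = n})"


section \<open>Model of computation\<close>

text \<open>
  Programs of an imperative language whose variables are integer arrays, under the logarithmic
  cost criterion: evaluating an expression costs, for each node of the syntax tree, one plus the
  number of bits of the value at that node. In particular array indices, addresses and
  intermediate results are charged by their length, so that running times agree with those of
  Turing machines up to a polynomial.
\<close>

type_synonym vname = string
type_synonym state = "vname \<Rightarrow> int \<Rightarrow> int"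

datatype aexp =
    N int
  | Idx vname aexp
  | Add aexp aexp
  | Sub aexp aexp
  | Mul aexp aexp
  | Div aexp aexp

datatype bexp =
    Less aexp aexp
  | Not bexp
  | And bexp bexp

datatype com =
    Skip
  | Assign vname aexp aexp  \<comment> \<open>array, index, value\<close>
  | Seq com com
  | If bexp com com
  | While bexp com

definition bits :: "int \<Rightarrow> nat" where
  "bits z = floorlog 2 (nat \<bar>z\<bar>)"

primrec aval :: "aexp \<Rightarrow> state \<Rightarrow> int" where
  "aval (N k) \<sigma> = k"
| "aval (Idx x a) \<sigma> = \<sigma> x (aval a \<sigma>)"
| "aval (Add a b) \<sigma> = aval a \<sigma> + aval b \<sigma>"
| "aval (Sub a b) \<sigma> = aval a \<sigma> - aval b \<sigma>"
| "aval (Mul a b) \<sigma> = aval a \<sigma> * aval b \<sigma>"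
| "aval (Div a b) \<sigma> = aval a \<sigma> div aval b \<sigma>"

primrec atime :: "aexp \<Rightarrow> state \<Rightarrow> nat" where
  "atime (N k) \<sigma> = 1 + bits k"
| "atime (Idx x a) \<sigma> = atime a \<sigma> + 1 + bits (aval (Idx x a) \<sigma>)"
| "atime (Add a b) \<sigma> = atime a \<sigma> + atime b \<sigma> + 1 + bits (aval (Add a b) \<sigma>)"
| "atime (Sub a b) \<sigma> = atime a \<sigma> + atime b \<sigma> + 1 + bits (aval (Sub a b) \<sigma>)"
| "atime (Mul a b) \<sigma> = atime a \<sigma> + atime b \<sigma> + 1 + bits (aval (Mul a b) \<sigma>)"
| "atime (Div a b) \<sigma> = atime a \<sigma> + atime b \<sigma> + 1 + bits (aval (Div a b) \<sigma>)"

primrec bval :: "bexp \<Rightarrow> state \<Rightarrow> bool" where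
  "bval (Less a b) \<sigma> \<longleftrightarrow> aval a \<sigma> < aval b \<sigma>"
| "bval (Not b) \<sigma> \<longleftrightarrow> \<not> bval b \<sigma>"
| "bval (And b c) \<sigma> \<longleftrightarrow> bval b \<sigma> \<and> bval c \<sigma>"

primrec btime :: "bexp \<Rightarrow> state \<Rightarrow> nat" where
  "btime (Less a b) \<sigma> = atime a \<sigma> + atime b \<sigma> + 1"
| "btime (Not b) \<sigma> = btime b \<sigma> + 1"
| "btime (And b c) \<sigma> = btime b \<sigma> + btime c \<sigma> + 1"

text \<open>\<open>exec P \<sigma> t \<sigma>'\<close>: started in \<open>\<sigma>\<close>, the program \<open>P\<close> terminates after time \<open>t\<close> in \<open>\<sigma>'\<close>.\<close>

inductive exec :: "com \<Rightarrow> state \<Rightarrow> nat \<Rightarrow> state \<Rightarrow> bool" where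
  Skip: "exec Skip \<sigma> 1 \<sigma>"
| Assign: "exec (Assign x a b) \<sigma> (atime a \<sigma> + atime b \<sigma> + 1)
    (\<sigma>(x := (\<sigma> x)(aval a \<sigma> := aval b \<sigma>)))"
| Seq: "exec c1 \<sigma> t1 \<sigma>' \<Longrightarrow> exec c2 \<sigma>' t2 \<sigma>'' \<Longrightarrow> exec (Seq c1 c2) \<sigma> (t1 + t2 + 1) \<sigma>''"
| IfTrue: "bval b \<sigma> \<Longrightarrow> exec c1 \<sigma> t \<sigma>' \<Longrightarrow> exec (If b c1 c2) \<sigma> (btime b \<sigma> + t + 1) \<sigma>'"
| IfFalse: "\<not> bval b \<sigma> \<Longrightarrow> exec c2 \<sigma> t \<sigma>' \<Longrightarrow> exec (If b c1 c2) \<sigma> (btime b \<sigma> + t + 1) \<sigma>'"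
| WhileFalse: "\<not> bval b \<sigma> \<Longrightarrow> exec (While b c) \<sigma> (btime b \<sigma> + 1) \<sigma>"
| WhileTrue: "bval b \<sigma> \<Longrightarrow> exec c \<sigma> t1 \<sigma>' \<Longrightarrow> exec (While b c) \<sigma>' t2 \<sigma>'' \<Longrightarrow>
    exec (While b c) \<sigma> (btime b \<sigma> + t1 + t2 + 1) \<sigma>''"

inductive_cases exec_SkipE: "exec Skip \<sigma> t \<sigma>'"
inductive_cases exec_AssignE: "exec (Assign x a b) \<sigma> t \<sigma>'"
inductive_cases exec_SeqE: "exec (Seq c1 c2) \<sigma> t \<sigma>'"
inductive_cases exec_IfE: "exec (If b c1 c2) \<sigma> t \<sigma>'"
inductive_cases exec_WhileE: "exec (While b c) \<sigma> t \<sigma>'"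

lemma exec_deterministic:
  "exec c \<sigma> t \<sigma>' \<Longrightarrow> exec c \<sigma> u \<sigma>'' \<Longrightarrow> u = t \<and> \<sigma>'' = \<sigma>'"
proof (induction arbitrary: u \<sigma>'' rule: exec.induct)
  case (Skip \<sigma>)
  from Skip show ?case by (rule exec_SkipE) simp
next
  case (Assign x a b \<sigma>)
  from Assign show ?case by (rule exec_AssignE) simp
next
  case (Seq c1 \<sigma> t1 \<sigma>1 c2 t2 \<sigma>2)
  from Seq.prems show ?case by (rule exec_SeqE) (auto dest!: Seq.IH)
next
  case (IfTrue b \<sigma> c1 t \<sigma>' c2)
  from IfTrue.prems show ?case by (rule exec_IfE) (use IfTrue.hyps(1) in \<open>auto dest!: IfTrue.IH\<close>)+
next
  case (IfFalse b \<sigma> c2 t \<sigma>' c1)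
  from IfFalse.prems show ?case by (rule exec_IfE) (use IfFalse.hyps(1) in \<open>auto dest!: IfFalse.IH\<close>)+
next
  case (WhileFalse b \<sigma> c)
  from WhileFalse.prems show ?case by (rule exec_WhileE) (use WhileFalse.hyps in auto)+
next
  case (WhileTrue b \<sigma> c t1 \<sigma>1 t2 \<sigma>2)
  from WhileTrue.prems show ?case by (rule exec_WhileE) (use WhileTrue.hyps(1) in \<open>auto dest!: WhileTrue.IH\<close>)+
qed


section \<open>Input and output of the algorithm\<close>

fun cost_code :: "enat \<Rightarrow> int" where
  "cost_code (enat k) = int k"
| "cost_code \<infinity> = -1"

text \<open>The matrix \<open>d\<close> is stored in row-major order. All cells not mentioned hold \<open>0\<close>. The family
  \<open>F\<close> enters only through the number \<open>s\<close>.\<close>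

definition input_state ::
  "nat \<Rightarrow> (nat \<Rightarrow> nat \<Rightarrow> enat) \<Rightarrow> (nat \<Rightarrow> nat) \<Rightarrow> (nat \<Rightarrow> nat) \<Rightarrow> nat \<Rightarrow> state" where
  "input_state n d ind outd s = (\<lambda>_ _. 0)
    (''n'' := (\<lambda>i. if i = 0 then int n else 0),
     ''s'' := (\<lambda>i. if i = 0 then int s else 0),
     ''d'' := (\<lambda>i. if 0 \<le> i \<and> i < int (n * n) then cost_code (d (nat i div n) (nat i mod n)) else 0),
     ''in'' := (\<lambda>i. if 0 \<le> i \<and> i < int n then int (ind (nat i)) else 0),
     ''out'' := (\<lambda>i. if 0 \<le> i \<and> i < int n then int (outd (nat i)) else 0))"

text \<open>All numbers of the input are written in binary.\<close>

definition input_size ::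
  "nat \<Rightarrow> (nat \<Rightarrow> nat \<Rightarrow> enat) \<Rightarrow> (nat \<Rightarrow> nat) \<Rightarrow> (nat \<Rightarrow> nat) \<Rightarrow> nat \<Rightarrow> nat" where
  "input_size n d ind outd s =
    (1 + bits (int n)) + (1 + bits (int s)) +
    (\<Sum>v<n. \<Sum>w<n. 1 + bits (cost_code (d v w))) +
    (\<Sum>v<n. 1 + bits (int (ind v))) + (\<Sum>v<n. 1 + bits (int (outd v)))"

definition output_state ::
  "nat \<Rightarrow> (nat \<Rightarrow> nat) \<Rightarrow> (nat \<Rightarrow> nat) \<Rightarrow> (nat \<Rightarrow> nat \<Rightarrow> nat) \<Rightarrow> state \<Rightarrow> bool" where
  "output_state n ind' outd' f \<sigma> \<longleftrightarrow>
    (\<forall>v<n. \<sigma> ''in_new'' (int v) = int (ind' v) \<and> \<sigma> ''out_new'' (int v) = int (outd' v)) \<and>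
    (\<forall>v<n. \<forall>w<n. \<sigma> ''f'' (int (v * n + w)) = int (f v w))"

text \<open>
  The bound \<open>O(n * s)\<close> of the degrees with explicit constant \<open>C\<close>. The extra term is \<open>1\<close> exactly if
  the indegrees and outdegrees of the given instance have different sums, so that no \<open>m\<close> realises
  them. It is absorbed by the constant unless \<open>s = 0\<close>. In that case the term cannot be omitted: a
  bound of \<open>0\<close> would force the output degrees to vanish, and then \<open>m = 0\<close> is an optimal solution of
  the output instance if \<open>F\<close> contains the arcless digraph on \<open>{..<n}\<close>, while the given instance has
  no solution.
\<close>

definition degree_bound :: "nat \<Rightarrow> nat \<Rightarrow> (nat \<Rightarrow> nat) \<Rightarrow> (nat \<Rightarrow> nat) \<Rightarrow> nat \<Rightarrow> nat" where
  "degree_bound C n ind outd s =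
    C * (n * s) + (if (\<Sum>v<n. ind v) = (\<Sum>v<n. outd v) then 0 else 1)"

end

theory Submission
  imports Defs
begin

text \<open>
  Forget \<open>F\<close>: an optimal matrix \<open>r\<close> with the given row and column sums solves a transportation
  problem and comes with dual prices certifying optimality. Let \<open>m\<close> be an optimal solution of the
  instance, containing a member \<open>S\<close> of \<open>F\<close> with at most \<open>s\<close> arcs. A cycle of the difference \<open>m - r\<close>
  can be removed from \<open>m\<close> without increasing the cost, unless this empties an arc of \<open>S\<close>.
  If no cycle can be removed, every unit of \<open>r - m\<close> on an arc has to return through one of the at most
  \<open>s\<close> blocked arcs, each carrying one unit, so \<open>r \<le> m + s\<close> everywhere. Hence \<open>f = max 0 (r - 2s)\<close>
  may be fixed: \<open>m - f\<close> still contains \<open>S\<close>, and the degrees left over are at most \<open>2ns\<close>.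

  The matrix \<open>r\<close> is computed by the Hungarian method with the degrees revealed bit by bit: doubling an
  optimal matrix keeps the prices valid, and the new bits require at most \<open>n\<close> augmentations.
\<close>

text \<open>Why \<open>2 * s\<close>: proximity uses up one \<open>s\<close>, the other keeps the
  arcs of \<open>S\<close> positive once \<open>f\<close> is subtracted. Leaving
  \<open>s + 1\<close> units per entry would also do that, but the degrees could then be as large as
  \<open>n * (s + 1)\<close>, which is not \<open>O(n * s)\<close> for \<open>s = 0\<close>. With
  \<open>2 * s\<close> that case is harmless, because then \<open>S\<close> has no arcs. Prices need
  finite costs. An exchange moves at most one unit on each arc, so a stand-in for infinity that
  exceeds the sum of all finite costs is large enough, whatever the degrees are. The degrees are
  written in binary, so the number of unit augmentations has to depend on their lengths and not on
  their values; this is the reason for scaling. Indegrees and outdegrees may have different sums.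
  The method then stops with one side used up and the other not, which is why many invariants below
  are disjunctions over the two sides.\<close>

lemma sum_of_bool_unique:
  fixes n :: nat
  assumes "k < n" "\<And>v. v < n \<Longrightarrow> P v \<longleftrightarrow> v = k"
  shows "(\<Sum>v<n. of_bool (P v)) = (1::int)"
proof -
  have "(\<Sum>v<n. of_bool (P v)) = (\<Sum>v<n. if v = k then 1 else (0::int))"
    by (rule sum.cong) (use assms in auto)
  then show ?thesis using assms(1) by simp
qed

lemma sum_of_bool_none:
  fixes n :: nat
  assumes "\<And>v. v < n \<Longrightarrow> \<not> P v"
  shows "(\<Sum>v<n. of_bool (P v)) = (0::int)"
  by (rule sum.neutral) (use assms in auto)

subsection \<open>Degrees, spanning members and costs\<close>

lemma in_degree_thick_graph: "v < n \<Longrightarrow> in_degree (thick_graph n m) v = (\<Sum>u<n. m u v)"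
proof -
  assume v: "v < n"
  have "in_arcs (thick_graph n m) v = (\<lambda>(u, i). (u, v, i)) ` (SIGMA u:{..<n}. {..<m u v})"
    using v by (auto simp: in_arcs_def thick_graph_def)
  moreover have "inj_on (\<lambda>(u, i). (u, v, i)) (SIGMA u:{..<n}. {..<m u v})"
    by (auto simp: inj_on_def)
  ultimately show ?thesis
    by (simp add: in_degree_def card_image)
qed

lemma out_degree_thick_graph: "u < n \<Longrightarrow> out_degree (thick_graph n m) u = (\<Sum>v<n. m u v)"
proof -
  assume u: "u < n"
  have "out_arcs (thick_graph n m) u = (\<lambda>(v, i). (u, v, i)) ` (SIGMA v:{..<n}. {..<m u v})"
    using u by (auto simp: out_arcs_def thick_graph_def)
  moreover have "inj_on (\<lambda>(v, i). (u, v, i)) (SIGMA v:{..<n}. {..<m u v})"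
    by (auto simp: inj_on_def)
  ultimately show ?thesis
    by (simp add: out_degree_def card_image)
qed

definition member_support ::
  "nat pair_pre_digraph set \<Rightarrow> nat \<Rightarrow> (nat \<times> nat) set \<Rightarrow> bool" where
  "member_support F n A \<longleftrightarrow> (\<exists>S\<in>F. pverts S = {..<n} \<and> parcs S = A)"

definition covers :: "nat \<Rightarrow> (nat \<times> nat) set \<Rightarrow> (nat \<Rightarrow> nat \<Rightarrow> nat) \<Rightarrow> bool" where
  "covers n A m \<longleftrightarrow> A \<subseteq> {..<n} \<times> {..<n} \<and> (\<forall>(u, v)\<in>A. 0 < m u v)"

text \<open>Parallel arcs are interchangeable, so each arc of a member can be embedded as the copy
  with index \<open>0\<close>. Only positivity of \<open>m\<close> on an arc set remains, and the
  graphs can be forgotten.\<close>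

lemma contains_spanning_member_iff:
  "contains_spanning_member F (thick_graph n m) \<longleftrightarrow> (\<exists>A. member_support F n A \<and> covers n A m)"
proof
  assume "contains_spanning_member F (thick_graph n m)"
  then obtain S H where S: "S \<in> F" "spanning H (thick_graph n m)" "verts H = pverts S"
      "arcs_ends H = parcs S"
    unfolding contains_spanning_member_def by blast
  have "pverts S = {..<n}"
    using S by (simp add: spanning_def thick_graph_def)
  moreover have "covers n (parcs S) m"
  proof -
    have sub: "arcs H \<subseteq> {(u, v, i). u < n \<and> v < n \<and> i < m u v}"
      "tail H = (\<lambda>(u, v, i). u)" "head H = (\<lambda>(u, v, i). v)"
      using S(2) by (auto simp: spanning_def subgraph_def compatible_def thick_graph_def)
    have "u < n \<and> v < n \<and> 0 < m u v" if "(u, v) \<in> parcs S" for u v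
    proof -
      from that obtain e where "e \<in> arcs H" "u = tail H e" "v = head H e"
        unfolding S(4)[symmetric] arcs_ends_def arc_to_ends_def by blast
      then show ?thesis using sub by (cases e) auto
    qed
    then show ?thesis by (auto simp: covers_def)
  qed
  ultimately show "\<exists>A. member_support F n A \<and> covers n A m"
    unfolding member_support_def using S by blast
next
  assume "\<exists>A. member_support F n A \<and> covers n A m"
  then obtain S where S: "S \<in> F" "pverts S = {..<n}" "covers n (parcs S) m"
    unfolding member_support_def by blast
  define H :: "(nat, nat \<times> nat \<times> nat) pre_digraph" where
    "H = \<lparr> verts = {..<n}, arcs = (\<lambda>(u, v). (u, v, 0)) ` parcs S,
           tail = (\<lambda>(u, v, i). u), head = (\<lambda>(u, v, i). v) \<rparr>"
  have "wf_digraph H"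
    using S(3) by unfold_locales (auto simp: H_def covers_def)
  moreover have "wf_digraph (thick_graph n m)"
    by unfold_locales (auto simp: thick_graph_def)
  ultimately have "spanning H (thick_graph n m)"
    using S(3) by (auto simp: spanning_def subgraph_def compatible_def H_def thick_graph_def covers_def)
  moreover have "nomulti_digraph H"
    using \<open>wf_digraph H\<close> by (auto simp: nomulti_digraph_def nomulti_digraph_axioms_def H_def arc_to_ends_def)
  moreover have "arcs_ends H = parcs S"
    by (auto simp: H_def arcs_ends_def arc_to_ends_def image_image split_beta)
  moreover have "verts H = pverts S" using S by (simp add: H_def)
  ultimately show "contains_spanning_member F (thick_graph n m)"
    unfolding contains_spanning_member_def using S(1) by blast
qed

lemma is_solution_iff:
  "is_solution F n ind outd m \<longleftrightarrow>
    (\<exists>A. member_support F n A \<and> covers n A m) \<and>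
    (\<forall>v<n. (\<Sum>u<n. m u v) = ind v) \<and> (\<forall>u<n. (\<Sum>v<n. m u v) = outd u)"
  unfolding is_solution_def contains_spanning_member_iff
  by (auto simp: in_degree_thick_graph out_degree_thick_graph)

text \<open>\<open>Max\<close> is informative on finite sets only. The arcs of a member are ordered
  pairs of its vertices, so \<open>n * n\<close> bounds the numbers in question.\<close>

lemma card_member_support:
  assumes "\<forall>G\<in>F. pair_digraph G" "member_support F n A"
  shows "finite A" "card A \<le> max_arcs F n"
proof -
  from assms obtain S where S: "S \<in> F" "pverts S = {..<n}" "parcs S = A"
    unfolding member_support_def by blast
  let ?K = "{card (parcs G) | G. G \<in> F \<and> card (pverts G) = n}"
  have bound: "finite (parcs G) \<and> card (parcs G) \<le> n * n" if "G \<in> F" "card (pverts G) = n" for G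
  proof -
    interpret pair_digraph G using that assms by blast
    have "parcs G \<subseteq> pverts G \<times> pverts G"
      using in_arcsD1 in_arcsD2 by auto
    then have "card (parcs G) \<le> card (pverts G \<times> pverts G)"
      using pair_finite_verts by (intro card_mono) auto
    then show ?thesis using that pair_finite_arcs by (simp add: card_cartesian_product)
  qed
  then have "?K \<subseteq> {..n * n}" by auto
  then have "finite ?K" by (rule finite_subset) simp
  then show "card A \<le> max_arcs F n"
    unfolding max_arcs_def using S by (intro Max_ge) auto
  show "finite A" using bound[of S] S by simp
qed

lemma cost_add: "cost n d (\<lambda>u v. f u v + m u v) = cost n d f + cost n d m"
proof -
  have "d v w * enat (f v w + m v w) = d v w * enat (f v w) + d v w * enat (m v w)" for v w
    unfolding plus_enat_simps(1)[symmetric] by (rule distrib_left)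
  then show ?thesis by (simp add: cost_def sum.distrib)
qed

subsection \<open>Exchange along cycles\<close>

text \<open>Infinite costs are replaced by a number that exceeds the cost of every set of arcs of
  finite cost.\<close>

definition big_cost :: "nat \<Rightarrow> (nat \<Rightarrow> nat \<Rightarrow> enat) \<Rightarrow> int" where
  "big_cost n d = 1 + (\<Sum>u<n. \<Sum>v<n. case d u v of enat k \<Rightarrow> int k | \<infinity> \<Rightarrow> 0)"

definition int_cost :: "nat \<Rightarrow> (nat \<Rightarrow> nat \<Rightarrow> enat) \<Rightarrow> nat \<Rightarrow> nat \<Rightarrow> int" where
  "int_cost n d u v = (case d u v of enat k \<Rightarrow> int k | \<infinity> \<Rightarrow> big_cost n d)"

lemma big_cost_pos: "0 < big_cost n d"
proof -
  have "0 \<le> (\<Sum>u<n. \<Sum>v<n. case d u v of enat k \<Rightarrow> int k | \<infinity> \<Rightarrow> 0)"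
    by (intro sum_nonneg) (auto split: enat.splits)
  then show ?thesis by (simp add: big_cost_def)
qed

lemma int_cost_nonneg: "0 \<le> int_cost n d u v"
  using big_cost_pos[of n d] by (auto simp: int_cost_def split: enat.splits)

lemma cost_eq_infinity:
  assumes "u < n" "v < n" "d u v = \<infinity>" "m u v > 0"
  shows "cost n d m = \<infinity>"
proof -
  have "d u v * enat (m u v) = \<infinity>" using assms by (simp add: imult_is_infinity zero_enat_def)
  then have "(\<Sum>w<n. d u w * enat (m u w)) = \<infinity>"
    using assms member_le_sum[of v "{..<n}" "\<lambda>w. d u w * enat (m u w)"] by simp
  then show ?thesis
    using assms member_le_sum[of u "{..<n}" "\<lambda>u. \<Sum>w<n. d u w * enat (m u w)"]
    by (simp add: cost_def)
qed

text \<open>The stand-in for infinity is multiplied by \<open>0\<close> wherever it occurs.\<close>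

lemma cost_eq_int_cost:
  assumes "\<And>u v. u < n \<Longrightarrow> v < n \<Longrightarrow> d u v = \<infinity> \<Longrightarrow> m u v = 0"
  shows "cost n d m = enat (nat (\<Sum>u<n. \<Sum>v<n. int_cost n d u v * int (m u v)))"
proof -
  have *: "d u v * enat (m u v) = enat (nat (int_cost n d u v * int (m u v)))"
    if "u < n" "v < n" for u v
    using assms[OF that]
    by (cases "d u v") (auto simp: int_cost_def nat_mult_distrib zero_enat_def)
  have "cost n d m = (\<Sum>u<n. \<Sum>v<n. enat (nat (int_cost n d u v * int (m u v))))"
    unfolding cost_def by (intro sum.cong refl) (use * in auto)
  also have "\<dots> = enat (\<Sum>u<n. \<Sum>v<n. nat (int_cost n d u v * int (m u v)))"
    by (simp flip: of_nat_eq_enat of_nat_sum)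
  also have "(\<Sum>u<n. \<Sum>v<n. nat (int_cost n d u v * int (m u v))) =
      nat (\<Sum>u<n. \<Sum>v<n. int_cost n d u v * int (m u v))"
  proof -
    have "int (\<Sum>u<n. \<Sum>v<n. nat (int_cost n d u v * int (m u v))) =
        (\<Sum>u<n. \<Sum>v<n. int_cost n d u v * int (m u v))"
      by (simp add: int_cost_nonneg)
    then show ?thesis by linarith
  qed
  finally show ?thesis .
qed

text \<open>On a set \<open>W\<close> that is minimal with this property, every successor map is surjective.\<close>

lemma ex_permutation_along_relation:
  assumes "finite W0" "W0 \<noteq> {}" "\<forall>x\<in>W0. \<exists>y\<in>W0. (x, y) \<in> E"
  obtains W nxt where "W \<subseteq> W0" "W \<noteq> {}" "bij_betw nxt W W" "\<And>x. x \<in> W \<Longrightarrow> (x, nxt x) \<in> E"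
proof -
  let ?P = "\<lambda>W. W \<subseteq> W0 \<and> W \<noteq> {} \<and> (\<forall>x\<in>W. \<exists>y\<in>W. (x, y) \<in> E)"
  obtain W where W: "?P W" and min: "\<And>W'. ?P W' \<Longrightarrow> card W \<le> card W'"
    using ex_has_least_nat[of ?P W0 card] assms by auto
  obtain nxt where nxt: "\<forall>x\<in>W. nxt x \<in> W \<and> (x, nxt x) \<in> E"
    using W bchoice[of W "\<lambda>x y. y \<in> W \<and> (x, y) \<in> E"] by blast
  have fin: "finite W" using W assms(1) finite_subset by blast
  have sub: "nxt ` W \<subseteq> W" using nxt by auto
  have "?P (nxt ` W)" using W sub nxt by blast
  then have "card W \<le> card (nxt ` W)" by (rule min)
  then have eq: "card (nxt ` W) = card W" using card_image_le[OF fin, of nxt] by linarith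
  then have "inj_on nxt W" using eq_card_imp_inj_on fin by blast
  moreover have "nxt ` W = W" using card_subset_eq[OF fin sub eq] .
  ultimately have "bij_betw nxt W W" by (simp add: bij_betw_def)
  then show ?thesis using that[of W nxt] W nxt by blast
qed

text \<open>Linear programming duality for the transportation problem:
  \<open>c u v - y u - z v\<close> is the reduced cost of an arc, and \<open>tight\<close> is
  complementary slackness. Optimality of \<open>r\<close> is never stated; the exchange argument
  works with the reduced costs directly.\<close>

locale transport_duals =
  fixes n :: nat and c :: "nat \<Rightarrow> nat \<Rightarrow> int" and y z :: "nat \<Rightarrow> int" and r :: "nat \<Rightarrow> nat \<Rightarrow> nat"
  assumes feasible: "\<And>u v. u < n \<Longrightarrow> v < n \<Longrightarrow> 0 \<le> c u v - y u - z v"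
    and tight: "\<And>u v. u < n \<Longrightarrow> v < n \<Longrightarrow> 0 < r u v \<Longrightarrow> c u v - y u - z v = 0"
begin

definition same_degrees :: "(nat \<Rightarrow> nat \<Rightarrow> nat) \<Rightarrow> bool" where
  "same_degrees m \<longleftrightarrow> (\<forall>u<n. (\<Sum>v<n. m u v) = (\<Sum>v<n. r u v)) \<and>
    (\<forall>v<n. (\<Sum>u<n. m u v) = (\<Sum>u<n. r u v))"

text \<open>The arcs along which \<open>m\<close> can be moved towards \<open>r\<close> without emptying
  an arc of \<open>A\<close>. A vertex occurs as \<open>Inl\<close> in its role as a tail and as \<open>Inr\<close> in its role as a head.\<close>

definition residual :: "(nat \<times> nat) set \<Rightarrow> (nat \<Rightarrow> nat \<Rightarrow> nat) \<Rightarrow> ((nat + nat) \<times> (nat + nat)) set" where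
  "residual A m =
    {(Inl u, Inr v) | u v. u < n \<and> v < n \<and> r u v < m u v \<and> \<not> ((u, v) \<in> A \<and> m u v = 1)} \<union>
    {(Inr v, Inl u) | u v. u < n \<and> v < n \<and> m u v < r u v}"

text \<open>Only exhausted arcs of \<open>A\<close> leave the set reachable from \<open>u0\<close>, and they carry one unit each,
  so the set cannot be entered by more than \<open>card A\<close> units.\<close>

lemma residual_reaches:
  assumes deg: "same_degrees m" and A: "finite A" "card A \<le> s"
    and uv: "u0 < n" "v0 < n" "m u0 v0 + s < r u0 v0"
  shows "(Inl u0, Inr v0) \<in> (residual A m)\<^sup>*"
proof (rule ccontr)
  let ?E = "residual A m"
  assume nreach: "(Inl u0, Inr v0) \<notin> ?E\<^sup>*"
  define X where "X = ?E\<^sup>* `` {Inl u0}"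
  define XR where "XR = {u. u < n \<and> Inl u \<in> X}"
  define XC where "XC = {v. v < n \<and> Inr v \<in> X}"
  define g where "g u v = int (m u v) - int (r u v)" for u v
  have step: "y \<in> X" if "x \<in> X" "(x, y) \<in> ?E" for x y
    using that by (auto simp: X_def intro: rtrancl_into_rtrancl)
  have sub: "XR \<subseteq> {..<n}" "XC \<subseteq> {..<n}" by (auto simp: XR_def XC_def)
  have fin: "finite XR" "finite XC" using sub finite_subset by blast+
  have u0: "u0 \<in> XR" using uv by (simp add: XR_def X_def)
  have v0: "v0 \<notin> XC" using nreach by (simp add: XC_def X_def)
  have row: "(\<Sum>v<n. g u v) = 0" if "u < n" for u
    using deg that by (simp add: g_def same_degrees_def sum_subtractf flip: of_nat_sum)
  have col: "(\<Sum>u<n. g u v) = 0" if "v < n" for v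
    using deg that by (simp add: g_def same_degrees_def sum_subtractf flip: of_nat_sum)
  have r0: "(\<Sum>u\<in>XR. \<Sum>v<n. g u v) = 0" using row sub by (intro sum.neutral) auto
  have c0: "(\<Sum>v\<in>XC. \<Sum>u<n. g u v) = 0" using col sub by (intro sum.neutral) auto
  have split1: "(\<Sum>v<n. g u v) = (\<Sum>v\<in>XC. g u v) + (\<Sum>v\<in>{..<n}-XC. g u v)" for u
    using sum.subset_diff[of XC "{..<n}" "\<lambda>v. g u v"] sub by simp
  have split2: "(\<Sum>u<n. g u v) = (\<Sum>u\<in>XR. g u v) + (\<Sum>u\<in>{..<n}-XR. g u v)" for v
    using sum.subset_diff[of XR "{..<n}" "\<lambda>u. g u v"] sub by simp
  \<comment> \<open>Rows and columns of \<open>g\<close> add up to 0, so both sides are minus the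
    sum over \<open>XR\<close> and \<open>XC\<close>: what leaves the reached set equals what enters
    it.\<close>
  have "(\<Sum>u\<in>XR. \<Sum>v\<in>{..<n}-XC. g u v) = (\<Sum>v\<in>XC. \<Sum>u\<in>{..<n}-XR. g u v)"
    using r0 c0 unfolding split1 split2 sum.distrib
    using sum.swap[of "\<lambda>u v. g u v" XC XR] by linarith
  moreover have "0 \<le> (\<Sum>v\<in>XC. \<Sum>u\<in>{..<n}-XR. g u v)"
  proof (intro sum_nonneg)
    fix v u assume *: "v \<in> XC" "u \<in> {..<n} - XR"
    have "\<not> m u v < r u v"
      using * step[of "Inr v" "Inl u"] by (auto simp: XC_def XR_def residual_def)
    then show "0 \<le> g u v" by (simp add: g_def)
  qed
  \<comment> \<open>A surplus leaves the set only on arcs of \<open>A\<close>, one unit each,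
    whereas \<open>(u0, v0)\<close> accounts for at least \<open>s + 1\<close> units of deficit. The
    total is negative, against the lower bound just shown.\<close>
  moreover have "(\<Sum>u\<in>XR. \<Sum>v\<in>{..<n}-XC. g u v) \<le>
      (\<Sum>u\<in>XR. \<Sum>v\<in>{..<n}-XC. of_bool ((u, v) \<in> A) - (if (u, v) = (u0, v0) then int s + 1 else 0))"
  proof (intro sum_mono)
    fix u v assume *: "u \<in> XR" "v \<in> {..<n} - XC"
    have "\<not> r u v < m u v \<or> (u, v) \<in> A \<and> m u v = 1"
      using * step[of "Inl u" "Inr v"] by (auto simp: XC_def XR_def residual_def)
    then show "g u v \<le> of_bool ((u, v) \<in> A) - (if (u, v) = (u0, v0) then int s + 1 else 0)"
      using uv(3) by (auto simp: g_def)
  qed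
  moreover have "(\<Sum>u\<in>XR. \<Sum>v\<in>{..<n}-XC. of_bool ((u, v) \<in> A)) \<le> int s"
  proof -
    have "(\<Sum>u\<in>XR. \<Sum>v\<in>{..<n}-XC. of_bool ((u, v) \<in> A)) =
        (\<Sum>p\<in>XR \<times> ({..<n}-XC). of_bool (p \<in> A) :: int)"
      unfolding sum.cartesian_product by (rule sum.cong) auto
    also have "\<dots> = int (card (XR \<times> ({..<n}-XC) \<inter> A))"
      using fin by (simp add: Int_def)
    also have "\<dots> \<le> int (card A)" using A(1) by (intro of_nat_mono card_mono) auto
    finally show ?thesis using A(2) by linarith
  qed
  moreover have "(\<Sum>u\<in>XR. \<Sum>v\<in>{..<n}-XC. if (u, v) = (u0, v0) then int s + 1 else 0) = int s + 1"
  proof -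
    have "(\<Sum>u\<in>XR. \<Sum>v\<in>{..<n}-XC. if (u, v) = (u0, v0) then int s + 1 else 0) =
        (\<Sum>p\<in>XR \<times> ({..<n}-XC). if p = (u0, v0) then int s + 1 else 0)"
      unfolding sum.cartesian_product by (rule sum.cong) (simp_all add: case_prod_beta prod_eq_iff)
    also have "\<dots> = int s + 1" using fin u0 v0 uv by (subst sum.delta) auto
    finally show ?thesis .
  qed
  ultimately show False by (simp add: sum_subtractf)
qed

text \<open>The deficient arc closes the walk given by \<open>residual_reaches\<close>, and a
  permutation along residual arcs moves one unit on each arc it uses towards \<open>r\<close>.
  Bijectivity preserves all degrees. Arcs that gain a unit have positive \<open>r\<close> and hence
  reduced cost 0, arcs that lose one have reduced cost at least 0, so the cost cannot rise.\<close>

lemma exchange_step: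
  assumes deg: "same_degrees m" and A: "finite A" "card A \<le> s" "covers n A m"
    and uv: "u0 < n" "v0 < n" "m u0 v0 + s < r u0 v0"
    and c: "c = int_cost n d"
  obtains m' where "same_degrees m'" "covers n A m'" "cost n d m' \<le> cost n d m"
    "(\<Sum>u<n. \<Sum>v<n. nat \<bar>int (m' u v) - int (r u v)\<bar>) < (\<Sum>u<n. \<Sum>v<n. nat \<bar>int (m u v) - int (r u v)\<bar>)"
proof -
  let ?E = "residual A m"
  have reach: "(Inl u0, Inr v0) \<in> ?E\<^sup>*"
    using residual_reaches[OF deg A(1,2) uv] .
  have closing: "(Inr v0, Inl u0) \<in> ?E" using uv by (auto simp: residual_def)
  \<comment> \<open>The vertices on walks from \<open>Inl u0\<close> to \<open>Inr v0\<close>. The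
    last of them continues with the closing arc, so every vertex of \<open>W0\<close> has a
    successor in \<open>W0\<close>.\<close>
  define W0 where "W0 = {x. (Inl u0, x) \<in> ?E\<^sup>* \<and> (x, Inr v0) \<in> ?E\<^sup>*}"
  have "W0 \<subseteq> Inl ` {..<n} \<union> Inr ` {..<n}"
  proof
    fix x assume "x \<in> W0"
    then have "(Inl u0, x) \<in> ?E\<^sup>*" by (simp add: W0_def)
    then show "x \<in> Inl ` {..<n} \<union> Inr ` {..<n}"
      by (cases rule: rtranclE) (use uv in \<open>auto simp: residual_def\<close>)
  qed
  then have "finite W0" by (rule finite_subset) simp
  moreover have "W0 \<noteq> {}" using reach by (auto simp: W0_def)
  moreover have "\<forall>x\<in>W0. \<exists>y\<in>W0. (x, y) \<in> ?E"
  proof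
    fix x assume x: "x \<in> W0"
    then have "(x, Inr v0) \<in> ?E\<^sup>*" by (simp add: W0_def)
    then show "\<exists>y\<in>W0. (x, y) \<in> ?E"
    proof (cases rule: converse_rtranclE)
      case base
      then show ?thesis using closing reach by (auto simp: W0_def)
    next
      case (step y)
      then show ?thesis using x by (auto simp: W0_def intro: rtrancl_into_rtrancl)
    qed
  qed
  ultimately obtain W nxt where W: "W \<subseteq> W0" "W \<noteq> {}" "bij_betw nxt W W"
      and E: "\<And>x. x \<in> W \<Longrightarrow> (x, nxt x) \<in> ?E"
    by (rule ex_permutation_along_relation) blast
  \<comment> \<open>\<open>P\<close> holds for the arcs that lose a unit, \<open>Q\<close> for those
    that gain one.\<close>
  define P where "P u v \<longleftrightarrow> Inl u \<in> W \<and> nxt (Inl u) = Inr v" for u v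
  define Q where "Q u v \<longleftrightarrow> Inr v \<in> W \<and> nxt (Inr v) = Inl u" for u v
  have P: "u < n" "v < n" "r u v < m u v" "\<not> ((u, v) \<in> A \<and> m u v = 1)" if "P u v" for u v
    using that E[of "Inl u"] by (auto simp: P_def residual_def)
  have Q: "u < n" "v < n" "m u v < r u v" if "Q u v" for u v
    using that E[of "Inr v"] by (auto simp: Q_def residual_def)
  have inj: "inj_on nxt W" and img: "nxt ` W = W"
    using W(3) by (auto simp: bij_betw_def)
  have Pex: "\<exists>v. P u v" if "Inl u \<in> W" for u
    using E[OF that] that by (auto simp: P_def residual_def)
  have Qex: "\<exists>u. Q u v" if "Inr v \<in> W" for v
    using E[OF that] that by (auto simp: Q_def residual_def)
  have Pex': "\<exists>u. P u v" if "Inr v \<in> W" for v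
  proof -
    obtain x where "x \<in> W" "nxt x = Inr v" using img \<open>Inr v \<in> W\<close> by (metis imageE)
    then show ?thesis using E[of x] by (cases x) (auto simp: P_def residual_def)
  qed
  have Qex': "\<exists>v. Q u v" if "Inl u \<in> W" for u
  proof -
    obtain x where "x \<in> W" "nxt x = Inl u" using img \<open>Inl u \<in> W\<close> by (metis imageE)
    then show ?thesis using E[of x] by (cases x) (auto simp: Q_def residual_def)
  qed
  have PW: "Inl u \<in> W \<and> Inr v \<in> W" if "P u v" for u v
    using that img unfolding P_def by (metis imageI)
  have QW: "Inl u \<in> W \<and> Inr v \<in> W" if "Q u v" for u v
    using that img unfolding Q_def by (metis imageI)
  have Pu: "P u v \<Longrightarrow> P u v' \<Longrightarrow> v = v'" for u v v' by (simp add: P_def)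
  have Pu': "P u v \<Longrightarrow> P u' v \<Longrightarrow> u = u'" for u v u'
    using inj_onD[OF inj, of "Inl u" "Inl u'"] by (simp add: P_def)
  have Qu: "Q u v \<Longrightarrow> Q u' v \<Longrightarrow> u = u'" for u v u' by (simp add: Q_def)
  have Qu': "Q u v \<Longrightarrow> Q u v' \<Longrightarrow> v = v'" for u v v'
    using inj_onD[OF inj, of "Inr v" "Inr v'"] by (simp add: Q_def)
  have Prow: "(\<Sum>v<n. of_bool (P u v)) = (of_bool (Inl u \<in> W) :: int)" for u
  proof (cases "Inl u \<in> W")
    case True
    then obtain v where v: "P u v" using Pex by blast
    have "(\<Sum>v<n. of_bool (P u v)) = (1::int)"
      by (rule sum_of_bool_unique[of v]) (use P(2)[OF v] v Pu in \<open>simp | blast\<close>)+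
    then show ?thesis using True by simp
  qed (use PW in \<open>auto intro!: sum_of_bool_none\<close>)
  have Qrow: "(\<Sum>v<n. of_bool (Q u v)) = (of_bool (Inl u \<in> W) :: int)" for u
  proof (cases "Inl u \<in> W")
    case True
    then obtain v where v: "Q u v" using Qex' by blast
    have "(\<Sum>v<n. of_bool (Q u v)) = (1::int)"
      by (rule sum_of_bool_unique[of v]) (use Q(2)[OF v] v Qu' in \<open>simp | blast\<close>)+
    then show ?thesis using True by simp
  qed (use QW in \<open>auto intro!: sum_of_bool_none\<close>)
  have Pcol: "(\<Sum>u<n. of_bool (P u v)) = (of_bool (Inr v \<in> W) :: int)" for v
  proof (cases "Inr v \<in> W")
    case True
    then obtain u where u: "P u v" using Pex' by blast
    have "(\<Sum>u<n. of_bool (P u v)) = (1::int)"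
      by (rule sum_of_bool_unique[of u]) (use P(1)[OF u] u Pu' in \<open>simp | blast\<close>)+
    then show ?thesis using True by simp
  qed (use PW in \<open>auto intro!: sum_of_bool_none\<close>)
  have Qcol: "(\<Sum>u<n. of_bool (Q u v)) = (of_bool (Inr v \<in> W) :: int)" for v
  proof (cases "Inr v \<in> W")
    case True
    then obtain u where u: "Q u v" using Qex by blast
    have "(\<Sum>u<n. of_bool (Q u v)) = (1::int)"
      by (rule sum_of_bool_unique[of u]) (use Q(1)[OF u] u Qu in \<open>simp | blast\<close>)+
    then show ?thesis using True by simp
  qed (use QW in \<open>auto intro!: sum_of_bool_none\<close>)
  have PQ: "\<not> Q u v" if "P u v" for u v using P[OF that] Q[of u v] by auto
  define \<delta> :: "nat \<Rightarrow> nat \<Rightarrow> int" where "\<delta> u v = of_bool (Q u v) - of_bool (P u v)" for u v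
  define m' where "m' u v = nat (int (m u v) + \<delta> u v)" for u v
  have m': "int (m' u v) = int (m u v) + \<delta> u v" for u v
    using P[of u v] by (auto simp: m'_def \<delta>_def)
  have drow: "(\<Sum>v<n. \<delta> u v) = 0" and dcol: "(\<Sum>u<n. \<delta> u v) = 0" for u v
    by (simp_all only: \<delta>_def sum_subtractf Prow Qrow Pcol Qcol diff_self)
  have row': "(\<Sum>v<n. m' u v) = (\<Sum>v<n. m u v)" for u
  proof -
    have "int (\<Sum>v<n. m' u v) = int (\<Sum>v<n. m u v)" by (simp add: m' sum.distrib drow)
    then show ?thesis by linarith
  qed
  have col': "(\<Sum>u<n. m' u v) = (\<Sum>u<n. m u v)" for v
  proof -
    have "int (\<Sum>u<n. m' u v) = int (\<Sum>u<n. m u v)" by (simp add: m' sum.distrib dcol)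
    then show ?thesis by linarith
  qed
  have deg': "same_degrees m'" using deg by (simp add: same_degrees_def row' col')
  have covers': "covers n A m'"
  proof -
    have "0 < m' u v" if "(u, v) \<in> A" for u v
    proof -
      have "0 < m u v" using A(3) that by (auto simp: covers_def)
      then have "0 < int (m' u v)" using P(4)[of u v] that unfolding m' \<delta>_def
        by (cases "P u v") auto
      then show ?thesis by simp
    qed
    then show ?thesis using A(3) by (auto simp: covers_def)
  qed
  \<comment> \<open>A changed arc moves by one unit and cannot overshoot, since \<open>m\<close> and
    \<open>r\<close> differ there in the right direction.\<close>
  have dist: "nat \<bar>int (m' u v) - int (r u v)\<bar> + of_bool (P u v \<or> Q u v)
      = nat \<bar>int (m u v) - int (r u v)\<bar>" for u v
    using P(3)[of u v] Q(3)[of u v] unfolding m' \<delta>_def by (auto simp: of_bool_def)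
  have "\<exists>u v. P u v \<or> Q u v"
  proof -
    obtain x where "x \<in> W" using W(2) by blast
    then show ?thesis using Pex Qex by (cases x) blast+
  qed
  then obtain u1 v1 where 1: "P u1 v1 \<or> Q u1 v1" by blast
  then have u1: "u1 < n" "v1 < n" using P Q by blast+
  have dlt: "(\<Sum>u<n. \<Sum>v<n. nat \<bar>int (m' u v) - int (r u v)\<bar>)
      < (\<Sum>u<n. \<Sum>v<n. nat \<bar>int (m u v) - int (r u v)\<bar>)"
  proof (rule sum_strict_mono_ex1)
    have le: "nat \<bar>int (m' u v) - int (r u v)\<bar> \<le> nat \<bar>int (m u v) - int (r u v)\<bar>" for u v
      using dist[of u v] by linarith
    then show "\<forall>u\<in>{..<n}. (\<Sum>v<n. nat \<bar>int (m' u v) - int (r u v)\<bar>)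
        \<le> (\<Sum>v<n. nat \<bar>int (m u v) - int (r u v)\<bar>)"
      by (intro ballI sum_mono)
    have "nat \<bar>int (m' u1 v1) - int (r u1 v1)\<bar> < nat \<bar>int (m u1 v1) - int (r u1 v1)\<bar>"
      using dist[of u1 v1] 1 by auto
    then have "(\<Sum>v<n. nat \<bar>int (m' u1 v) - int (r u1 v)\<bar>)
        < (\<Sum>v<n. nat \<bar>int (m u1 v) - int (r u1 v)\<bar>)"
      by (intro sum_strict_mono_ex1 ballI bexI[of _ v1]) (use u1 le in simp_all)
    then show "\<exists>u\<in>{..<n}. (\<Sum>v<n. nat \<bar>int (m' u v) - int (r u v)\<bar>)
        < (\<Sum>v<n. nat \<bar>int (m u v) - int (r u v)\<bar>)"
      using u1 by blast
  qed simp
  have cost': "cost n d m' \<le> cost n d m"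
  proof (cases "\<exists>u v. u < n \<and> v < n \<and> d u v = \<infinity> \<and> m u v > 0")
    case True
    then show ?thesis using cost_eq_infinity[of _ n _ d m] by auto
  next
    case False
    then have fin: "m u v = 0" if "u < n" "v < n" "d u v = \<infinity>" for u v
      using that by (metis gr0I)
    \<comment> \<open>The prices are constant along rows or columns, where \<delta> adds up to
      0.\<close>
    have red: "(\<Sum>u<n. \<Sum>v<n. c u v * \<delta> u v) = (\<Sum>u<n. \<Sum>v<n. (c u v - y u - z v) * \<delta> u v)"
    proof -
      have "(\<Sum>u<n. \<Sum>v<n. y u * \<delta> u v) = 0"
        by (simp add: drow flip: sum_distrib_left)
      moreover have "(\<Sum>u<n. \<Sum>v<n. z v * \<delta> u v) = 0"
        by (subst sum.swap) (simp add: dcol flip: sum_distrib_left)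
      ultimately show ?thesis by (simp add: left_diff_distrib sum_subtractf)
    qed
    have "(\<Sum>u<n. \<Sum>v<n. (c u v - y u - z v) * \<delta> u v) \<le> 0"
    proof (intro sum_nonpos)
      fix u v assume "u \<in> {..<n}" "v \<in> {..<n}"
      then show "(c u v - y u - z v) * \<delta> u v \<le> 0"
        using feasible[of u v] tight[of u v] Q(3)[of u v] by (auto simp: \<delta>_def of_bool_def)
    qed
    then have le: "(\<Sum>u<n. \<Sum>v<n. c u v * \<delta> u v) \<le> 0" using red by simp
    \<comment> \<open>The losing arcs are distinct and carry flow of \<open>m\<close>, so their
      costs are finite and add up to less than \<open>big_cost\<close>. Hence the gaining arcs cost
      less than that too, and none of them can be infinite.\<close>
    have QP: "(\<Sum>u<n. \<Sum>v<n. c u v * of_bool (Q u v)) \<le> (\<Sum>u<n. \<Sum>v<n. c u v * of_bool (P u v))"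
      using le by (simp add: \<delta>_def right_diff_distrib sum_subtractf)
    also have "\<dots> \<le> (\<Sum>u<n. \<Sum>v<n. case d u v of enat k \<Rightarrow> int k | \<infinity> \<Rightarrow> 0)"
    proof (intro sum_mono)
      fix u v assume uv: "u \<in> {..<n}" "v \<in> {..<n}"
      show "c u v * of_bool (P u v) \<le> (case d u v of enat k \<Rightarrow> int k | \<infinity> \<Rightarrow> 0)"
        using fin[of u v] P(3)[of u v] uv
        by (cases "d u v") (auto simp: c int_cost_def of_bool_def)
    qed
    also have "\<dots> < big_cost n d" by (simp add: big_cost_def)
    finally have small: "(\<Sum>u<n. \<Sum>v<n. c u v * of_bool (Q u v)) < big_cost n d" .
    have Qfin: "d u v \<noteq> \<infinity>" if "Q u v" for u v
    proof
      assume "d u v = \<infinity>"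
      then have "big_cost n d = c u v * of_bool (Q u v)" using that by (simp add: c int_cost_def)
      also have "\<dots> \<le> (\<Sum>v<n. c u v * of_bool (Q u v))"
        using Q[OF that] by (intro member_le_sum) (auto simp: c int_cost_nonneg)
      also have "\<dots> \<le> (\<Sum>u<n. \<Sum>v<n. c u v * of_bool (Q u v))"
        using Q[OF that]
        by (intro member_le_sum[of u _ "\<lambda>u. \<Sum>v<n. c u v * of_bool (Q u v)"])
           (auto simp: c int_cost_nonneg intro!: sum_nonneg)
      finally show False using small by simp
    qed
    have fin': "m' u v = 0" if "u < n" "v < n" "d u v = \<infinity>" for u v
      using fin[OF that] Qfin[of u v] P(3)[of u v] that by (auto simp: m'_def \<delta>_def)
    have "(\<Sum>u<n. \<Sum>v<n. c u v * int (m' u v)) =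
        (\<Sum>u<n. \<Sum>v<n. c u v * int (m u v)) + (\<Sum>u<n. \<Sum>v<n. c u v * \<delta> u v)"
      by (simp add: m' distrib_left sum.distrib)
    then have "(\<Sum>u<n. \<Sum>v<n. c u v * int (m' u v)) \<le> (\<Sum>u<n. \<Sum>v<n. c u v * int (m u v))"
      using le by simp
    moreover have "cost n d m = enat (nat (\<Sum>u<n. \<Sum>v<n. c u v * int (m u v)))"
      unfolding c by (rule cost_eq_int_cost) (rule fin)
    moreover have "cost n d m' = enat (nat (\<Sum>u<n. \<Sum>v<n. c u v * int (m' u v)))"
      unfolding c by (rule cost_eq_int_cost) (rule fin')
    ultimately show ?thesis by (simp only: enat_ord_simps nat_mono)
  qed
  show ?thesis using that[OF deg' covers' cost' dlt] .
qed

text \<open>Exchanging at an entry that violates the bound terminates, because the L1 distance to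
  \<open>r\<close> falls each time.\<close>

lemma proximity:
  assumes "same_degrees m" and A: "finite A" "card A \<le> s" and "covers n A m"
    and c: "c = int_cost n d"
  shows "\<exists>m'. same_degrees m' \<and> covers n A m' \<and> cost n d m' \<le> cost n d m \<and>
    (\<forall>u<n. \<forall>v<n. r u v \<le> m' u v + s)"
  using assms(1,4)
proof (induction "\<Sum>u<n. \<Sum>v<n. nat \<bar>int (m u v) - int (r u v)\<bar>" arbitrary: m rule: less_induct)
  case less
  show ?case
  proof (cases "\<forall>u<n. \<forall>v<n. r u v \<le> m u v + s")
    case True
    then show ?thesis using less.prems by blast
  next
    case False
    then obtain u0 v0 where uv: "u0 < n" "v0 < n" "m u0 v0 + s < r u0 v0" by (auto simp: not_le)
    obtain m1 where m1: "same_degrees m1" "covers n A m1" "cost n d m1 \<le> cost n d m"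
      "(\<Sum>u<n. \<Sum>v<n. nat \<bar>int (m1 u v) - int (r u v)\<bar>) < (\<Sum>u<n. \<Sum>v<n. nat \<bar>int (m u v) - int (r u v)\<bar>)"
      by (rule exchange_step[OF less.prems(1) A less.prems(2) uv c])
    from less.hyps[OF m1(4) m1(1,2)] m1(3) show ?thesis by (meson order_trans)
  qed
qed

end

subsection \<open>The reduced instance\<close>

text \<open>A competitor in the original instance is first moved close to \<open>r\<close> without
  raising its cost. Then \<open>f\<close> can be subtracted from it, and the difference competes
  with \<open>m\<close> in the reduced instance. Adding the cost of \<open>f\<close> carries the
  comparison back.\<close>

lemma optimal_lift:
  assumes duals: "transport_duals n (int_cost n d) y z r"
    and F: "\<forall>G\<in>F. pair_digraph G"
    and ind: "\<And>v. v < n \<Longrightarrow> (\<Sum>u<n. r u v) = ind v"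
    and outd: "\<And>u. u < n \<Longrightarrow> (\<Sum>v<n. r u v) = outd u"
    and f: "\<And>u v. u < n \<Longrightarrow> v < n \<Longrightarrow> f u v = r u v - 2 * max_arcs F n"
    and ind': "\<And>v. v < n \<Longrightarrow> ind' v = (\<Sum>u<n. r u v - f u v)"
    and outd': "\<And>u. u < n \<Longrightarrow> outd' u = (\<Sum>v<n. r u v - f u v)"
    and opt: "is_optimal F n d ind' outd' m"
  shows "is_optimal F n d ind outd (\<lambda>u v. f u v + m u v)"
proof -
  interpret transport_duals n "int_cost n d" y z r by fact
  let ?s = "max_arcs F n"
  have fr: "f u v \<le> r u v" if "u < n" "v < n" for u v using f[OF that] by simp
  have col: "(\<Sum>u<n. f u v) + ind' v = ind v" if "v < n" for v
    using fr that unfolding ind'[OF that] ind[OF that, symmetric] by (simp flip: sum.distrib)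
  have row: "(\<Sum>v<n. f u v) + outd' u = outd u" if "u < n" for u
    using fr that unfolding outd'[OF that] outd[OF that, symmetric] by (simp flip: sum.distrib)
  have sol: "is_solution F n ind' outd' m" using opt by (simp add: is_optimal_def)
  have "is_solution F n ind outd (\<lambda>u v. f u v + m u v)"
    using sol col row unfolding is_solution_iff covers_def by (fastforce simp: sum.distrib)
  moreover have "cost n d (\<lambda>u v. f u v + m u v) \<le> cost n d m'"
    if m': "is_solution F n ind outd m'" for m'
  proof -
    from m' obtain A where A: "member_support F n A" "covers n A m'"
      unfolding is_solution_iff by blast
    have "same_degrees m'" using m' ind outd by (simp add: same_degrees_def is_solution_iff)
    from proximity[OF this card_member_support[OF F A(1)] A(2) refl]
    obtain m2 where m2: "same_degrees m2" "covers n A m2" "cost n d m2 \<le> cost n d m'"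
        "\<forall>u<n. \<forall>v<n. r u v \<le> m2 u v + ?s" by blast
    define m3 where "m3 u v = (if u < n \<and> v < n then m2 u v - f u v else 0)" for u v
    have fm: "f u v \<le> m2 u v" if "u < n" "v < n" for u v
      using m2(4) that f[OF that] by (metis diff_le_mono le_diff_conv mult_2 diff_diff_left le_trans diff_le_self)
    \<comment> \<open>Where \<open>f\<close> is positive, \<open>m2 - f\<close> is at least
      \<open>(r - s) - (r - 2 * s) = s\<close>; this is what the second \<open>s\<close> is for. It
      is positive unless \<open>s = 0\<close>, and then \<open>A\<close> is empty.\<close>
    have cov: "covers n A m3"
    proof (cases "?s = 0")
      case True
      then have "A = {}" using card_member_support[OF F A(1)] by simp
      then show ?thesis by (simp add: covers_def)
    next
      case False
      have "0 < m2 u v - f u v" if "(u, v) \<in> A" "u < n" "v < n" for u v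
        using m2(4) m2(2) that f[OF that(2,3)] False by (fastforce simp: covers_def)
      then show ?thesis using m2(2) by (auto simp: covers_def m3_def)
    qed
    have m3: "f u v + m3 u v = m2 u v" if "u < n" "v < n" for u v
      using fm[OF that] that by (simp add: m3_def)
    have "(\<Sum>u<n. m3 u v) = ind' v" if "v < n" for v
    proof -
      have "(\<Sum>u<n. f u v) + (\<Sum>u<n. m3 u v) = (\<Sum>u<n. m2 u v)"
        using m3 that by (simp flip: sum.distrib)
      also have "\<dots> = ind v" using m2(1) that ind by (simp add: same_degrees_def)
      finally show ?thesis using col[OF that] by simp
    qed
    moreover have "(\<Sum>v<n. m3 u v) = outd' u" if "u < n" for u
    proof -
      have "(\<Sum>v<n. f u v) + (\<Sum>v<n. m3 u v) = (\<Sum>v<n. m2 u v)"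
        using m3 that by (simp flip: sum.distrib)
      also have "\<dots> = outd u" using m2(1) that outd by (simp add: same_degrees_def)
      finally show ?thesis using row[OF that] by simp
    qed
    ultimately have "is_solution F n ind' outd' m3"
      using A(1) cov unfolding is_solution_iff by blast
    then have "cost n d m \<le> cost n d m3" using opt by (simp add: is_optimal_def)
    then have "cost n d (\<lambda>u v. f u v + m u v) \<le> cost n d (\<lambda>u v. f u v + m3 u v)"
      by (simp add: cost_add add_left_mono)
    also have "\<dots> = cost n d m2"
      unfolding cost_def by (intro sum.cong refl) (simp add: m3)
    also have "\<dots> \<le> cost n d m'" by fact
    finally show ?thesis .
  qed
  ultimately show ?thesis by (simp add: is_optimal_def)
qed

text \<open>Both sums would count all arcs. For unbalanced degrees, claims about all optimal
  solutions are therefore vacuous.\<close>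

lemma not_optimal_unbalanced:
  assumes "(\<Sum>v<n. ind v) \<noteq> (\<Sum>u<n. outd u)"
  shows "\<not> is_optimal F n d ind outd m"
proof
  assume "is_optimal F n d ind outd m"
  then have "(\<Sum>v<n. \<Sum>u<n. m u v) = (\<Sum>v<n. ind v)" "(\<Sum>u<n. \<Sum>v<n. m u v) = (\<Sum>u<n. outd u)"
    by (auto simp: is_optimal_def is_solution_iff)
  then show False using assms sum.swap[of m "{..<n}" "{..<n}"] by simp
qed

subsection \<open>Structured programs and their running time\<close>

abbreviation V :: "vname \<Rightarrow> aexp" where "V x \<equiv> Idx x (N 0)"

text \<open>\<open>HFor i c\<close> runs \<open>c\<close> for \<open>i = 0, \<dots>, n - 1\<close>, where \<open>n\<close> is the number of vertices.\<close>

datatype hcom =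
    HSkip
  | HAssign vname aexp aexp
  | HSeq hcom hcom  (infixr \<open>;;\<close> 60)
  | HIf bexp hcom hcom
  | HFor vname hcom

primrec comp :: "hcom \<Rightarrow> com" where
  "comp HSkip = Skip"
| "comp (HAssign x a b) = Assign x a b"
| "comp (c1 ;; c2) = Seq (comp c1) (comp c2)"
| "comp (HIf b c1 c2) = If b (comp c1) (comp c2)"
| "comp (HFor i c) = Seq (Assign i (N 0) (N 0))
    (While (Less (V i) (V ''n'')) (Seq (comp c) (Assign i (N 0) (Add (V i) (N 1)))))"

definition upd :: "vname \<Rightarrow> int \<Rightarrow> int \<Rightarrow> state \<Rightarrow> state" where
  "upd x i a \<sigma> = \<sigma>(x := (\<sigma> x)(i := a))"

lemma upd_same [simp]: "upd x i a \<sigma> x = (\<sigma> x)(i := a)"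
  by (simp add: upd_def)

lemma upd_other [simp]: "y \<noteq> x \<Longrightarrow> upd x i a \<sigma> y = \<sigma> y"
  by (simp add: upd_def)

text \<open>The number of iterations of \<open>HFor\<close> is fixed on entry, so the semantics is a
  total function, which \<open>While\<close> rules out for \<open>com\<close>.\<close>

primrec sem :: "hcom \<Rightarrow> state \<Rightarrow> state" where
  "sem HSkip = (\<lambda>\<sigma>. \<sigma>)"
| "sem (HAssign x a b) = (\<lambda>\<sigma>. upd x (aval a \<sigma>) (aval b \<sigma>) \<sigma>)"
| "sem (c1 ;; c2) = (\<lambda>\<sigma>. sem c2 (sem c1 \<sigma>))"
| "sem (HIf b c1 c2) = (\<lambda>\<sigma>. if bval b \<sigma> then sem c1 \<sigma> else sem c2 \<sigma>)"
| "sem (HFor i c) = (\<lambda>\<sigma>. ((\<lambda>\<tau>. upd i 0 (sem c \<tau> i 0 + 1) (sem c \<tau>)) ^^ nat (\<sigma> ''n'' 0)) (upd i 0 0 \<sigma>))"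

primrec mods :: "hcom \<Rightarrow> vname list" where
  "mods HSkip = []"
| "mods (HAssign x a b) = [x]"
| "mods (c1 ;; c2) = mods c1 @ mods c2"
| "mods (HIf b c1 c2) = mods c1 @ mods c2"
| "mods (HFor i c) = i # mods c"

text \<open>As the body leaves the counter and \<open>n\<close> alone, the compiled
  \<open>While\<close> performs exactly the iterations that \<open>sem\<close> counts.\<close>

primrec wf_hcom :: "hcom \<Rightarrow> bool" where
  "wf_hcom HSkip \<longleftrightarrow> True"
| "wf_hcom (HAssign x a b) \<longleftrightarrow> True"
| "wf_hcom (c1 ;; c2) \<longleftrightarrow> wf_hcom c1 \<and> wf_hcom c2"
| "wf_hcom (HIf b c1 c2) \<longleftrightarrow> wf_hcom c1 \<and> wf_hcom c2"
| "wf_hcom (HFor i c) \<longleftrightarrow> wf_hcom c \<and> i \<notin> set (mods c) \<and> ''n'' \<notin> set (i # mods c)"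

lemma funpow_invariant: "P x \<Longrightarrow> (\<And>y. P y \<Longrightarrow> P (f y)) \<Longrightarrow> P ((f ^^ k) x)"
  by (induction k) auto

lemma sem_frame: "x \<notin> set (mods c) \<Longrightarrow> sem c \<sigma> x = \<sigma> x"
proof (induction c arbitrary: \<sigma>)
  case (HFor i c)
  let ?f = "\<lambda>\<tau>. upd i 0 (sem c \<tau> i 0 + 1) (sem c \<tau>)"
  have "(?f ^^ nat (\<sigma> ''n'' 0)) (upd i 0 0 \<sigma>) x = \<sigma> x"
    by (rule funpow_invariant[where P = "\<lambda>\<tau>. \<tau> x = \<sigma> x"]) (use HFor in auto)
  then show ?case by simp
next
  case (HAssign y a b)
  then show ?case by simp
qed simp_all

text \<open>The step may use that arrays not written by the loop keep their values from before it,
  so \<open>I\<close> has to describe the written ones only.\<close>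

lemma sem_HFor_rule:
  assumes wf: "wf_hcom (HFor i c)" and n: "\<sigma> ''n'' 0 = n" "0 \<le> n"
    and base: "I 0 (upd i 0 0 \<sigma>)"
    and step: "\<And>j \<tau>. 0 \<le> j \<Longrightarrow> j < n \<Longrightarrow> (\<And>x. x \<notin> set (i # mods c) \<Longrightarrow> \<tau> x = \<sigma> x) \<Longrightarrow>
      \<tau> i 0 = j \<Longrightarrow> I j \<tau> \<Longrightarrow> I (j + 1) (upd i 0 (j + 1) (sem c \<tau>))"
  shows "I n (sem (HFor i c) \<sigma>)"
proof -
  let ?f = "\<lambda>\<tau>. upd i 0 (sem c \<tau> i 0 + 1) (sem c \<tau>)"
  have i: "sem c \<tau> i = \<tau> i" for \<tau> using wf by (intro sem_frame) simp
  have "I (int k) ((?f ^^ k) (upd i 0 0 \<sigma>)) \<and> (?f ^^ k) (upd i 0 0 \<sigma>) i 0 = int k \<and>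
      (\<forall>x. x \<notin> set (i # mods c) \<longrightarrow> (?f ^^ k) (upd i 0 0 \<sigma>) x = \<sigma> x)" if "int k \<le> n" for k
    using that
  proof (induction k)
    case 0
    then show ?case using base by simp
  next
    case (Suc k)
    define \<tau> where "\<tau> = (?f ^^ k) (upd i 0 0 \<sigma>)"
    have IH: "I (int k) \<tau>" "\<tau> i 0 = int k" "\<And>x. x \<notin> set (i # mods c) \<Longrightarrow> \<tau> x = \<sigma> x"
      using Suc unfolding \<tau>_def by auto
    have eq: "(?f ^^ Suc k) (upd i 0 0 \<sigma>) = upd i 0 (int k + 1) (sem c \<tau>)"
      using IH(2) i[of \<tau>] unfolding \<tau>_def by simp
    have "I (int k + 1) (upd i 0 (int k + 1) (sem c \<tau>))"
      using Suc.prems by (intro step) (use IH in auto)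
    moreover have "upd i 0 (int k + 1) (sem c \<tau>) x = \<sigma> x" if "x \<notin> set (i # mods c)" for x
      using that IH(3)[of x] sem_frame[of x c \<tau>] by (cases "x = i") auto
    ultimately show ?case unfolding eq by(simp add: add.commute)
  qed
  from this[of "nat n"] show ?thesis using n by simp
qed

text \<open>Like \<open>exec\<close>, but with free evaluation of expressions. Counting commands
  first separates the analysis of the loops from that of the lengths of numbers.\<close>

inductive ucost :: "com \<Rightarrow> state \<Rightarrow> nat \<Rightarrow> state \<Rightarrow> bool" where
  Skip: "ucost Skip \<sigma> 1 \<sigma>"
| Assign: "ucost (Assign x a b) \<sigma> 1 (upd x (aval a \<sigma>) (aval b \<sigma>) \<sigma>)"
| Seq: "ucost c1 \<sigma> k1 \<sigma>' \<Longrightarrow> ucost c2 \<sigma>' k2 \<sigma>'' \<Longrightarrow> ucost (Seq c1 c2) \<sigma> (k1 + k2 + 1) \<sigma>''"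
| IfTrue: "bval b \<sigma> \<Longrightarrow> ucost c1 \<sigma> k \<sigma>' \<Longrightarrow> ucost (If b c1 c2) \<sigma> (k + 1) \<sigma>'"
| IfFalse: "\<not> bval b \<sigma> \<Longrightarrow> ucost c2 \<sigma> k \<sigma>' \<Longrightarrow> ucost (If b c1 c2) \<sigma> (k + 1) \<sigma>'"
| WhileFalse: "\<not> bval b \<sigma> \<Longrightarrow> ucost (While b c) \<sigma> 1 \<sigma>"
| WhileTrue: "bval b \<sigma> \<Longrightarrow> ucost c \<sigma> k1 \<sigma>' \<Longrightarrow> ucost (While b c) \<sigma>' k2 \<sigma>'' \<Longrightarrow>
    ucost (While b c) \<sigma> (k1 + k2 + 1) \<sigma>''"

text \<open>Both branches of \<open>HIf\<close> are added up rather than compared, so that the bound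
  is a polynomial in \<open>n\<close>.\<close>

primrec steps :: "hcom \<Rightarrow> nat \<Rightarrow> nat" where
  "steps HSkip n = 1"
| "steps (HAssign x a b) n = 1"
| "steps (c1 ;; c2) n = steps c1 n + steps c2 n + 1"
| "steps (HIf b c1 c2) n = steps c1 n + steps c2 n + 1"
| "steps (HFor i c) n = n * (steps c n + 3) + 3"

lemma ucost_comp:
  "wf_hcom c \<Longrightarrow> ''n'' \<notin> set (mods c) \<Longrightarrow>
    \<exists>k\<le>steps c (nat (\<sigma> ''n'' 0)). ucost (comp c) \<sigma> k (sem c \<sigma>)"
proof (induction c arbitrary: \<sigma>)
  case HSkip
  then show ?case using ucost.Skip by auto
next
  case (HAssign x a b)
  then show ?case using ucost.Assign by auto
next
  case (HSeq c1 c2)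
  from HSeq obtain k1 where k1: "k1 \<le> steps c1 (nat (\<sigma> ''n'' 0))" "ucost (comp c1) \<sigma> k1 (sem c1 \<sigma>)"
    by force
  have "sem c1 \<sigma> ''n'' = \<sigma> ''n''" using HSeq.prems by (intro sem_frame) auto
  then obtain k2 where k2: "k2 \<le> steps c2 (nat (\<sigma> ''n'' 0))"
      "ucost (comp c2) (sem c1 \<sigma>) k2 (sem c2 (sem c1 \<sigma>))"
    using HSeq.IH(2)[of "sem c1 \<sigma>"] HSeq.prems by auto
  show ?case
    by (rule exI[of _ "k1 + k2 + 1"]) (use k1 k2 ucost.Seq in auto)
next
  case (HIf b c1 c2)
  show ?case
  proof (cases "bval b \<sigma>")
    case True
    from HIf obtain k where k: "k \<le> steps c1 (nat (\<sigma> ''n'' 0))" "ucost (comp c1) \<sigma> k (sem c1 \<sigma>)"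
      by force
    show ?thesis by (rule exI[of _ "k + 1"]) (use k True ucost.IfTrue in auto)
  next
    case False
    from HIf obtain k where k: "k \<le> steps c2 (nat (\<sigma> ''n'' 0))" "ucost (comp c2) \<sigma> k (sem c2 \<sigma>)"
      by force
    show ?thesis by (rule exI[of _ "k + 1"]) (use k False ucost.IfFalse in auto)
  qed
next
  case (HFor i c)
  let ?f = "\<lambda>\<tau>. upd i 0 (sem c \<tau> i 0 + 1) (sem c \<tau>)"
  let ?N = "nat (\<sigma> ''n'' 0)"
  let ?W = "While (Less (V i) (V ''n'')) (Seq (comp c) (Assign i (N 0) (Add (V i) (N 1))))"
  have fr: "sem c \<tau> i = \<tau> i" "sem c \<tau> ''n'' = \<tau> ''n''" for \<tau>
    using HFor.prems by (auto intro: sem_frame)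
  \<comment> \<open>Induction over the iterations that remain. It peels off the first one, hence
    \<open>funpow_Suc_right\<close>.\<close>
  have loop: "\<exists>k\<le>j * (steps c ?N + 3) + 1. ucost ?W \<tau> k ((?f ^^ j) \<tau>)"
    if "\<tau> ''n'' = \<sigma> ''n''" "j = nat (\<tau> ''n'' 0 - \<tau> i 0)" for \<tau> j
    using that
  proof (induction j arbitrary: \<tau>)
    case 0
    then show ?case using ucost.WhileFalse[of "Less (V i) (V ''n'')" \<tau>] by auto
  next
    case (Suc j)
    from HFor Suc.prems obtain k1 where k1: "k1 \<le> steps c ?N" "ucost (comp c) \<tau> k1 (sem c \<tau>)"
      by (metis insertCI list.simps(15) mods.simps(5) wf_hcom.simps(5))
    have "ucost (Assign i (N 0) (Add (V i) (N 1))) (sem c \<tau>) 1 (?f \<tau>)"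
      using ucost.Assign[of i "N 0" "Add (V i) (N 1)" "sem c \<tau>"] by simp
    with k1(2) have "ucost (Seq (comp c) (Assign i (N 0) (Add (V i) (N 1)))) \<tau> (k1 + 1 + 1) (?f \<tau>)"
      by (rule ucost.Seq)
    moreover have "?f \<tau> ''n'' = \<sigma> ''n''" "j = nat (?f \<tau> ''n'' 0 - ?f \<tau> i 0)"
      using Suc.prems HFor.prems fr[of \<tau>] by auto
    then obtain k2 where k2: "k2 \<le> j * (steps c ?N + 3) + 1" "ucost ?W (?f \<tau>) k2 ((?f ^^ j) (?f \<tau>))"
      using Suc.IH[of "?f \<tau>"] by blast
    note k2(2)
    moreover have "bval (Less (V i) (V ''n'')) \<tau>" using Suc.prems(2) by simp
    ultimately have "ucost ?W \<tau> (k1 + 1 + 1 + k2 + 1) ((?f ^^ j) (?f \<tau>))"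
      by (intro ucost.WhileTrue)
    moreover have "(?f ^^ Suc j) \<tau> = (?f ^^ j) (?f \<tau>)" by (simp only: funpow_Suc_right o_apply)
    ultimately show ?case
      by (intro exI[of _ "k1 + 1 + 1 + k2 + 1"]) (use k1 k2 in simp)
  qed
  have "\<exists>k\<le>?N * (steps c ?N + 3) + 1. ucost ?W (upd i 0 0 \<sigma>) k ((?f ^^ ?N) (upd i 0 0 \<sigma>))"
    by (rule loop) (use HFor.prems in auto)
  then obtain k where k: "k \<le> ?N * (steps c ?N + 3) + 1" "ucost ?W (upd i 0 0 \<sigma>) k ((?f ^^ ?N) (upd i 0 0 \<sigma>))"
    by blast
  have "ucost (Assign i (N 0) (N 0)) \<sigma> 1 (upd i 0 0 \<sigma>)"
    using ucost.Assign[of i "N 0" "N 0" \<sigma>] by simp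
  from ucost.Seq[OF this k(2)] show ?case
    by (intro exI[of _ "1 + k + 1"]) (use k(1) in simp)
qed

text \<open>If one factor of each multiplication is the number of vertices, then a command lengthens the
  numbers in the memory only by an additive term. Hence the running time is bounded in terms of the
  number of executed commands, and the sizes of intermediate results need no invariants.\<close>

primrec ok_aexp :: "aexp \<Rightarrow> bool" where
  "ok_aexp (N k) \<longleftrightarrow> \<bar>k\<bar> \<le> 2"
| "ok_aexp (Idx x a) \<longleftrightarrow> ok_aexp a"
| "ok_aexp (Add a b) \<longleftrightarrow> ok_aexp a \<and> ok_aexp b"
| "ok_aexp (Sub a b) \<longleftrightarrow> ok_aexp a \<and> ok_aexp b"
| "ok_aexp (Mul a b) \<longleftrightarrow> ok_aexp a \<and> b = V ''n''"
| "ok_aexp (Div a b) \<longleftrightarrow> ok_aexp a \<and> ok_aexp b"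

primrec ok_bexp :: "bexp \<Rightarrow> bool" where
  "ok_bexp (Less a b) \<longleftrightarrow> ok_aexp a \<and> ok_aexp b"
| "ok_bexp (Not b) \<longleftrightarrow> ok_bexp b"
| "ok_bexp (And b c) \<longleftrightarrow> ok_bexp b \<and> ok_bexp c"

text \<open>Since \<open>''n''\<close> is never written, the length of the factor in multiplications
  stays the same throughout a run.\<close>

primrec ok_com :: "com \<Rightarrow> bool" where
  "ok_com Skip \<longleftrightarrow> True"
| "ok_com (Assign x a b) \<longleftrightarrow> x \<noteq> ''n'' \<and> ok_aexp a \<and> ok_aexp b"
| "ok_com (Seq c1 c2) \<longleftrightarrow> ok_com c1 \<and> ok_com c2"
| "ok_com (If b c1 c2) \<longleftrightarrow> ok_bexp b \<and> ok_com c1 \<and> ok_com c2"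
| "ok_com (While b c) \<longleftrightarrow> ok_bexp b \<and> ok_com c"

primrec asize :: "aexp \<Rightarrow> nat" where
  "asize (N k) = 1"
| "asize (Idx x a) = asize a + 1"
| "asize (Add a b) = asize a + asize b + 1"
| "asize (Sub a b) = asize a + asize b + 1"
| "asize (Mul a b) = asize a + asize b + 1"
| "asize (Div a b) = asize a + asize b + 1"

primrec bsize :: "bexp \<Rightarrow> nat" where
  "bsize (Less a b) = asize a + asize b + 1"
| "bsize (Not b) = bsize b + 1"
| "bsize (And b c) = bsize b + bsize c + 1"

primrec csize :: "com \<Rightarrow> nat" where
  "csize Skip = 1"
| "csize (Assign x a b) = asize a + asize b + 1"
| "csize (Seq c1 c2) = csize c1 + csize c2"
| "csize (If b c1 c2) = bsize b + csize c1 + csize c2"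
| "csize (While b c) = bsize b + csize c"

section \<open>Growth of the numbers in memory and logarithmic cost\<close>

lemma bits_le: "\<bar>z\<bar> \<le> 2 ^ k \<Longrightarrow> bits z \<le> k + 1"
proof -
  assume "\<bar>z\<bar> \<le> 2 ^ k"
  moreover have "(2::int) ^ k < 2 ^ (k + 1)" by simp
  ultimately have "\<bar>z\<bar> < 2 ^ (k + 1)" by linarith
  then have "nat \<bar>z\<bar> < 2 ^ (k + 1)" by (simp add: nat_less_iff)
  then show ?thesis unfolding bits_def by (intro floorlog_leI) auto
qed

lemma abs_less_bits: "\<bar>z\<bar> < 2 ^ bits z"
proof (cases "z = 0")
  case False
  then have "nat \<bar>z\<bar> < 2 ^ bits z" unfolding bits_def by (intro floorlog_bounds[THEN conjunct2]) auto
  then show ?thesis by (simp add: nat_less_iff)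
qed (simp add: bits_def)

text \<open>\<open>B\<close> bounds the lengths of all numbers and grows during a run.
  \<open>D\<close> bounds the length of \<open>n\<close> for good and is the growth caused by one
  multiplication; \<open>1 \<le> D\<close> lets it pay for an addition as well.\<close>

definition bounded :: "nat \<Rightarrow> nat \<Rightarrow> state \<Rightarrow> bool" where
  "bounded B D \<sigma> \<longleftrightarrow> 1 \<le> B \<and> 1 \<le> D \<and> (\<forall>x i. \<bar>\<sigma> x i\<bar> \<le> 2 ^ B) \<and> \<bar>\<sigma> ''n'' 0\<bar> \<le> 2 ^ D"

lemma double_power_le: "a < k \<Longrightarrow> b < k \<Longrightarrow> \<bar>x\<bar> \<le> 2 ^ a \<Longrightarrow> \<bar>y\<bar> \<le> 2 ^ b \<Longrightarrow> \<bar>x\<bar> + \<bar>y\<bar> \<le> (2::int) ^ k"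
proof -
  assume *: "a < k" "b < k" "\<bar>x\<bar> \<le> 2 ^ a" "\<bar>y\<bar> \<le> 2 ^ b"
  then obtain k' where k: "k = Suc k'" by (cases k) auto
  have "(2::int) ^ a \<le> 2 ^ k'" "(2::int) ^ b \<le> 2 ^ k'"
    using * k by (auto intro!: power_increasing)
  then have "\<bar>x\<bar> + \<bar>y\<bar> \<le> 2 ^ k' + 2 ^ k'" using *(3,4) by linarith
  then show ?thesis using k by simp
qed

text \<open>Quotients are rounded down, so for negative \<open>x\<close> and positive
  \<open>y\<close> the value lies between \<open>x\<close> and 0. Division by 0 gives 0.\<close>

lemma abs_div_le: "\<bar>x div y\<bar> \<le> \<bar>x\<bar>" for x y :: int
proof -
  have pos: "\<bar>x div y\<bar> \<le> \<bar>x\<bar>" if "0 < y" for x y :: int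
  proof (cases "0 \<le> x")
    case True
    then show ?thesis using that using zdiv_mono2[of x 1 y] by (simp add: pos_imp_zdiv_nonneg_iff)
  next
    case False
    have "x * y \<le> x * 1" using False that by (intro mult_left_mono_neg) auto
    then have "x * y div y \<le> x div y" using that by (intro zdiv_mono1) auto
    moreover have "x div y \<le> 0" using False that by (simp add: div_nonpos_pos_le0)
    ultimately show ?thesis using that by simp
  qed
  consider "y = 0" | "0 < y" | "0 < - y" by linarith
  then show ?thesis
  proof cases
    case 3
    then show ?thesis using pos[of "- y" "- x"] by simp
  qed (simp_all add: pos)
qed

text \<open>Each node of the expression adds at most \<open>D\<close> bits: one for an addition,
  \<open>D\<close> for a multiplication by \<open>n\<close>. A lookup starts again from
  \<open>B\<close>.\<close>

lemma aval_bound: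
  "ok_aexp a \<Longrightarrow> bounded B D \<sigma> \<Longrightarrow> \<bar>aval a \<sigma>\<bar> \<le> 2 ^ (B + D * asize a)"
proof (induction a)
  case (N k)
  then have "\<bar>k\<bar> \<le> 2 ^ 1" by simp
  also have "(2::int) ^ 1 \<le> 2 ^ (B + D * asize (N k))"
    using N by (intro power_increasing) (auto simp: bounded_def)
  finally show ?case by simp
next
  case (Idx x a)
  then have "\<bar>\<sigma> x (aval a \<sigma>)\<bar> \<le> 2 ^ B" by (simp add: bounded_def)
  also have "(2::int) ^ B \<le> 2 ^ (B + D * asize (Idx x a))" by (intro power_increasing) auto
  finally show ?case by simp
next
  case (Add a b)
  have "B + D * asize a < B + D * asize (Add a b)" "B + D * asize b < B + D * asize (Add a b)"
    using Add.prems by (auto simp: bounded_def distrib_left)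
  from double_power_le[OF this, of "aval a \<sigma>" "aval b \<sigma>"] Add show ?case
    using abs_triangle_ineq[of "aval a \<sigma>" "aval b \<sigma>"] by auto
next
  case (Sub a b)
  have "B + D * asize a < B + D * asize (Sub a b)" "B + D * asize b < B + D * asize (Sub a b)"
    using Sub.prems by (auto simp: bounded_def distrib_left)
  from double_power_le[OF this, of "aval a \<sigma>" "aval b \<sigma>"] Sub show ?case
    using abs_triangle_ineq4[of "aval a \<sigma>" "aval b \<sigma>"] by auto
next
  case (Mul a b)
  then have b: "b = V ''n''" by simp
  have "\<bar>aval (Mul a b) \<sigma>\<bar> = \<bar>aval a \<sigma>\<bar> * \<bar>\<sigma> ''n'' 0\<bar>" by (simp add: b abs_mult)
  also have "\<dots> \<le> 2 ^ (B + D * asize a) * 2 ^ D"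
    using Mul by (intro mult_mono) (auto simp: bounded_def)
  also have "\<dots> = 2 ^ (B + D * asize a + D)" by (simp add: power_add)
  also have "\<dots> \<le> 2 ^ (B + D * asize (Mul a b))"
    by (intro power_increasing) (simp_all add: distrib_left)
  finally show ?case .
next
  case (Div a b)
  then have "\<bar>aval (Div a b) \<sigma>\<bar> \<le> 2 ^ (B + D * asize a)"
    using abs_div_le[of "aval a \<sigma>" "aval b \<sigma>"] by auto
  also have "(2::int) ^ (B + D * asize a) \<le> 2 ^ (B + D * asize (Div a b))"
    by (intro power_increasing) (simp_all add: distrib_left)
  finally show ?case .
qed

lemma bounded_mono:
  assumes "bounded B D \<sigma>" "B \<le> B'"
  shows "bounded B' D \<sigma>"
proof -
  have "(2::int) ^ B \<le> 2 ^ B'" using assms(2) by (intro power_increasing) auto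
  then have "\<bar>\<sigma> x i\<bar> \<le> 2 ^ B'" for x i
    using assms(1) unfolding bounded_def by (meson order_trans)
  then show ?thesis using assms by (simp add: bounded_def)
qed

lemma bits_aval:
  assumes "ok_aexp a" "bounded B D \<sigma>" "asize a \<le> K"
  shows "bits (aval a \<sigma>) \<le> B + D * K + 1"
proof -
  have "bits (aval a \<sigma>) \<le> B + D * asize a + 1" using assms aval_bound by (intro bits_le) auto
  also have "\<dots> \<le> B + D * K + 1" using assms by simp
  finally show ?thesis .
qed

lemma atime_bound:
  "ok_aexp a \<Longrightarrow> bounded B D \<sigma> \<Longrightarrow> asize a \<le> K \<Longrightarrow> atime a \<sigma> \<le> asize a * (B + D * K + 2)"
proof (induction a)
  case (N k)
  then show ?case using bits_aval[of "N k" B D \<sigma> K] by simp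
next
  case (Idx x a)
  then show ?case using bits_aval[of "Idx x a" B D \<sigma> K] by simp
next
  case (Add a b)
  then show ?case using bits_aval[of "Add a b" B D \<sigma> K] by (simp add: distrib_right)
next
  case (Sub a b)
  then show ?case using bits_aval[of "Sub a b" B D \<sigma> K] by (simp add: distrib_right)
next
  case (Mul a b)
  then show ?case using bits_aval[of "Mul a b" B D \<sigma> K] by (simp add: distrib_right)
next
  case (Div a b)
  then show ?case using bits_aval[of "Div a b" B D \<sigma> K] by (simp add: distrib_right)
qed

lemma btime_bound:
  "ok_bexp b \<Longrightarrow> bounded B D \<sigma> \<Longrightarrow> bsize b \<le> K \<Longrightarrow> btime b \<sigma> \<le> bsize b * (B + D * K + 2)"
proof (induction b)
  case (Less a1 a2)
  then show ?case using atime_bound[of a1 B D \<sigma> K] atime_bound[of a2 B D \<sigma> K]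
    by (simp add: distrib_right)
qed (simp_all add: distrib_right)

text \<open>A command evaluates at most \<open>K\<close> nodes and raises the bound on lengths by at
  most \<open>D * K\<close>. Hence \<open>B\<close> varies in the induction, while
  \<open>Bf\<close>, which is valid until the end of the run, gives every command the same
  price.\<close>

lemma exec_of_ucost:
  assumes "ucost c \<sigma> k \<sigma>'" "ok_com c" "csize c \<le> K" "bounded B D \<sigma>" "B + D * K * k \<le> Bf"
  shows "\<exists>t. exec c \<sigma> t \<sigma>' \<and> bounded (B + D * K * k) D \<sigma>' \<and> t \<le> k * (K * (Bf + D * K + 2) + 1)"
  using assms
proof (induction arbitrary: B rule: ucost.induct)
  case (Skip \<sigma>)
  then show ?case using exec.Skip[of \<sigma>] bounded_mono[of B D \<sigma> "B + D * K * 1"]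
    by (intro exI[of _ 1]) auto
next
  case (Assign x a b \<sigma>)
  have time: "atime a \<sigma> + atime b \<sigma> + 1 \<le> 1 * (K * (Bf + D * K + 2) + 1)"
  proof -
    have "atime a \<sigma> + atime b \<sigma> \<le> asize a * (B + D * K + 2) + asize b * (B + D * K + 2)"
      using Assign by (intro add_mono atime_bound) auto
    also have "\<dots> = (asize a + asize b) * (B + D * K + 2)" by (simp add: distrib_right)
    also have "\<dots> \<le> K * (Bf + D * K + 2)" using Assign by (intro mult_le_mono) auto
    finally show ?thesis by simp
  qed
  have inc: "bounded (B + D * K) D \<sigma>" by (rule bounded_mono[OF Assign.prems(3)]) simp
  have "\<bar>aval b \<sigma>\<bar> \<le> 2 ^ (B + D * asize b)" using Assign by (intro aval_bound) auto
  also have "(2::int) ^ (B + D * asize b) \<le> 2 ^ (B + D * K)"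
    using Assign by (intro power_increasing) auto
  finally have "bounded (B + D * K * 1) D (upd x (aval a \<sigma>) (aval b \<sigma>) \<sigma>)"
    using Assign.prems(1) inc by (auto simp: bounded_def upd_def)
  then show ?case
    using time exec.Assign[of x a b \<sigma>] unfolding upd_def by blast
next
  case (Seq c1 \<sigma> k1 \<sigma>1 c2 k2 \<sigma>2)
  have "B + D * K * k1 \<le> Bf" using Seq.prems by (simp add: algebra_simps)
  then obtain t1 where t1: "exec c1 \<sigma> t1 \<sigma>1" "bounded (B + D * K * k1) D \<sigma>1"
      "t1 \<le> k1 * (K * (Bf + D * K + 2) + 1)"
    using Seq.IH(1)[of B] Seq.prems by auto
  have "B + D * K * k1 + D * K * k2 \<le> Bf" using Seq.prems by (simp add: algebra_simps)
  then obtain t2 where t2: "exec c2 \<sigma>1 t2 \<sigma>2" "bounded (B + D * K * k1 + D * K * k2) D \<sigma>2"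
      "t2 \<le> k2 * (K * (Bf + D * K + 2) + 1)"
    using Seq.IH(2)[of "B + D * K * k1"] Seq.prems t1 by auto
  have "bounded (B + D * K * (k1 + k2 + 1)) D \<sigma>2"
    by (rule bounded_mono[OF t2(2)]) (simp add: algebra_simps)
  then show ?case
    by (intro exI[of _ "t1 + t2 + 1"]) (use t1 t2 exec.Seq[OF t1(1) t2(1)] in \<open>simp add: distrib_right\<close>)
next
  case (IfTrue b \<sigma> c1 k \<sigma>' c2)
  have "B + D * K * k \<le> Bf" using IfTrue.prems by (simp add: algebra_simps)
  then obtain t where t: "exec c1 \<sigma> t \<sigma>'" "bounded (B + D * K * k) D \<sigma>'"
      "t \<le> k * (K * (Bf + D * K + 2) + 1)"
    using IfTrue.IH[of B] IfTrue.prems by auto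
  have "btime b \<sigma> \<le> bsize b * (B + D * K + 2)" using IfTrue.prems by (intro btime_bound) auto
  also have "\<dots> \<le> K * (Bf + D * K + 2)" using IfTrue.prems by (intro mult_le_mono) auto
  finally have bt: "btime b \<sigma> \<le> K * (Bf + D * K + 2)" .
  have "bounded (B + D * K * (k + 1)) D \<sigma>'"
    by (rule bounded_mono[OF t(2)]) (simp add: algebra_simps)
  then show ?case
    by (intro exI[of _ "btime b \<sigma> + t + 1"])
      (use t bt exec.IfTrue[OF IfTrue.hyps(1) t(1)] in \<open>simp add: distrib_right\<close>)
next
  case (IfFalse b \<sigma> c2 k \<sigma>' c1)
  have "B + D * K * k \<le> Bf" using IfFalse.prems by (simp add: algebra_simps)
  then obtain t where t: "exec c2 \<sigma> t \<sigma>'" "bounded (B + D * K * k) D \<sigma>'"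
      "t \<le> k * (K * (Bf + D * K + 2) + 1)"
    using IfFalse.IH[of B] IfFalse.prems by auto
  have "btime b \<sigma> \<le> bsize b * (B + D * K + 2)" using IfFalse.prems by (intro btime_bound) auto
  also have "\<dots> \<le> K * (Bf + D * K + 2)" using IfFalse.prems by (intro mult_le_mono) auto
  finally have bt: "btime b \<sigma> \<le> K * (Bf + D * K + 2)" .
  have "bounded (B + D * K * (k + 1)) D \<sigma>'"
    by (rule bounded_mono[OF t(2)]) (simp add: algebra_simps)
  then show ?case
    by (intro exI[of _ "btime b \<sigma> + t + 1"])
      (use t bt exec.IfFalse[OF IfFalse.hyps(1) t(1)] in \<open>simp add: distrib_right\<close>)
next
  case (WhileFalse b \<sigma> c)
  have "btime b \<sigma> \<le> bsize b * (B + D * K + 2)" using WhileFalse.prems by (intro btime_bound) auto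
  also have "\<dots> \<le> K * (Bf + D * K + 2)" using WhileFalse.prems by (intro mult_le_mono) auto
  finally have bt: "btime b \<sigma> \<le> K * (Bf + D * K + 2)" .
  have "bounded (B + D * K * 1) D \<sigma>"
    by (rule bounded_mono[OF WhileFalse.prems(3)]) (simp add: algebra_simps)
  then show ?case
    by (intro exI[of _ "btime b \<sigma> + 1"]) (use bt exec.WhileFalse[OF WhileFalse.hyps(1)] in simp)
next
  case (WhileTrue b \<sigma> c k1 \<sigma>1 k2 \<sigma>2)
  have "B + D * K * k1 \<le> Bf" using WhileTrue.prems by (simp add: algebra_simps)
  then obtain t1 where t1: "exec c \<sigma> t1 \<sigma>1" "bounded (B + D * K * k1) D \<sigma>1"
      "t1 \<le> k1 * (K * (Bf + D * K + 2) + 1)"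
    using WhileTrue.IH(1)[of B] WhileTrue.prems by auto
  have "B + D * K * k1 + D * K * k2 \<le> Bf" using WhileTrue.prems by (simp add: algebra_simps)
  then obtain t2 where t2: "exec (While b c) \<sigma>1 t2 \<sigma>2" "bounded (B + D * K * k1 + D * K * k2) D \<sigma>2"
      "t2 \<le> k2 * (K * (Bf + D * K + 2) + 1)"
    using WhileTrue.IH(2)[of "B + D * K * k1"] WhileTrue.prems t1 by auto
  have "btime b \<sigma> \<le> bsize b * (B + D * K + 2)" using WhileTrue.prems by (intro btime_bound) auto
  also have "\<dots> \<le> K * (Bf + D * K + 2)" using WhileTrue.prems by (intro mult_le_mono) auto
  finally have bt: "btime b \<sigma> \<le> K * (Bf + D * K + 2)" .
  have "bounded (B + D * K * (k1 + k2 + 1)) D \<sigma>2"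
    by (rule bounded_mono[OF t2(2)]) (simp add: algebra_simps)
  then show ?case
    by (intro exI[of _ "btime b \<sigma> + t1 + t2 + 1"])
      (use bt t1 t2 exec.WhileTrue[OF WhileTrue.hyps(1) t1(1) t2(1)] in \<open>simp add: distrib_right\<close>)
qed

section \<open>Closure properties of polynomial bounds\<close>

definition poly_bounded :: "(nat \<Rightarrow> nat) \<Rightarrow> bool" where
  "poly_bounded g \<longleftrightarrow> (\<exists>p. \<forall>x. g x \<le> poly p x)"

lemma poly_bounded_const: "poly_bounded (\<lambda>x. k)"
  unfolding poly_bounded_def by (rule exI[of _ "[:k:]"]) simp

lemma poly_bounded_id: "poly_bounded (\<lambda>x. x)"
  unfolding poly_bounded_def by (rule exI[of _ "[:0, 1:]"]) simp

lemma poly_bounded_add: "poly_bounded g \<Longrightarrow> poly_bounded h \<Longrightarrow> poly_bounded (\<lambda>x. g x + h x)"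
  unfolding poly_bounded_def
proof (elim exE)
  fix p q assume "\<forall>x. g x \<le> poly p x" "\<forall>x. h x \<le> poly q x"
  then show "\<exists>p. \<forall>x. g x + h x \<le> poly p x" by (intro exI[of _ "p + q"]) (simp add: add_mono)
qed

lemma poly_bounded_mult: "poly_bounded g \<Longrightarrow> poly_bounded h \<Longrightarrow> poly_bounded (\<lambda>x. g x * h x)"
  unfolding poly_bounded_def
proof (elim exE)
  fix p q assume "\<forall>x. g x \<le> poly p x" "\<forall>x. h x \<le> poly q x"
  then show "\<exists>p. \<forall>x. g x * h x \<le> poly p x" by (intro exI[of _ "p * q"]) (simp add: mult_le_mono)
qed

lemmas poly_bounded_intros =
  poly_bounded_const poly_bounded_id poly_bounded_add poly_bounded_mult

lemma poly_bounded_steps: "poly_bounded (steps c)"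
proof (induction c)
  case (HSeq c1 c2)
  show ?case unfolding steps.simps by (intro poly_bounded_intros HSeq)
next
  case (HIf b c1 c2)
  show ?case unfolding steps.simps by (intro poly_bounded_intros HIf)
next
  case (HFor i c)
  show ?case unfolding steps.simps by (intro poly_bounded_intros HFor)
qed (simp_all add: poly_bounded_const)

lemma steps_mono: "m \<le> n \<Longrightarrow> steps c m \<le> steps c n"
  by (induction c) (auto intro!: mult_le_mono add_mono)

subsection \<open>Scaled Hungarian method: invariants\<close>

lemma index_inj:
  fixes n u v :: int
  assumes "0 \<le> v" "v < n" "0 \<le> v'" "v' < n"
  shows "u * n + v = u' * n + v' \<longleftrightarrow> u = u' \<and> v = v'"
proof
  assume eq: "u * n + v = u' * n + v'"
  have "(u * n + v) div n = u" "(u' * n + v') div n = u'" using assms by auto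
  then show "u = u' \<and> v = v'" using eq by auto
qed simp

definition row_sum :: "int \<Rightarrow> (int \<Rightarrow> int) \<Rightarrow> int \<Rightarrow> int" where
  "row_sum n r u = (\<Sum>v\<in>{0..<n}. r (u * n + v))"

definition col_sum :: "int \<Rightarrow> (int \<Rightarrow> int) \<Rightarrow> int \<Rightarrow> int" where
  "col_sum n r v = (\<Sum>u\<in>{0..<n}. r (u * n + v))"

lemma row_sum_update:
  assumes "w \<in> {0..<n}"
  shows "row_sum n (r(g * n + w := r (g * n + w) + e)) u = row_sum n r u + (if u = g then e else 0)"
proof -
  have "row_sum n (r(g * n + w := r (g * n + w) + e)) u =
      (\<Sum>v\<in>{0..<n}. r (u * n + v) + (if v = w then if u = g then e else 0 else 0))"
    unfolding row_sum_def using assms by (intro sum.cong) (auto simp: index_inj)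
  then show ?thesis using assms by (simp add: row_sum_def sum.distrib)
qed

lemma col_sum_update:
  assumes "w \<in> {0..<n}" "g \<in> {0..<n}" "v \<in> {0..<n}"
  shows "col_sum n (r(g * n + w := r (g * n + w) + e)) v = col_sum n r v + (if v = w then e else 0)"
proof -
  have "col_sum n (r(g * n + w := r (g * n + w) + e)) v =
      (\<Sum>u\<in>{0..<n}. r (u * n + v) + (if u = g then if v = w then e else 0 else 0))"
    unfolding col_sum_def using assms by (intro sum.cong) (auto simp: index_inj)
  then show ?thesis using assms by (simp add: col_sum_def sum.distrib)
qed

definition slack :: "int \<Rightarrow> (int \<Rightarrow> int) \<Rightarrow> (int \<Rightarrow> int) \<Rightarrow> (int \<Rightarrow> int) \<Rightarrow> int \<Rightarrow> int \<Rightarrow> int" where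
  "slack n c y z u v = c (u * n + v) - y u - z v"

text \<open>The certificate of \<open>transport_duals\<close> for integer arrays. The entries of
  \<open>r\<close> are integers now, so their sign has to be part of it.\<close>

definition duals_ok ::
  "int \<Rightarrow> (int \<Rightarrow> int) \<Rightarrow> (int \<Rightarrow> int) \<Rightarrow> (int \<Rightarrow> int) \<Rightarrow> (int \<Rightarrow> int) \<Rightarrow> bool" where
  "duals_ok n c y z r \<longleftrightarrow> (\<forall>u\<in>{0..<n}. \<forall>v\<in>{0..<n}. 0 \<le> r (u * n + v) \<and> 0 \<le> slack n c y z u v \<and>
    (0 < r (u * n + v) \<longrightarrow> slack n c y z u v = 0))"

lemma duals_ok_update:
  assumes "duals_ok n c y z r" "g \<in> {0..<n}" "w \<in> {0..<n}"
    and "0 \<le> a" "0 < a \<Longrightarrow> slack n c y z g w = 0"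
  shows "duals_ok n c y z (r(g * n + w := a))"
  using assms unfolding duals_ok_def by (auto simp: index_inj)

text \<open>The search forest after \<open>k\<close> rounds: \<open>S u\<close> and \<open>T v\<close> are \<open>0\<close> for unlabelled vertices and
  otherwise \<open>1\<close> plus the number of the round that labelled the vertex (\<open>1\<close> for the roots, the
  rows with remaining supply \<open>a\<close>). A column has the parent \<open>pc v\<close>, a row the parent \<open>co (S u)\<close>,
  the column labelled in the same round. The search ends in a column \<open>x\<close> with remaining demand
  \<open>b\<close>; until then \<open>x = -1\<close>.\<close>

definition forest_ok ::
  "int \<Rightarrow> (int \<Rightarrow> int) \<Rightarrow> (int \<Rightarrow> int) \<Rightarrow> (int \<Rightarrow> int) \<Rightarrow> (int \<Rightarrow> int) \<Rightarrow> (int \<Rightarrow> int) \<Rightarrow> (int \<Rightarrow> int)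
    \<Rightarrow> (int \<Rightarrow> int) \<Rightarrow> (int \<Rightarrow> int) \<Rightarrow> (int \<Rightarrow> int) \<Rightarrow> (int \<Rightarrow> int) \<Rightarrow> int \<Rightarrow> int \<Rightarrow> bool" where
  "forest_ok n r a b c y z S T pc co x k \<longleftrightarrow>
    duals_ok n c y z r \<and>
    (\<forall>u\<in>{0..<n}. 0 \<le> S u \<and> S u \<le> k + 1 \<and> (S u = 1 \<longleftrightarrow> 0 < a u) \<and>
      (1 < S u \<longrightarrow> co (S u) \<in> {0..<n} \<and> T (co (S u)) = S u \<and> 0 < r (u * n + co (S u)))) \<and>
    (\<forall>v\<in>{0..<n}. 0 \<le> T v \<and> T v \<le> k + 1 \<and>
      (0 < T v \<longrightarrow> pc v \<in> {0..<n} \<and> 0 < S (pc v) \<and> S (pc v) < T v \<and> slack n c y z (pc v) v = 0 \<and>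
        (v \<noteq> x \<longrightarrow> b v \<le> 0 \<and> (\<forall>u\<in>{0..<n}. 0 < r (u * n + v) \<longrightarrow> 0 < S u)))) \<and>
    (x = -1 \<or> x \<in> {0..<n} \<and> 0 < T x \<and> 0 < b x) \<and>
    (x = -1 \<longrightarrow> (\<exists>u\<in>{0..<n}. 0 < a u) \<longrightarrow> card {v\<in>{0..<n}. 0 < T v} = nat k)"

lemma forest_ok_rowD:
  assumes "forest_ok n r a b c y z S T pc co x k" "u \<in> {0..<n}"
  shows "0 \<le> S u" "S u \<le> k + 1" "S u = 1 \<longleftrightarrow> 0 < a u"
    "1 < S u \<Longrightarrow> co (S u) \<in> {0..<n} \<and> T (co (S u)) = S u \<and> 0 < r (u * n + co (S u))"
  using assms unfolding forest_ok_def by blast+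

lemma forest_ok_colD:
  assumes "forest_ok n r a b c y z S T pc co x k" "v \<in> {0..<n}"
  shows "0 \<le> T v" "T v \<le> k + 1"
    "0 < T v \<Longrightarrow> pc v \<in> {0..<n} \<and> 0 < S (pc v) \<and> S (pc v) < T v \<and> slack n c y z (pc v) v = 0"
    "0 < T v \<Longrightarrow> v \<noteq> x \<Longrightarrow> b v \<le> 0 \<and> (\<forall>u\<in>{0..<n}. 0 < r (u * n + v) \<longrightarrow> 0 < S u)"
  using assms unfolding forest_ok_def by blast+

lemma forest_ok_endD:
  assumes "forest_ok n r a b c y z S T pc co x k" "x \<noteq> -1"
  shows "x \<in> {0..<n}" "0 < T x" "0 < b x"
  using assms unfolding forest_ok_def by blast+

lemma forest_ok_duals: "forest_ok n r a b c y z S T pc co x k \<Longrightarrow> duals_ok n c y z r"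
  unfolding forest_ok_def by blast

lemma forest_ok_init:
  assumes "duals_ok n c y z r"
    and "\<forall>u\<in>{0..<n}. S u = (if 0 < a u then 1 else 0)" "\<forall>v\<in>{0..<n}. T v = 0"
  shows "forest_ok n r a b c y z S T pc co (-1) 0"
proof -
  have "{v\<in>{0..<n}. 0 < T v} = {}" using assms(3) by auto
  then show ?thesis using assms unfolding forest_ok_def by (simp del: atLeastLessThan_iff)
qed

text \<open>For the rounds that the fixed loop still performs after the search has ended; only the
  upper bounds on the labels are relaxed.\<close>

lemma forest_ok_skip:
  assumes "forest_ok n r a b c y z S T pc co x k" "x \<noteq> -1"
  shows "forest_ok n r a b c y z S T pc co x (k + 1)"
  using assms unfolding forest_ok_def by auto

text \<open>A row with supply is labelled, so \<open>no\<close> would make all columns labelled. But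
  while supply remains, each round labels just one column, and only \<open>k < n\<close> rounds have
  passed.\<close>

lemma forest_ok_complete:
  assumes f: "forest_ok n r a b c y z S T pc co (-1) k" and k: "0 \<le> k" "k < n"
    and no: "\<forall>u\<in>{0..<n}. \<forall>v\<in>{0..<n}. \<not> (0 < S u \<and> \<not> 0 < T v)"
  shows "\<forall>u\<in>{0..<n}. \<not> 0 < a u"
proof (rule ccontr)
  assume "\<not> ?thesis"
  then obtain u where u: "u \<in> {0..<n}" "0 < a u" by auto
  then have "0 < S u" using forest_ok_rowD(3)[OF f u(1)] by simp
  then have "0 < T v" if "v \<in> {0..<n}" for v using no[rule_format, OF u(1) that] by simp
  then have "{v\<in>{0..<n}. 0 < T v} = {0..<n}" by blast
  then have "card {v\<in>{0..<n}. 0 < T v} = nat n" by simp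
  then show False using f u k by (auto simp: forest_ok_def)
qed

lemma forest_ok_stuck:
  assumes f: "forest_ok n r a b c y z S T pc co (-1) k"
    and no: "\<forall>u\<in>{0..<n}. \<not> 0 < a u"
  shows "forest_ok n r a b c y z S T pc co (-1) (k + 1)"
  using assms unfolding forest_ok_def by auto

text \<open>The price change of the Hungarian method. Slack falls only from labelled rows to
  unlabelled columns, where \<delta> is the minimum; a positive entry of \<open>r\<close> there
  forces \<delta> to be 0. It rises only from unlabelled rows to labelled columns, where
  \<open>closed\<close> excludes positive entries.\<close>

lemma duals_ok_shift:
  assumes d: "duals_ok n c y z r"
    and g: "g \<in> {0..<n}" "w \<in> {0..<n}" "0 < S g" "\<not> 0 < T w" "\<delta> = slack n c y z g w"
    and min: "\<forall>u\<in>{0..<n}. \<forall>v\<in>{0..<n}. 0 < S u \<and> \<not> 0 < T v \<longrightarrow> \<delta> \<le> slack n c y z u v"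
    and closed: "\<forall>v\<in>{0..<n}. 0 < T v \<longrightarrow> (\<forall>u\<in>{0..<n}. 0 < r (u * n + v) \<longrightarrow> 0 < S u)"
    and y': "\<forall>u\<in>{0..<n}. y' u = (if 0 < S u then y u + \<delta> else y u)"
    and z': "\<forall>v\<in>{0..<n}. z' v = (if 0 < T v then z v - \<delta> else z v)"
  shows "duals_ok n c y' z' r"
  unfolding duals_ok_def
proof (intro ballI)
  fix u v assume uv: "u \<in> {0..<n}" "v \<in> {0..<n}"
  have 0: "0 \<le> \<delta>" using d g by (auto simp: duals_ok_def)
  have old: "0 \<le> r (u * n + v)" "0 \<le> slack n c y z u v" "0 < r (u * n + v) \<Longrightarrow> slack n c y z u v = 0"
    using d uv by (auto simp: duals_ok_def)
  have new: "slack n c y' z' u v = slack n c y z u v - (if 0 < S u then \<delta> else 0) + (if 0 < T v then \<delta> else 0)"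
    using y' z' uv by (simp add: slack_def)
  show "0 \<le> r (u * n + v) \<and> 0 \<le> slack n c y' z' u v \<and>
      (0 < r (u * n + v) \<longrightarrow> slack n c y' z' u v = 0)"
    using old min[rule_format, OF uv] closed[rule_format, OF uv(2) _ uv(1)] 0 unfolding new
    by (cases "0 < S u"; cases "0 < T v"; cases "0 < r (u * n + v)") auto
qed

text \<open>The minimising arc becomes tight and its column \<open>w\<close> joins the forest.
  Unless \<open>w\<close> ends the search, the unlabelled rows with a positive entry in column
  \<open>w\<close> join too, which keeps the labelled columns closed. The new label is
  \<open>k + 2\<close> because rounds count from 0 and roots have label 1.\<close>

lemma forest_ok_grow:
  assumes f: "forest_ok n r a b c y z S T pc co (-1) k" and k: "0 \<le> k"
    and g: "g \<in> {0..<n}" "w \<in> {0..<n}" "0 < S g" "\<not> 0 < T w" "\<delta> = slack n c y z g w"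
    and min: "\<forall>u\<in>{0..<n}. \<forall>v\<in>{0..<n}. 0 < S u \<and> \<not> 0 < T v \<longrightarrow> \<delta> \<le> slack n c y z u v"
    and y': "\<forall>u\<in>{0..<n}. y' u = (if 0 < S u then y u + \<delta> else y u)"
    and z': "\<forall>v\<in>{0..<n}. z' v = (if 0 < T v then z v - \<delta> else z v)"
    and S': "\<forall>u\<in>{0..<n}. S' u = (if \<not> 0 < b w \<and> \<not> 0 < S u \<and> 0 < r (u * n + w) then k + 2 else S u)"
    and x': "x' = (if 0 < b w then w else -1)"
  shows "forest_ok n r a b c y' z' S' (T(w := k + 2)) (pc(w := g)) (co(k + 2 := w)) x' (k + 1)"
proof -
  note row = forest_ok_rowD[OF f] and col = forest_ok_colD[OF f]
  have not_end: "v \<noteq> -1" if "v \<in> {0..<n}" for v using that by auto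
  have keep: "S' u = S u" if "u \<in> {0..<n}" "0 < S u" for u using S' that by auto
  have pos: "0 < S' u" if "u \<in> {0..<n}" "0 < S u" for u using keep that by auto
  have "duals_ok n c y' z' r"
    using f by (intro duals_ok_shift[OF _ g min _ y' z']) (use col(4) not_end forest_ok_duals in blast)+
  moreover have "0 \<le> S' u \<and> S' u \<le> k + 1 + 1 \<and> (S' u = 1 \<longleftrightarrow> 0 < a u) \<and>
      (1 < S' u \<longrightarrow> (co(k + 2 := w)) (S' u) \<in> {0..<n} \<and> (T(w := k + 2)) ((co(k + 2 := w)) (S' u)) = S' u \<and>
        0 < r (u * n + (co(k + 2 := w)) (S' u)))" if u: "u \<in> {0..<n}" for u
  proof (cases "\<not> 0 < b w \<and> \<not> 0 < S u \<and> 0 < r (u * n + w)")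
    case True
    then have "S' u = k + 2" using S' u by auto
    moreover have "S u \<noteq> 1" using True by auto
    ultimately show ?thesis using True row(3)[OF u] k g by auto
  next
    case False
    then have "S' u = S u" using S' u by auto
    moreover have "co (S u) \<noteq> w" if "1 < S u" using row(4)[OF u that] g(4) that by auto
    ultimately show ?thesis using row[OF u] by auto
  qed
  moreover have "0 \<le> (T(w := k + 2)) v \<and> (T(w := k + 2)) v \<le> k + 1 + 1 \<and>
      (0 < (T(w := k + 2)) v \<longrightarrow> (pc(w := g)) v \<in> {0..<n} \<and> 0 < S' ((pc(w := g)) v) \<and>
        S' ((pc(w := g)) v) < (T(w := k + 2)) v \<and> slack n c y' z' ((pc(w := g)) v) v = 0 \<and>
        (v \<noteq> x' \<longrightarrow> b v \<le> 0 \<and> (\<forall>u\<in>{0..<n}. 0 < r (u * n + v) \<longrightarrow> 0 < S' u)))"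
    if v: "v \<in> {0..<n}" for v
  proof (cases "v = w")
    case True
    have "S' g < k + 2" using keep[OF g(1,3)] row(2)[OF g(1)] by simp
    moreover have "slack n c y' z' g w = 0" using y' z' g by (simp add: slack_def)
    moreover have "0 < S' u" if "u \<in> {0..<n}" "0 < r (u * n + w)" "\<not> 0 < b w" for u
      using S' that k by auto
    ultimately show ?thesis using True k g pos[OF g(1,3)] x' by auto
  next
    case False
    show ?thesis
    proof (cases "0 < T v")
      case True
      note c = col(3)[OF v True] col(4)[OF v True not_end[OF v]]
      have "slack n c y' z' (pc v) v = 0" using c y' z' v True by (simp add: slack_def)
      then show ?thesis using False col(1,2)[OF v] c keep[of "pc v"] pos by auto
    next
      case False
      then show ?thesis using \<open>v \<noteq> w\<close> col(1,2)[OF v] by auto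
    qed
  qed
  moreover have "x' = -1 \<or> x' \<in> {0..<n} \<and> 0 < (T(w := k + 2)) x' \<and> 0 < b x'"
    using x' g k by auto
  moreover have "card {v\<in>{0..<n}. 0 < (T(w := k + 2)) v} = nat (k + 1)" if "\<exists>u\<in>{0..<n}. 0 < a u"
  proof -
    have "{v\<in>{0..<n}. 0 < (T(w := k + 2)) v} = insert w {v\<in>{0..<n}. 0 < T v}"
      using g k by auto
    moreover have "finite {v\<in>{0..<n}. 0 < T v}" by (rule finite_subset[of _ "{0..<n}"]) auto
    moreover have "card {v\<in>{0..<n}. 0 < T v} = nat k" using f that unfolding forest_ok_def by blast
    ultimately show ?thesis using g(4) k by (simp add: nat_add_distrib del: atLeastLessThan_iff)
  qed
  ultimately show ?thesis unfolding forest_ok_def by blast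
qed

text \<open>The current assignment \<open>r\<close> while the augmenting path is traced back from \<open>x\<close> to the root:
  it has one unit more than \<open>r0\<close> in column \<open>x\<close> and in the current row \<open>g\<close>, and \<open>r0\<close> has not been
  decreased in the rows that can still be visited.\<close>

definition path_ok ::
  "int \<Rightarrow> (int \<Rightarrow> int) \<Rightarrow> (int \<Rightarrow> int) \<Rightarrow> (int \<Rightarrow> int) \<Rightarrow> (int \<Rightarrow> int) \<Rightarrow> int \<Rightarrow> (int \<Rightarrow> int)
    \<Rightarrow> (int \<Rightarrow> int) \<Rightarrow> int \<Rightarrow> bool" where
  "path_ok n c y z S x r0 r g \<longleftrightarrow> g \<in> {0..<n} \<and> 0 < S g \<and> duals_ok n c y z r \<and>
    (\<forall>u\<in>{0..<n}. 0 < S u \<and> S u \<le> S g \<longrightarrow> (\<forall>v\<in>{0..<n}. r0 (u * n + v) \<le> r (u * n + v))) \<and>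
    (\<forall>u\<in>{0..<n}. row_sum n r u = row_sum n r0 u + (if u = g then 1 else 0)) \<and>
    (\<forall>v\<in>{0..<n}. col_sum n r v = col_sum n r0 v + (if v = x then 1 else 0))"

lemma path_ok_init:
  assumes f: "forest_ok n r0 a b c y z S T pc co x k" and x: "x \<noteq> -1"
  shows "path_ok n c y z S x r0 (r0(pc x * n + x := r0 (pc x * n + x) + 1)) (pc x)" "S (pc x) \<le> k"
proof -
  note e = forest_ok_endD[OF f x]
  have x: "x \<in> {0..<n}" "pc x \<in> {0..<n}" "0 < S (pc x)" "slack n c y z (pc x) x = 0"
      "duals_ok n c y z r0"
    using e forest_ok_colD(3)[OF f e(1,2)] forest_ok_duals[OF f] by auto
  have "duals_ok n c y z (r0(pc x * n + x := r0 (pc x * n + x) + 1))"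
    using x by (intro duals_ok_update) (auto simp: duals_ok_def)
  then show "path_ok n c y z S x r0 (r0(pc x * n + x := r0 (pc x * n + x) + 1)) (pc x)"
    unfolding path_ok_def using x row_sum_update[OF x(1)] col_sum_update[OF x(1,2)]
    by simp
  show "S (pc x) \<le> k" using forest_ok_colD(2)[OF f e(1)] forest_ok_colD(3)[OF f e(1,2)] by simp
qed

text \<open>Row \<open>g\<close> passes its surplus unit to the row \<open>g'\<close> through the
  column \<open>w\<close> that was labelled together with \<open>g\<close>. The entry at
  \<open>(g, w)\<close> is positive in \<open>r0\<close> and has not been decreased so far; the arc
  from \<open>g'\<close> to \<open>w\<close> is tight and may gain a unit.\<close>

lemma path_ok_step:
  assumes p: "path_ok n c y z S x r0 r g" and f: "forest_ok n r0 a b c y z S T pc co x k"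
    and g: "1 < S g" and w: "w = co (S g)" and g': "g' = pc w"
    and r1: "r1 = r(g * n + w := r (g * n + w) - 1)"
    and r2: "r2 = r1(g' * n + w := r1 (g' * n + w) + 1)"
  shows "path_ok n c y z S x r0 r2 g'" "S g' < S g"
proof -
  have gn: "g \<in> {0..<n}" using p by (simp add: path_ok_def)
  then have wn: "w \<in> {0..<n}" "T w = S g" "0 < r0 (g * n + w)"
    using forest_ok_rowD(4)[OF f gn g] w by auto
  then have g'n: "g' \<in> {0..<n}" "0 < S g'" "S g' < S g" "slack n c y z g' w = 0"
    using forest_ok_colD(3)[OF f wn(1)] g g' by auto
  then show "S g' < S g" by simp
  have "0 < r (g * n + w)" using p gn wn g unfolding path_ok_def by fastforce
  then have d1: "duals_ok n c y z r1"
    unfolding r1 using p gn wn(1) by (intro duals_ok_update) (auto simp: path_ok_def duals_ok_def)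
  then have d2: "duals_ok n c y z r2"
    unfolding r2 using g'n wn(1) by (intro duals_ok_update) (auto simp: duals_ok_def)
  have r1': "r1 = r(g * n + w := r (g * n + w) + (-1))" by (simp add: r1)
  \<comment> \<open>Only row \<open>g\<close> loses a unit here, and its label exceeds that of
    \<open>g'\<close>.\<close>
  have ge: "r0 (u * n + v) \<le> r2 (u * n + v)"
    if "u \<in> {0..<n}" "0 < S u" "S u \<le> S g'" "v \<in> {0..<n}" for u v
  proof -
    have "u \<noteq> g" using that g'n by auto
    then have "r1 (u * n + v) = r (u * n + v)" using that wn(1) by (auto simp: r1 index_inj)
    moreover have "r1 (u * n + v) \<le> r2 (u * n + v)" by (simp add: r2)
    moreover have "r0 (u * n + v) \<le> r (u * n + v)" using p that g'n by (auto simp: path_ok_def)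
    ultimately show ?thesis by simp
  qed
  have "row_sum n r2 u = row_sum n r0 u + (if u = g' then 1 else 0)" if "u \<in> {0..<n}" for u
    unfolding r2 row_sum_update[OF wn(1)] unfolding r1' row_sum_update[OF wn(1)]
    using p that by (simp add: path_ok_def)
  moreover have "col_sum n r2 v = col_sum n r0 v + (if v = x then 1 else 0)" if "v \<in> {0..<n}" for v
    unfolding r2 col_sum_update[OF wn(1) g'n(1) that] unfolding r1' col_sum_update[OF wn(1) gn that]
    using p that by (simp add: path_ok_def)
  ultimately show "path_ok n c y z S x r0 r2 g'"
    unfolding path_ok_def using g'n d2 ge by blast
qed

text \<open>An optimal partial assignment: \<open>a\<close> and \<open>b\<close> are the parts of the supplies \<open>p\<close> and demands
  \<open>q\<close> that are not yet assigned.\<close>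

definition partial_opt ::
  "int \<Rightarrow> (int \<Rightarrow> int) \<Rightarrow> (int \<Rightarrow> int) \<Rightarrow> (int \<Rightarrow> int) \<Rightarrow> (int \<Rightarrow> int) \<Rightarrow> (int \<Rightarrow> int) \<Rightarrow> (int \<Rightarrow> int)
    \<Rightarrow> (int \<Rightarrow> int) \<Rightarrow> (int \<Rightarrow> int) \<Rightarrow> bool" where
  "partial_opt n c p q y z r a b \<longleftrightarrow> duals_ok n c y z r \<and>
    (\<forall>u\<in>{0..<n}. 0 \<le> a u \<and> a u + row_sum n r u = p u) \<and>
    (\<forall>v\<in>{0..<n}. 0 \<le> b v \<and> b v + col_sum n r v = q v)"

text \<open>A positive label of at most 1 marks a root, which has supply, just as \<open>x\<close>
  has demand. The traced path turns one unit of each into a unit of \<open>r\<close>.\<close>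

lemma partial_opt_augmented:
  assumes po: "partial_opt n c p q y0 z0 r0 a b"
    and f: "forest_ok n r0 a b c y z S T pc co x k" and x: "x \<noteq> -1"
    and p: "path_ok n c y z S x r0 r g" and g: "S g \<le> 1"
  shows "partial_opt n c p q y z r (a(g := a g - 1)) (b(x := b x - 1))"
    "sum (a(g := a g - 1)) {0..<n} = sum a {0..<n} - 1" "sum (b(x := b x - 1)) {0..<n} = sum b {0..<n} - 1"
proof -
  have gn: "g \<in> {0..<n}" "S g = 1" "duals_ok n c y z r" using p g unfolding path_ok_def by auto
  have ag: "0 < a g" using forest_ok_rowD(3)[OF f gn(1)] gn(2) by simp
  note xn = forest_ok_endD(1,3)[OF f x]
  show "partial_opt n c p q y z r (a(g := a g - 1)) (b(x := b x - 1))"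
    using po p gn ag xn unfolding partial_opt_def path_ok_def by auto
  have dec: "sum (h(i := h i - 1)) {0..<n} = sum h {0..<n} - 1" if "i \<in> {0..<n}" for h :: "int \<Rightarrow> int" and i
  proof -
    have "sum (h(i := h i - 1)) {0..<n} = (\<Sum>j\<in>{0..<n}. h j - (if j = i then 1 else 0))"
      by (intro sum.cong) auto
    then show ?thesis using that by (simp add: sum_subtractf)
  qed
  show "sum (a(g := a g - 1)) {0..<n} = sum a {0..<n} - 1" "sum (b(x := b x - 1)) {0..<n} = sum b {0..<n} - 1"
    using dec gn(1) xn(1) by auto
qed

text \<open>If supply remains, then \<open>n\<close> rounds have labelled all \<open>n\<close>
  columns, and a labelled column that is not the end has no demand.\<close>

lemma partial_opt_unaugmented:
  assumes po: "partial_opt n c p q y0 z0 r a b"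
    and f: "forest_ok n r a b c y z S T pc co (-1) n" and n: "0 \<le> n"
  shows "partial_opt n c p q y z r a b" "sum a {0..<n} = 0 \<or> sum b {0..<n} = 0"
proof -
  show "partial_opt n c p q y z r a b"
    using po f unfolding partial_opt_def forest_ok_def by auto
  have nonneg: "\<forall>u\<in>{0..<n}. 0 \<le> a u" "\<forall>v\<in>{0..<n}. 0 \<le> b v" using po unfolding partial_opt_def by auto
  show "sum a {0..<n} = 0 \<or> sum b {0..<n} = 0"
  proof (cases "\<exists>u\<in>{0..<n}. 0 < a u")
    case True
    then have "card {v\<in>{0..<n}. 0 < T v} = card {0..<n}" using f by (auto simp: forest_ok_def)
    then have "{v\<in>{0..<n}. 0 < T v} = {0..<n}" by (intro card_subset_eq) auto
    then have "\<forall>v\<in>{0..<n}. b v \<le> 0" using f unfolding forest_ok_def by force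
    then have "\<forall>v\<in>{0..<n}. b v = 0" using nonneg by force
    then show ?thesis by simp
  next
    case False
    then have "\<forall>u\<in>{0..<n}. a u = 0" using nonneg by force
    then show ?thesis by simp
  qed
qed

text \<open>\<open>m div h\<close> is twice \<open>m div (2 * h)\<close> plus one bit. Doubling
  keeps the set of positive entries of \<open>r\<close> and thus the validity of the prices. A side
  that was used up is left with at most one bit per vertex.\<close>

lemma partial_opt_double:
  assumes po: "partial_opt n c p q y z r a b" and q: "0 < h"
    and p: "\<forall>u\<in>{0..<n}. p u = s u div (2 * h)" and q: "\<forall>v\<in>{0..<n}. q v = t v div (2 * h)"
    and r': "\<forall>u\<in>{0..<n}. \<forall>v\<in>{0..<n}. r' (u * n + v) = r (u * n + v) + r (u * n + v)"
    and a': "\<forall>u\<in>{0..<n}. a' u = a u + a u + s u div h - (s u div (2 * h) + s u div (2 * h))"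
    and b': "\<forall>v\<in>{0..<n}. b' v = b v + b v + t v div h - (t v div (2 * h) + t v div (2 * h))"
    and fin: "sum a {0..<n} = 0 \<or> sum b {0..<n} = 0" and n: "0 \<le> n"
  shows "partial_opt n c (\<lambda>u. s u div h) (\<lambda>v. t v div h) y z r' a' b'"
    "sum a' {0..<n} \<le> n \<or> sum b' {0..<n} \<le> n"
proof -
  have half: "0 \<le> m div h - (m div (2 * h) + m div (2 * h))" "m div h - (m div (2 * h) + m div (2 * h)) \<le> 1" for m :: int
  proof -
    have "m div (2 * h) = m div h div 2"
      using \<open>0 < h\<close> by (simp add: zdiv_zmult2_eq[of 2 m h, symmetric] mult.commute)
    moreover have "0 \<le> e - (e div 2 + e div 2) \<and> e - (e div 2 + e div 2) \<le> 1" for e :: int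
      by presburger
    ultimately show "0 \<le> m div h - (m div (2 * h) + m div (2 * h))" "m div h - (m div (2 * h) + m div (2 * h)) \<le> 1"
      by simp_all
  qed
  have rs: "row_sum n r' u = 2 * row_sum n r u" if "u \<in> {0..<n}" for u
    using r' that by (simp add: row_sum_def sum_distrib_left)
  have cs: "col_sum n r' v = 2 * col_sum n r v" if "v \<in> {0..<n}" for v
    using r' that by (simp add: col_sum_def sum_distrib_left)
  have "0 \<le> a' u \<and> a' u + row_sum n r' u = s u div h" if u: "u \<in> {0..<n}" for u
  proof -
    have "0 \<le> a u" "a u + row_sum n r u = s u div (2 * h)" using po p u by (auto simp: partial_opt_def)
    then show ?thesis using half(1)[of "s u"] a' rs[OF u] u by auto
  qed
  moreover have "0 \<le> b' v \<and> b' v + col_sum n r' v = t v div h" if v: "v \<in> {0..<n}" for v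
  proof -
    have "0 \<le> b v" "b v + col_sum n r v = t v div (2 * h)" using po q v by (auto simp: partial_opt_def)
    then show ?thesis using half(1)[of "t v"] b' cs[OF v] v by auto
  qed
  moreover have "duals_ok n c y z r'"
    using po r' unfolding partial_opt_def duals_ok_def by auto
  ultimately show "partial_opt n c (\<lambda>u. s u div h) (\<lambda>v. t v div h) y z r' a' b'"
    unfolding partial_opt_def by auto
  have small: "sum h' {0..<n} \<le> n"
    if "sum g {0..<n} = 0" "\<forall>u\<in>{0..<n}. 0 \<le> g u"
      "\<forall>u\<in>{0..<n}. h' u = g u + g u + m u div h - (m u div (2 * h) + m u div (2 * h))" for g h' m :: "int \<Rightarrow> int"
  proof -
    have "\<forall>u\<in>{0..<n}. g u = 0" using that(1,2) by (subst (asm) sum_nonneg_eq_0_iff) auto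
    then have "h' u \<le> 1" if "u \<in> {0..<n}" for u
      using half(2)[of "m u"] \<open>\<forall>u\<in>{0..<n}. h' u = _ u\<close> that by auto
    then have "sum h' {0..<n} \<le> (\<Sum>u\<in>{0..<n}. 1)" by (intro sum_mono)
    then show ?thesis using n by simp
  qed
  show "sum a' {0..<n} \<le> n \<or> sum b' {0..<n} \<le> n"
    using fin small[of a a' s] small[of b b' t] a' b' po unfolding partial_opt_def by blast
qed

subsection \<open>The program\<close>

text \<open>Throughout, \<open>r\<close> is the current assignment for the degrees rounded down to multiples of the scale
  \<open>p\<close> and divided by it, \<open>a\<close> and \<open>b\<close> are the remaining supplies and demands, and \<open>y\<close>, \<open>z\<close> the
  dual prices. Each iteration of \<open>h\<close> in a phase is one search with at most one augmentation by one
  unit; as halving \<open>p\<close> leaves a remainder of at most \<open>n\<close>, \<open>n\<close> of them suffice.\<close>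

abbreviation cell :: "vname \<Rightarrow> aexp \<Rightarrow> aexp \<Rightarrow> aexp" where
  "cell x a b \<equiv> Idx x (Add (Mul a (V ''n'')) b)"

text \<open>\<open>g = -1\<close> means that no candidate has been seen, in which case the stale
  value of \<open>e\<close> must not count. The language has no disjunction, hence the negated
  conjunction.\<close>

definition find_min :: hcom where
  "find_min =
    HAssign ''g'' (N 0) (N (-1)) ;;
    HFor ''u'' (HFor ''v''
      (HIf (And (Less (N 0) (Idx ''S'' (V ''u''))) (And (Not (Less (N 0) (Idx ''T'' (V ''v''))))
          (Not (And (Less (N (-1)) (V ''g''))
            (Not (Less (Sub (Sub (cell ''c'' (V ''u'') (V ''v'')) (Idx ''y'' (V ''u''))) (Idx ''z'' (V ''v''))) (V ''e'')))))))
        (HAssign ''g'' (N 0) (V ''u'') ;; HAssign ''w'' (N 0) (V ''v'') ;;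
         HAssign ''e'' (N 0) (Sub (Sub (cell ''c'' (V ''u'') (V ''v'')) (Idx ''y'' (V ''u''))) (Idx ''z'' (V ''v''))))
        HSkip))"

definition shift_duals :: hcom where
  "shift_duals = HFor ''u''
    (HIf (Less (N 0) (Idx ''S'' (V ''u'')))
      (HAssign ''y'' (V ''u'') (Add (Idx ''y'' (V ''u'')) (V ''e''))) HSkip ;;
     HIf (Less (N 0) (Idx ''T'' (V ''u'')))
      (HAssign ''z'' (V ''u'') (Sub (Idx ''z'' (V ''u'')) (V ''e''))) HSkip)"

definition grow :: hcom where
  "grow =
    HAssign ''T'' (V ''w'') (Add (V ''k'') (N 2)) ;;
    HAssign ''pc'' (V ''w'') (V ''g'') ;;
    HAssign ''co'' (Add (V ''k'') (N 2)) (V ''w'') ;;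
    HIf (Less (N 0) (Idx ''b'' (V ''w'')))
      (HAssign ''x'' (N 0) (V ''w''))
      (HFor ''u'' (HIf (And (Not (Less (N 0) (Idx ''S'' (V ''u'')))) (Less (N 0) (cell ''r'' (V ''u'') (V ''w''))))
        (HAssign ''S'' (V ''u'') (Add (V ''k'') (N 2))) HSkip))"

definition init_search :: hcom where
  "init_search =
    HAssign ''x'' (N 0) (N (-1)) ;;
    HFor ''u''
      (HIf (Less (N 0) (Idx ''a'' (V ''u''))) (HAssign ''S'' (V ''u'') (N 1)) (HAssign ''S'' (V ''u'') (N 0)) ;;
       HAssign ''T'' (V ''u'') (N 0))"

text \<open>An \<open>HFor\<close> loop cannot be left early, so rounds after the end
  \<open>x\<close> has been found do nothing.\<close>

definition search :: hcom where
  "search = HFor ''k''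
    (HIf (Less (V ''x'') (N 0))
      (find_min ;; HIf (Less (V ''g'') (N 0)) HSkip (shift_duals ;; grow))
      HSkip)"

definition augment :: hcom where
  "augment = HIf (Less (V ''x'') (N 0)) HSkip
    (HAssign ''b'' (V ''x'') (Sub (Idx ''b'' (V ''x'')) (N 1)) ;;
     HAssign ''g'' (N 0) (Idx ''pc'' (V ''x'')) ;;
     HAssign ''r'' (Add (Mul (V ''g'') (V ''n'')) (V ''x'')) (Add (cell ''r'' (V ''g'') (V ''x'')) (N 1)) ;;
     HFor ''k'' (HIf (Less (N 1) (Idx ''S'' (V ''g'')))
       (HAssign ''w'' (N 0) (Idx ''co'' (Idx ''S'' (V ''g''))) ;;
        HAssign ''r'' (Add (Mul (V ''g'') (V ''n'')) (V ''w'')) (Sub (cell ''r'' (V ''g'') (V ''w'')) (N 1)) ;;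
        HAssign ''g'' (N 0) (Idx ''pc'' (V ''w'')) ;;
        HAssign ''r'' (Add (Mul (V ''g'') (V ''n'')) (V ''w'')) (Add (cell ''r'' (V ''g'') (V ''w'')) (N 1)))
       HSkip) ;;
     HAssign ''a'' (V ''g'') (Sub (Idx ''a'' (V ''g'')) (N 1)))"

text \<open>\<open>p\<close> is the old scale and \<open>q\<close> the new one. A quotient by
  \<open>q\<close> minus twice the quotient by \<open>p\<close> is the newly revealed bit.\<close>

definition double :: hcom where
  "double =
    HAssign ''q'' (N 0) (Div (V ''p'') (N 2)) ;;
    HFor ''u''
      (HAssign ''a'' (V ''u'') (Sub (Add (Add (Idx ''a'' (V ''u'')) (Idx ''a'' (V ''u'')))
          (Div (Idx ''out'' (V ''u'')) (V ''q'')))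
        (Add (Div (Idx ''out'' (V ''u'')) (V ''p'')) (Div (Idx ''out'' (V ''u'')) (V ''p'')))) ;;
       HAssign ''b'' (V ''u'') (Sub (Add (Add (Idx ''b'' (V ''u'')) (Idx ''b'' (V ''u'')))
          (Div (Idx ''in'' (V ''u'')) (V ''q'')))
        (Add (Div (Idx ''in'' (V ''u'')) (V ''p'')) (Div (Idx ''in'' (V ''u'')) (V ''p'')))) ;;
       HFor ''v'' (HAssign ''r'' (Add (Mul (V ''u'') (V ''n'')) (V ''v''))
         (Add (cell ''r'' (V ''u'') (V ''v'')) (cell ''r'' (V ''u'') (V ''v''))))) ;;
    HAssign ''p'' (N 0) (V ''q'')"

definition phase :: hcom where
  "phase = double ;; HFor ''h'' (init_search ;; search ;; augment)"

section \<open>Correctness of search, augmentation and doubling\<close>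

lemma matrix_update_apply:
  fixes n :: int
  assumes "v \<in> {0..<n}" "v' \<in> {0..<n}"
  shows "(r(u * n + v := a)) (u' * n + v') = (if u' = u \<and> v' = v then a else r (u' * n + v'))"
  using assms by (auto simp: index_inj)

text \<open>Loop invariant of \<open>find_min\<close>: \<open>A\<close> consists of the pairs
  inspected so far, and \<sigma> is the state before the loops.\<close>

definition min_ok :: "state \<Rightarrow> (int \<times> int) set \<Rightarrow> state \<Rightarrow> bool" where
  "min_ok \<sigma> A \<tau> \<longleftrightarrow>
    (\<tau> ''g'' 0 = -1 \<and> (\<forall>(u, v)\<in>A. \<not> (0 < \<sigma> ''S'' u \<and> \<not> 0 < \<sigma> ''T'' v))) \<or>
    ((\<tau> ''g'' 0, \<tau> ''w'' 0) \<in> A \<and> 0 \<le> \<tau> ''g'' 0 \<and>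
      0 < \<sigma> ''S'' (\<tau> ''g'' 0) \<and> \<not> 0 < \<sigma> ''T'' (\<tau> ''w'' 0) \<and>
      \<tau> ''e'' 0 = slack (\<sigma> ''n'' 0) (\<sigma> ''c'') (\<sigma> ''y'') (\<sigma> ''z'') (\<tau> ''g'' 0) (\<tau> ''w'' 0) \<and>
      (\<forall>(u, v)\<in>A. 0 < \<sigma> ''S'' u \<and> \<not> 0 < \<sigma> ''T'' v \<longrightarrow>
        \<tau> ''e'' 0 \<le> slack (\<sigma> ''n'' 0) (\<sigma> ''c'') (\<sigma> ''y'') (\<sigma> ''z'') u v))"

lemma min_ok_upd [simp]:
  "x \<noteq> ''g'' \<Longrightarrow> x \<noteq> ''w'' \<Longrightarrow> x \<noteq> ''e'' \<Longrightarrow> min_ok \<sigma> A (upd x i a \<tau>) = min_ok \<sigma> A \<tau>"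
  by (simp add: min_ok_def)

lemma find_min_correct:
  assumes n: "\<sigma> ''n'' 0 = n" "0 \<le> n"
  shows "min_ok \<sigma> ({0..<n} \<times> {0..<n}) (sem find_min \<sigma>)"
proof -
  define body where "body =
      (HIf (And (Less (N 0) (Idx ''S'' (V ''u''))) (And (Not (Less (N 0) (Idx ''T'' (V ''v''))))
          (Not (And (Less (N (-1)) (V ''g''))
            (Not (Less (Sub (Sub (cell ''c'' (V ''u'') (V ''v'')) (Idx ''y'' (V ''u''))) (Idx ''z'' (V ''v''))) (V ''e'')))))))
        (HAssign ''g'' (N 0) (V ''u'') ;; HAssign ''w'' (N 0) (V ''v'') ;;
         HAssign ''e'' (N 0) (Sub (Sub (cell ''c'' (V ''u'') (V ''v'')) (Idx ''y'' (V ''u''))) (Idx ''z'' (V ''v''))))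
        HSkip)"
  define \<sigma>1 where "\<sigma>1 = upd ''g'' 0 (-1) \<sigma>"
  have body: "min_ok \<sigma> (insert (u, v) A) (sem body \<tau>)"
    if "min_ok \<sigma> A \<tau>" "\<tau> ''u'' 0 = u" "\<tau> ''v'' 0 = v" "0 \<le> u"
      "\<And>x. x \<notin> {''g'', ''w'', ''e'', ''u'', ''v''} \<Longrightarrow> \<tau> x = \<sigma> x" for u v A \<tau>
  proof -
    have eq: "\<tau> ''S'' = \<sigma> ''S''" "\<tau> ''T'' = \<sigma> ''T''" "\<tau> ''c'' = \<sigma> ''c''" "\<tau> ''y'' = \<sigma> ''y''"
      "\<tau> ''z'' = \<sigma> ''z''" "\<tau> ''n'' = \<sigma> ''n''" using that(5) by simp_all
    show ?thesis
      using that(1-4) unfolding min_ok_def body_def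
      by (auto simp: eq slack_def)
  qed
  have "min_ok \<sigma> ({0..<n} \<times> {0..<n}) (sem (HFor ''u'' (HFor ''v'' body)) \<sigma>1)"
  proof (rule sem_HFor_rule[where I = "\<lambda>j. min_ok \<sigma> ({0..<j} \<times> {0..<n})"])
    show "wf_hcom (HFor ''u'' (HFor ''v'' body))" by (simp add: body_def)
    show "\<sigma>1 ''n'' 0 = n" "0 \<le> n" using n by (simp_all add: \<sigma>1_def)
    show "min_ok \<sigma> ({0..<0} \<times> {0..<n}) (upd ''u'' 0 0 \<sigma>1)" by (simp add: min_ok_def \<sigma>1_def)
  next
    fix j \<tau>
    assume j: "0 \<le> j" "j < n" "\<tau> ''u'' 0 = j" "min_ok \<sigma> ({0..<j} \<times> {0..<n}) \<tau>"
      and fr: "\<And>x. x \<notin> set (''u'' # mods (HFor ''v'' body)) \<Longrightarrow> \<tau> x = \<sigma>1 x"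
    have "min_ok \<sigma> ({0..<j} \<times> {0..<n} \<union> {j} \<times> {0..<n}) (sem (HFor ''v'' body) \<tau>)"
    proof (rule sem_HFor_rule[where I = "\<lambda>i. min_ok \<sigma> ({0..<j} \<times> {0..<n} \<union> {j} \<times> {0..<i})"])
      show "wf_hcom (HFor ''v'' body)" by (simp add: body_def)
      show "\<tau> ''n'' 0 = n" "0 \<le> n" using n fr by (simp_all add: \<sigma>1_def body_def)
      show "min_ok \<sigma> ({0..<j} \<times> {0..<n} \<union> {j} \<times> {0..<0}) (upd ''v'' 0 0 \<tau>)" using j by simp
    next
      fix i \<tau>'
      assume i: "0 \<le> i" "i < n" "\<tau>' ''v'' 0 = i" "min_ok \<sigma> ({0..<j} \<times> {0..<n} \<union> {j} \<times> {0..<i}) \<tau>'"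
        and fr': "\<And>x. x \<notin> set (''v'' # mods body) \<Longrightarrow> \<tau>' x = \<tau> x"
      have "min_ok \<sigma> (insert (j, i) ({0..<j} \<times> {0..<n} \<union> {j} \<times> {0..<i})) (sem body \<tau>')"
        by (rule body) (use i j fr fr' in \<open>auto simp: \<sigma>1_def body_def\<close>)
      moreover have "insert (j, i) ({0..<j} \<times> {0..<n} \<union> {j} \<times> {0..<i}) = {0..<j} \<times> {0..<n} \<union> {j} \<times> {0..<i + 1}"
        using i by auto
      ultimately show "min_ok \<sigma> ({0..<j} \<times> {0..<n} \<union> {j} \<times> {0..<i + 1}) (upd ''v'' 0 (i + 1) (sem body \<tau>'))"
        by simp
    qed
    moreover have "{0..<j} \<times> {0..<n} \<union> {j} \<times> {0..<n} = {0..<j + 1} \<times> {0..<n}" using j by auto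
    ultimately show "min_ok \<sigma> ({0..<j + 1} \<times> {0..<n}) (upd ''u'' 0 (j + 1) (sem (HFor ''v'' body) \<tau>))"
      by simp
  qed
  moreover have "sem find_min \<sigma> = sem (HFor ''u'' (HFor ''v'' body)) \<sigma>1"
    by (simp only: find_min_def body_def \<sigma>1_def sem.simps aval.simps)
  ultimately show ?thesis by simp
qed

lemma shift_duals_correct:
  assumes n: "\<sigma> ''n'' 0 = n" "0 \<le> n"
  defines "\<sigma>' \<equiv> sem shift_duals \<sigma>"
  shows "\<forall>u\<in>{0..<n}. \<sigma>' ''y'' u = (if 0 < \<sigma> ''S'' u then \<sigma> ''y'' u + \<sigma> ''e'' 0 else \<sigma> ''y'' u)"
    "\<forall>v\<in>{0..<n}. \<sigma>' ''z'' v = (if 0 < \<sigma> ''T'' v then \<sigma> ''z'' v - \<sigma> ''e'' 0 else \<sigma> ''z'' v)"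
proof -
  let ?I = "\<lambda>j \<tau>. \<forall>u.
      \<tau> ''y'' u = (if u \<in> {0..<j} \<and> 0 < \<sigma> ''S'' u then \<sigma> ''y'' u + \<sigma> ''e'' 0 else \<sigma> ''y'' u) \<and>
      \<tau> ''z'' u = (if u \<in> {0..<j} \<and> 0 < \<sigma> ''T'' u then \<sigma> ''z'' u - \<sigma> ''e'' 0 else \<sigma> ''z'' u)"
  have "?I n \<sigma>'"
    unfolding \<sigma>'_def shift_duals_def
  proof (rule sem_HFor_rule[where I = ?I], goal_cases)
    case (5 j \<tau>)
    then have "\<tau> ''S'' = \<sigma> ''S''" "\<tau> ''T'' = \<sigma> ''T''" "\<tau> ''e'' = \<sigma> ''e''" by simp_all
    then show ?case using 5(1,2,4,5) by auto
  qed (use n in simp_all)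
  then show "\<forall>u\<in>{0..<n}. \<sigma>' ''y'' u = (if 0 < \<sigma> ''S'' u then \<sigma> ''y'' u + \<sigma> ''e'' 0 else \<sigma> ''y'' u)"
    "\<forall>v\<in>{0..<n}. \<sigma>' ''z'' v = (if 0 < \<sigma> ''T'' v then \<sigma> ''z'' v - \<sigma> ''e'' 0 else \<sigma> ''z'' v)"
    by auto
qed

lemma grow_correct:
  assumes n: "\<sigma> ''n'' 0 = n" "0 \<le> n" and w: "\<sigma> ''w'' 0 = w" and k: "\<sigma> ''k'' 0 = k"
  defines "\<sigma>' \<equiv> sem grow \<sigma>"
  shows "\<sigma>' ''T'' = (\<sigma> ''T'')(w := k + 2)" "\<sigma>' ''pc'' = (\<sigma> ''pc'')(w := \<sigma> ''g'' 0)"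
    "\<sigma>' ''co'' = (\<sigma> ''co'')(k + 2 := w)"
    "\<sigma>' ''x'' 0 = (if 0 < \<sigma> ''b'' w then w else \<sigma> ''x'' 0)"
    "\<forall>u\<in>{0..<n}. \<sigma>' ''S'' u = (if \<not> 0 < \<sigma> ''b'' w \<and> \<not> 0 < \<sigma> ''S'' u \<and> 0 < \<sigma> ''r'' (u * n + w)
      then k + 2 else \<sigma> ''S'' u)"
proof -
  let ?F = "HFor ''u'' (HIf (And (Not (Less (N 0) (Idx ''S'' (V ''u'')))) (Less (N 0) (cell ''r'' (V ''u'') (V ''w''))))
        (HAssign ''S'' (V ''u'') (Add (V ''k'') (N 2))) HSkip)"
  define \<sigma>1 where "\<sigma>1 = upd ''co'' (k + 2) w (upd ''pc'' w (\<sigma> ''g'' 0) (upd ''T'' w (k + 2) \<sigma>))"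
  have eq: "\<sigma>' = (if 0 < \<sigma> ''b'' w then upd ''x'' 0 w \<sigma>1 else sem ?F \<sigma>1)"
    unfolding \<sigma>'_def grow_def \<sigma>1_def using w k by (simp del: sem.simps(5) add: sem.simps)
  let ?I = "\<lambda>j \<tau>. \<forall>u. \<tau> ''S'' u = (if u \<in> {0..<j} \<and> \<not> 0 < \<sigma> ''S'' u \<and> 0 < \<sigma> ''r'' (u * n + w)
      then k + 2 else \<sigma> ''S'' u)"
  have "?I n (sem ?F \<sigma>1)"
  proof (rule sem_HFor_rule[where I = ?I], goal_cases)
    case (5 j \<tau>)
    then have "\<tau> ''r'' = \<sigma> ''r''" "\<tau> ''w'' 0 = w" "\<tau> ''n'' 0 = n" "\<tau> ''k'' 0 = k"
      using n w k by (simp_all add: \<sigma>1_def)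
    then show ?case using 5(1,2,4,5) by auto
  qed (use n in \<open>simp_all add: \<sigma>1_def\<close>)
  then show "\<forall>u\<in>{0..<n}. \<sigma>' ''S'' u = (if \<not> 0 < \<sigma> ''b'' w \<and> \<not> 0 < \<sigma> ''S'' u \<and> 0 < \<sigma> ''r'' (u * n + w)
      then k + 2 else \<sigma> ''S'' u)"
    unfolding eq by (auto simp: \<sigma>1_def)
  have fr: "sem ?F \<sigma>1 x = \<sigma>1 x" if "x \<noteq> ''u''" "x \<noteq> ''S''" for x
    using that by (intro sem_frame) simp
  show "\<sigma>' ''T'' = (\<sigma> ''T'')(w := k + 2)" "\<sigma>' ''pc'' = (\<sigma> ''pc'')(w := \<sigma> ''g'' 0)"
    "\<sigma>' ''co'' = (\<sigma> ''co'')(k + 2 := w)"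
    "\<sigma>' ''x'' 0 = (if 0 < \<sigma> ''b'' w then w else \<sigma> ''x'' 0)"
  proof -
    have same: "\<sigma>' x = \<sigma>1 x" if "x \<noteq> ''u''" "x \<noteq> ''S''" "x \<noteq> ''x''" for x
      using that fr[of x] unfolding eq by (cases "0 < \<sigma> ''b'' w") simp_all
    show "\<sigma>' ''T'' = (\<sigma> ''T'')(w := k + 2)" by (rule ext) (simp add: same \<sigma>1_def)
    show "\<sigma>' ''pc'' = (\<sigma> ''pc'')(w := \<sigma> ''g'' 0)" by (rule ext) (simp add: same \<sigma>1_def)
    show "\<sigma>' ''co'' = (\<sigma> ''co'')(k + 2 := w)" by (rule ext) (simp add: same \<sigma>1_def)
    have "\<sigma>1 ''x'' = \<sigma> ''x''" by (simp add: \<sigma>1_def)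
    then show "\<sigma>' ''x'' 0 = (if 0 < \<sigma> ''b'' w then w else \<sigma> ''x'' 0)"
      using fr[of "''x''"] unfolding eq by (cases "0 < \<sigma> ''b'' w") simp_all
  qed
qed

lemma init_search_correct:
  assumes n: "\<sigma> ''n'' 0 = n" "0 \<le> n"
  defines "\<sigma>' \<equiv> sem init_search \<sigma>"
  shows "\<sigma>' ''x'' 0 = -1" "\<forall>u\<in>{0..<n}. \<sigma>' ''S'' u = (if 0 < \<sigma> ''a'' u then 1 else 0)"
    "\<forall>v\<in>{0..<n}. \<sigma>' ''T'' v = 0"
proof -
  let ?F = "HFor ''u''
      (HIf (Less (N 0) (Idx ''a'' (V ''u''))) (HAssign ''S'' (V ''u'') (N 1)) (HAssign ''S'' (V ''u'') (N 0)) ;;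
       HAssign ''T'' (V ''u'') (N 0))"
  define \<sigma>1 where "\<sigma>1 = upd ''x'' 0 (-1) \<sigma>"
  have eq: "\<sigma>' = sem ?F \<sigma>1"
    unfolding \<sigma>'_def init_search_def \<sigma>1_def by (simp del: sem.simps(5))
  let ?I = "\<lambda>j \<tau>. \<forall>u\<in>{0..<j}. \<tau> ''S'' u = (if 0 < \<sigma> ''a'' u then 1 else 0) \<and> \<tau> ''T'' u = 0"
  have "?I n (sem ?F \<sigma>1)"
  proof (rule sem_HFor_rule[where I = ?I], goal_cases)
    case (5 j \<tau>)
    then have "\<tau> ''a'' = \<sigma> ''a''" by (simp add: \<sigma>1_def)
    then show ?case using 5(1,2,4,5) by auto
  qed (use n in \<open>simp_all add: \<sigma>1_def\<close>)
  then show "\<forall>u\<in>{0..<n}. \<sigma>' ''S'' u = (if 0 < \<sigma> ''a'' u then 1 else 0)" "\<forall>v\<in>{0..<n}. \<sigma>' ''T'' v = 0"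
    unfolding eq by auto
  have "sem ?F \<sigma>1 ''x'' = \<sigma>1 ''x''" by (intro sem_frame) simp
  then show "\<sigma>' ''x'' 0 = -1" unfolding eq by (simp add: \<sigma>1_def)
qed

abbreviation forest_state :: "int \<Rightarrow> state \<Rightarrow> bool" where
  "forest_state k \<sigma> \<equiv> forest_ok (\<sigma> ''n'' 0) (\<sigma> ''r'') (\<sigma> ''a'') (\<sigma> ''b'') (\<sigma> ''c'') (\<sigma> ''y'') (\<sigma> ''z'')
    (\<sigma> ''S'') (\<sigma> ''T'') (\<sigma> ''pc'') (\<sigma> ''co'') (\<sigma> ''x'' 0) k"

lemma search_round_correct:
  assumes f: "forest_state k \<sigma>" and k: "\<sigma> ''k'' 0 = k" "0 \<le> k" "k < \<sigma> ''n'' 0" and x: "\<sigma> ''x'' 0 < 0"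
  shows "forest_state (k + 1) (sem (find_min ;; HIf (Less (V ''g'') (N 0)) HSkip (shift_duals ;; grow)) \<sigma>)"
proof -
  define n where "n = \<sigma> ''n'' 0"
  have n: "\<sigma> ''n'' 0 = n" "0 \<le> n" "k < n" using k by (simp_all add: n_def)
  have x1: "\<sigma> ''x'' 0 = -1" using forest_ok_endD(1)[OF f] x by fastforce
  note f' = f[unfolded x1 n]
  define \<tau>1 where "\<tau>1 = sem find_min \<sigma>"
  have fr1: "\<tau>1 x = \<sigma> x" if "x \<notin> set (mods find_min)" for x
    unfolding \<tau>1_def using that by (rule sem_frame)
  have eq1: "\<tau>1 ''n'' = \<sigma> ''n''" "\<tau>1 ''r'' = \<sigma> ''r''" "\<tau>1 ''a'' = \<sigma> ''a''" "\<tau>1 ''b'' = \<sigma> ''b''"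
    "\<tau>1 ''c'' = \<sigma> ''c''" "\<tau>1 ''y'' = \<sigma> ''y''" "\<tau>1 ''z'' = \<sigma> ''z''" "\<tau>1 ''S'' = \<sigma> ''S''"
    "\<tau>1 ''T'' = \<sigma> ''T''" "\<tau>1 ''pc'' = \<sigma> ''pc''" "\<tau>1 ''co'' = \<sigma> ''co''" "\<tau>1 ''x'' = \<sigma> ''x''" "\<tau>1 ''k'' = \<sigma> ''k''"
    by (rule fr1; simp add: find_min_def)+
  have min: "min_ok \<sigma> ({0..<n} \<times> {0..<n}) \<tau>1"
    unfolding \<tau>1_def using find_min_correct n by blast
  show ?thesis
  proof (cases "\<tau>1 ''g'' 0 < 0")
    case True
    then have no: "\<forall>u\<in>{0..<n}. \<forall>v\<in>{0..<n}. \<not> (0 < \<sigma> ''S'' u \<and> \<not> 0 < \<sigma> ''T'' v)"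
      using min unfolding min_ok_def by auto
    have "forest_state (k + 1) \<tau>1"
      unfolding eq1 x1 n
      using forest_ok_stuck[OF f' forest_ok_complete[OF f' k(2) n(3) no]] .
    then show ?thesis using True by (simp add: \<tau>1_def)
  next
    case False
    define g w \<delta> where "g = \<tau>1 ''g'' 0" and "w = \<tau>1 ''w'' 0" and "\<delta> = \<tau>1 ''e'' 0"
    have g: "g \<in> {0..<n}" "w \<in> {0..<n}" "0 < \<sigma> ''S'' g" "\<not> 0 < \<sigma> ''T'' w"
      "\<delta> = slack n (\<sigma> ''c'') (\<sigma> ''y'') (\<sigma> ''z'') g w"
      and least: "\<forall>u\<in>{0..<n}. \<forall>v\<in>{0..<n}. 0 < \<sigma> ''S'' u \<and> \<not> 0 < \<sigma> ''T'' v \<longrightarrow>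
        \<delta> \<le> slack n (\<sigma> ''c'') (\<sigma> ''y'') (\<sigma> ''z'') u v"
      using min False unfolding min_ok_def g_def w_def \<delta>_def n by auto
    define \<tau>2 where "\<tau>2 = sem shift_duals \<tau>1"
    have fr2: "\<tau>2 x = \<tau>1 x" if "x \<notin> set (mods shift_duals)" for x
      unfolding \<tau>2_def using that by (rule sem_frame)
    have eq2: "\<tau>2 ''n'' = \<tau>1 ''n''" "\<tau>2 ''r'' = \<tau>1 ''r''" "\<tau>2 ''a'' = \<tau>1 ''a''" "\<tau>2 ''b'' = \<tau>1 ''b''"
      "\<tau>2 ''c'' = \<tau>1 ''c''" "\<tau>2 ''S'' = \<tau>1 ''S''" "\<tau>2 ''T'' = \<tau>1 ''T''" "\<tau>2 ''pc'' = \<tau>1 ''pc''"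
      "\<tau>2 ''co'' = \<tau>1 ''co''" "\<tau>2 ''x'' = \<tau>1 ''x''" "\<tau>2 ''k'' = \<tau>1 ''k''" "\<tau>2 ''g'' = \<tau>1 ''g''"
      "\<tau>2 ''w'' = \<tau>1 ''w''"
      by (rule fr2; simp add: shift_duals_def)+
    have "\<tau>1 ''n'' 0 = n" using eq1 n by simp
    note y2 = shift_duals_correct[of \<tau>1 n, OF this n(2), folded \<tau>2_def, unfolded eq1, folded \<delta>_def]
    define \<tau>3 where "\<tau>3 = sem grow \<tau>2"
    have fr3: "\<tau>3 x = \<tau>2 x" if "x \<notin> set (mods grow)" for x
      unfolding \<tau>3_def using that by (rule sem_frame)
    have eq3: "\<tau>3 ''n'' = \<tau>2 ''n''" "\<tau>3 ''r'' = \<tau>2 ''r''" "\<tau>3 ''a'' = \<tau>2 ''a''" "\<tau>3 ''b'' = \<tau>2 ''b''"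
      "\<tau>3 ''c'' = \<tau>2 ''c''" "\<tau>3 ''y'' = \<tau>2 ''y''" "\<tau>3 ''z'' = \<tau>2 ''z''"
      by (rule fr3; simp add: grow_def)+
    have "\<tau>2 ''n'' 0 = n" "\<tau>2 ''w'' 0 = w" "\<tau>2 ''k'' 0 = k"
      using eq1 eq2 n k by (simp_all add: w_def)
    note t3 = grow_correct[of \<tau>2 n w k, OF this(1) n(2) this(2,3), folded \<tau>3_def, unfolded eq2 eq1, folded g_def]
    have "forest_ok n (\<sigma> ''r'') (\<sigma> ''a'') (\<sigma> ''b'') (\<sigma> ''c'') (\<tau>2 ''y'') (\<tau>2 ''z'') (\<tau>3 ''S'')
        ((\<sigma> ''T'')(w := k + 2)) ((\<sigma> ''pc'')(w := g)) ((\<sigma> ''co'')(k + 2 := w)) (\<tau>3 ''x'' 0) (k + 1)"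
      by (rule forest_ok_grow[OF f' k(2) g least y2 t3(5)]) (use t3(4) x1 in simp)
    then have "forest_state (k + 1) \<tau>3"
      unfolding eq3 eq2 t3(1-3) eq1 n .
    moreover have "sem (find_min ;; HIf (Less (V ''g'') (N 0)) HSkip (shift_duals ;; grow)) \<sigma> = \<tau>3"
      using False unfolding \<tau>3_def \<tau>2_def \<tau>1_def by simp
    ultimately show ?thesis by simp
  qed
qed

lemma search_correct:
  assumes f: "forest_state 0 \<sigma>" and n: "\<sigma> ''n'' 0 = n" "0 \<le> n"
  shows "forest_state n (sem search \<sigma>)"
  unfolding search_def
proof (rule sem_HFor_rule[where I = "\<lambda>k \<tau>. forest_state k \<tau>"], goal_cases)
  case 1
  then show ?case by (simp add: find_min_def shift_duals_def grow_def)
next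
  case 4
  then show ?case using f by simp
next
  case (5 j \<tau>)
  have nj: "\<tau> ''n'' 0 = n" using 5(3)[of "''n''"] n by (simp add: find_min_def shift_duals_def grow_def)
  show ?case
  proof (cases "\<tau> ''x'' 0 < 0")
    case True
    then show ?thesis using search_round_correct[OF 5(5,4,1) _ True] nj 5(2) by simp
  next
    case False
    then show ?thesis using forest_ok_skip[OF 5(5)] by simp
  qed
qed (use n in simp_all)

abbreviation opt_state :: "(int \<Rightarrow> int) \<Rightarrow> (int \<Rightarrow> int) \<Rightarrow> state \<Rightarrow> bool" where
  "opt_state p q \<sigma> \<equiv> partial_opt (\<sigma> ''n'' 0) (\<sigma> ''c'') p q (\<sigma> ''y'') (\<sigma> ''z'') (\<sigma> ''r'') (\<sigma> ''a'') (\<sigma> ''b'')"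

lemma augment_correct:
  assumes f: "forest_state n \<sigma>" and n: "\<sigma> ''n'' 0 = n" "0 \<le> n"
    and po: "partial_opt n (\<sigma> ''c'') p q y0 z0 (\<sigma> ''r'') (\<sigma> ''a'') (\<sigma> ''b'')"
  defines "\<sigma>' \<equiv> sem augment \<sigma>"
  shows "opt_state p q \<sigma>'"
    "sum (\<sigma>' ''a'') {0..<n} = sum (\<sigma> ''a'') {0..<n} - 1 \<and> sum (\<sigma>' ''b'') {0..<n} = sum (\<sigma> ''b'') {0..<n} - 1 \<or>
      sum (\<sigma>' ''a'') {0..<n} = 0 \<or> sum (\<sigma>' ''b'') {0..<n} = 0"
proof -
  define x where "x = \<sigma> ''x'' 0"
  have "opt_state p q \<sigma>' \<and> (sum (\<sigma>' ''a'') {0..<n} = sum (\<sigma> ''a'') {0..<n} - 1 \<and> sum (\<sigma>' ''b'') {0..<n} = sum (\<sigma> ''b'') {0..<n} - 1 \<or>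
      sum (\<sigma>' ''a'') {0..<n} = 0 \<or> sum (\<sigma>' ''b'') {0..<n} = 0)"
  proof (cases "x < 0")
    case True
    then have "x = -1" using forest_ok_endD(1)[OF f] by (fastforce simp: x_def)
    then have "\<sigma> ''x'' 0 = -1" by (simp add: x_def)
    note un = partial_opt_unaugmented[OF po f[unfolded this n] n(2)]
    have "\<sigma>' = \<sigma>" using True by (simp add: \<sigma>'_def augment_def x_def)
    then show ?thesis using un n by simp
  next
    case False
    then have x: "x \<noteq> -1" by simp
    note f' = f[unfolded n, folded x_def]
    let ?B = "(HIf (Less (N 1) (Idx ''S'' (V ''g'')))
       (HAssign ''w'' (N 0) (Idx ''co'' (Idx ''S'' (V ''g''))) ;;
        HAssign ''r'' (Add (Mul (V ''g'') (V ''n'')) (V ''w'')) (Sub (cell ''r'' (V ''g'') (V ''w'')) (N 1)) ;;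
        HAssign ''g'' (N 0) (Idx ''pc'' (V ''w'')) ;;
        HAssign ''r'' (Add (Mul (V ''g'') (V ''n'')) (V ''w'')) (Add (cell ''r'' (V ''g'') (V ''w'')) (N 1)))
       HSkip)"
    define r0 where "r0 = \<sigma> ''r''"
    define g0 where "g0 = \<sigma> ''pc'' x"
    define r1 where "r1 = r0(g0 * n + x := r0 (g0 * n + x) + 1)"
    define \<sigma>1 where "\<sigma>1 = upd ''r'' (g0 * n + x) (r0 (g0 * n + x) + 1)
      (upd ''g'' 0 g0 (upd ''b'' x (\<sigma> ''b'' x - 1) \<sigma>))"
    define \<sigma>2 where "\<sigma>2 = sem (HFor ''k'' ?B) \<sigma>1"
    let ?P = "path_ok n (\<sigma> ''c'') (\<sigma> ''y'') (\<sigma> ''z'') (\<sigma> ''S'') x r0"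
    note init = path_ok_init[OF f' x, folded r0_def g0_def, folded r1_def]
    have r1: "\<sigma>1 ''r'' = r1" by (rule ext) (simp add: \<sigma>1_def r1_def r0_def)
    have g1: "\<sigma>1 ''g'' 0 = g0" by (simp add: \<sigma>1_def)
    have eq1: "\<sigma>1 ''n'' = \<sigma> ''n''" "\<sigma>1 ''S'' = \<sigma> ''S''" "\<sigma>1 ''co'' = \<sigma> ''co''" "\<sigma>1 ''pc'' = \<sigma> ''pc''"
      "\<sigma>1 ''c'' = \<sigma> ''c''" "\<sigma>1 ''y'' = \<sigma> ''y''" "\<sigma>1 ''z'' = \<sigma> ''z''" "\<sigma>1 ''a'' = \<sigma> ''a''"
      by (simp_all add: \<sigma>1_def)
    have b1: "\<sigma>1 ''b'' = (\<sigma> ''b'')(x := \<sigma> ''b'' x - 1)"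
      by (rule ext) (simp add: \<sigma>1_def)
    \<comment> \<open>The label of the current row is at most \<open>n\<close> at first and falls
      with each step, so \<open>n\<close> iterations reach a root. \<open>max 1\<close> covers the
      idle iterations there.\<close>
    let ?I = "\<lambda>j \<tau>. ?P (\<tau> ''r'') (\<tau> ''g'' 0) \<and> \<sigma> ''S'' (\<tau> ''g'' 0) \<le> max 1 (n - j)"
    have "?I n \<sigma>2"
      unfolding \<sigma>2_def
    proof (rule sem_HFor_rule[where I = ?I], goal_cases)
      case 4
      then show ?case using init r1 g1 by simp
    next
      case (5 j \<tau>)
      have eq: "\<tau> ''n'' 0 = n" "\<tau> ''S'' = \<sigma> ''S''" "\<tau> ''co'' = \<sigma> ''co''" "\<tau> ''pc'' = \<sigma> ''pc''"
        using 5(3) n eq1 by simp_all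
      define g where "g = \<tau> ''g'' 0"
      show ?case
      proof (cases "1 < \<sigma> ''S'' g")
        case True
        define w where "w = \<sigma> ''co'' (\<sigma> ''S'' g)"
        define g' where "g' = \<sigma> ''pc'' w"
        define s1 where "s1 = (\<tau> ''r'')(g * n + w := \<tau> ''r'' (g * n + w) - 1)"
        define s2 where "s2 = s1(g' * n + w := s1 (g' * n + w) + 1)"
        have p: "?P (\<tau> ''r'') g" using 5(5) by (simp add: g_def)
        note st = path_ok_step[OF p f'[folded r0_def] True w_def g'_def s1_def s2_def]
        have "sem ?B \<tau> ''g'' 0 = g'" using True by (simp add: eq g_def w_def g'_def)
        moreover have "sem ?B \<tau> ''r'' = s2"
          by (rule ext) (use True in \<open>simp add: eq flip: g_def\<close>, simp add: s2_def s1_def w_def g'_def)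
        moreover have "\<sigma> ''S'' g \<le> n - j" using 5(5) True by (auto simp: g_def max_def split: if_splits)
        ultimately show ?thesis using st by simp
      next
        case False
        then have "sem ?B \<tau> = \<tau>" by (simp add: eq g_def)
        then show ?thesis using 5(5) False by (simp add: g_def)
      qed
    qed (use n eq1 in simp_all)
    then have p2: "?P (\<sigma>2 ''r'') (\<sigma>2 ''g'' 0)" "\<sigma> ''S'' (\<sigma>2 ''g'' 0) \<le> 1" by simp_all
    have fr2: "\<sigma>2 v = \<sigma>1 v" if "v \<notin> set (mods (HFor ''k'' ?B))" for v
      unfolding \<sigma>2_def using that by (rule sem_frame)
    have eq2: "\<sigma>2 ''n'' = \<sigma> ''n''" "\<sigma>2 ''c'' = \<sigma> ''c''" "\<sigma>2 ''y'' = \<sigma> ''y''" "\<sigma>2 ''z'' = \<sigma> ''z''"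
      "\<sigma>2 ''a'' = \<sigma> ''a''" "\<sigma>2 ''b'' = (\<sigma> ''b'')(x := \<sigma> ''b'' x - 1)"
      using eq1 b1 fr2 by simp_all
    define g where "g = \<sigma>2 ''g'' 0"
    have \<sigma>': "\<sigma>' = upd ''a'' g (\<sigma> ''a'' g - 1) \<sigma>2"
      unfolding \<sigma>'_def augment_def using False n
      by (simp del: sem.simps(5) add: eq2 g_def flip: x_def g0_def r0_def \<sigma>1_def \<sigma>2_def)
    have a': "\<sigma>' ''a'' = (\<sigma> ''a'')(g := \<sigma> ''a'' g - 1)"
      by (rule ext) (simp add: \<sigma>' eq2)
    have eq': "\<sigma>' ''n'' = \<sigma> ''n''" "\<sigma>' ''c'' = \<sigma> ''c''" "\<sigma>' ''y'' = \<sigma> ''y''" "\<sigma>' ''z'' = \<sigma> ''z''"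
      "\<sigma>' ''b'' = (\<sigma> ''b'')(x := \<sigma> ''b'' x - 1)" "\<sigma>' ''r'' = \<sigma>2 ''r''"
      unfolding \<sigma>' by (subst upd_other; simp add: eq2 del: upd_other fun_upd_apply)+
    note au = partial_opt_augmented[OF po f' x, folded r0_def, OF p2, folded g_def]
    show ?thesis unfolding eq' a' n using au by blast
  qed
  then show "opt_state p q \<sigma>'"
    "sum (\<sigma>' ''a'') {0..<n} = sum (\<sigma> ''a'') {0..<n} - 1 \<and> sum (\<sigma>' ''b'') {0..<n} = sum (\<sigma> ''b'') {0..<n} - 1 \<or>
      sum (\<sigma>' ''a'') {0..<n} = 0 \<or> sum (\<sigma>' ''b'') {0..<n} = 0"
    by blast+
qed

lemma attempt_correct:
  assumes n: "\<sigma> ''n'' 0 = n" "0 \<le> n" and po: "opt_state p q \<sigma>"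
  defines "\<sigma>' \<equiv> sem (init_search ;; search ;; augment) \<sigma>"
  shows "opt_state p q \<sigma>'"
    "sum (\<sigma>' ''a'') {0..<n} = sum (\<sigma> ''a'') {0..<n} - 1 \<and> sum (\<sigma>' ''b'') {0..<n} = sum (\<sigma> ''b'') {0..<n} - 1 \<or>
      sum (\<sigma>' ''a'') {0..<n} = 0 \<or> sum (\<sigma>' ''b'') {0..<n} = 0"
proof -
  define \<tau>1 where "\<tau>1 = sem init_search \<sigma>"
  define \<tau>2 where "\<tau>2 = sem search \<tau>1"
  have fr1: "\<tau>1 x = \<sigma> x" if "x \<notin> set (mods init_search)" for x
    unfolding \<tau>1_def using that by (rule sem_frame)
  have fr2: "\<tau>2 x = \<tau>1 x" if "x \<notin> set (mods search)" for x
    unfolding \<tau>2_def using that by (rule sem_frame)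
  have eq1: "\<tau>1 ''n'' = \<sigma> ''n''" "\<tau>1 ''r'' = \<sigma> ''r''" "\<tau>1 ''a'' = \<sigma> ''a''" "\<tau>1 ''b'' = \<sigma> ''b''"
    "\<tau>1 ''c'' = \<sigma> ''c''" "\<tau>1 ''y'' = \<sigma> ''y''" "\<tau>1 ''z'' = \<sigma> ''z''"
    by (rule fr1; simp add: init_search_def)+
  have eq2: "\<tau>2 ''n'' = \<sigma> ''n''" "\<tau>2 ''r'' = \<sigma> ''r''" "\<tau>2 ''a'' = \<sigma> ''a''" "\<tau>2 ''b'' = \<sigma> ''b''"
    "\<tau>2 ''c'' = \<sigma> ''c''"
    unfolding eq1[symmetric] by (rule fr2; simp add: search_def find_min_def shift_duals_def grow_def)+
  note i = init_search_correct[of \<sigma> n, OF n, folded \<tau>1_def]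
  have "forest_state 0 \<tau>1"
    unfolding i(1) eq1 n
    by (rule forest_ok_init[OF _ i(2,3)]) (use po n in \<open>simp add: partial_opt_def\<close>)
  then have f2: "forest_state n \<tau>2"
    unfolding \<tau>2_def using n eq1 by (intro search_correct) simp_all
  have "partial_opt n (\<tau>2 ''c'') p q (\<sigma> ''y'') (\<sigma> ''z'') (\<tau>2 ''r'') (\<tau>2 ''a'') (\<tau>2 ''b'')"
    unfolding eq2 using po n by simp
  note au = augment_correct[of \<tau>2 n, OF f2 _ n(2) this]
  have "\<sigma>' = sem augment \<tau>2" unfolding \<sigma>'_def \<tau>2_def \<tau>1_def by simp
  then show "opt_state p q \<sigma>'"
    "sum (\<sigma>' ''a'') {0..<n} = sum (\<sigma> ''a'') {0..<n} - 1 \<and> sum (\<sigma>' ''b'') {0..<n} = sum (\<sigma> ''b'') {0..<n} - 1 \<or>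
      sum (\<sigma>' ''a'') {0..<n} = 0 \<or> sum (\<sigma>' ''b'') {0..<n} = 0"
    using au n eq2 by simp_all
qed

lemma double_correct:
  assumes n: "\<sigma> ''n'' 0 = n" "0 \<le> n" and p: "\<sigma> ''p'' 0 = 2 * h"
  defines "\<sigma>' \<equiv> sem double \<sigma>"
  shows "\<sigma>' ''p'' 0 = h"
    "\<forall>u\<in>{0..<n}. \<sigma>' ''a'' u = \<sigma> ''a'' u + \<sigma> ''a'' u + \<sigma> ''out'' u div h -
      (\<sigma> ''out'' u div (2 * h) + \<sigma> ''out'' u div (2 * h))"
    "\<forall>v\<in>{0..<n}. \<sigma>' ''b'' v = \<sigma> ''b'' v + \<sigma> ''b'' v + \<sigma> ''in'' v div h -
      (\<sigma> ''in'' v div (2 * h) + \<sigma> ''in'' v div (2 * h))"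
    "\<forall>u\<in>{0..<n}. \<forall>v\<in>{0..<n}. \<sigma>' ''r'' (u * n + v) = \<sigma> ''r'' (u * n + v) + \<sigma> ''r'' (u * n + v)"
proof -
  let ?V = "HFor ''v'' (HAssign ''r'' (Add (Mul (V ''u'') (V ''n'')) (V ''v''))
         (Add (cell ''r'' (V ''u'') (V ''v'')) (cell ''r'' (V ''u'') (V ''v''))))"
  let ?A = "HAssign ''a'' (V ''u'') (Sub (Add (Add (Idx ''a'' (V ''u'')) (Idx ''a'' (V ''u'')))
          (Div (Idx ''out'' (V ''u'')) (V ''q'')))
        (Add (Div (Idx ''out'' (V ''u'')) (V ''p'')) (Div (Idx ''out'' (V ''u'')) (V ''p''))))"
  let ?B = "HAssign ''b'' (V ''u'') (Sub (Add (Add (Idx ''b'' (V ''u'')) (Idx ''b'' (V ''u'')))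
          (Div (Idx ''in'' (V ''u'')) (V ''q'')))
        (Add (Div (Idx ''in'' (V ''u'')) (V ''p'')) (Div (Idx ''in'' (V ''u'')) (V ''p''))))"
  let ?F = "HFor ''u'' (?A ;; ?B ;; ?V)"
  define \<sigma>1 where "\<sigma>1 = upd ''q'' 0 h \<sigma>"
  let ?a = "\<lambda>u. \<sigma> ''a'' u + \<sigma> ''a'' u + \<sigma> ''out'' u div h - (\<sigma> ''out'' u div (2 * h) + \<sigma> ''out'' u div (2 * h))"
  let ?b = "\<lambda>u. \<sigma> ''b'' u + \<sigma> ''b'' u + \<sigma> ''in'' u div h - (\<sigma> ''in'' u div (2 * h) + \<sigma> ''in'' u div (2 * h))"
  \<comment> \<open>\<open>P\<close> marks the cells already doubled. Columns are restricted to
    \<open>{0..<n}\<close>, where a row-major index determines its cell.\<close>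
  let ?R = "\<lambda>r P. \<forall>u. \<forall>v\<in>{0..<n}. r (u * n + v) =
      (if P u v then \<sigma> ''r'' (u * n + v) + \<sigma> ''r'' (u * n + v) else \<sigma> ''r'' (u * n + v))"
  let ?I = "\<lambda>j \<tau>. (\<forall>u. \<tau> ''a'' u = (if u \<in> {0..<j} then ?a u else \<sigma> ''a'' u)) \<and>
    (\<forall>u. \<tau> ''b'' u = (if u \<in> {0..<j} then ?b u else \<sigma> ''b'' u)) \<and> ?R (\<tau> ''r'') (\<lambda>u v. u \<in> {0..<j})"
  have I: "?I n (sem ?F \<sigma>1)"
  proof (rule sem_HFor_rule[where I = ?I], goal_cases)
    case (5 j \<tau>)
    have eq: "\<tau> ''n'' 0 = n" "\<tau> ''out'' = \<sigma> ''out''" "\<tau> ''in'' = \<sigma> ''in''" "\<tau> ''q'' 0 = h" "\<tau> ''p'' 0 = 2 * h"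
      using 5(3) n p by (simp_all add: \<sigma>1_def)
    define \<tau>1 where "\<tau>1 = sem (?A ;; ?B) \<tau>"
    have t1: "\<tau>1 ''n'' 0 = n" "\<tau>1 ''u'' 0 = j" "\<tau>1 ''r'' = \<tau> ''r''"
      using 5(4) eq(1) by (simp_all add: \<tau>1_def)
    have a1: "\<tau>1 ''a'' u = (if u = j then ?a u else \<tau> ''a'' u)" "\<tau>1 ''b'' u = (if u = j then ?b u else \<tau> ''b'' u)" for u
      using 5(4,5) by (simp_all add: \<tau>1_def eq)
    define \<tau>2 where "\<tau>2 = sem ?V \<tau>1"
    have "?R (\<tau>2 ''r'') (\<lambda>u v. u \<in> {0..<j} \<or> u = j \<and> v \<in> {0..<n})"
      unfolding \<tau>2_def
    proof (rule sem_HFor_rule[where I = "\<lambda>i \<tau>. ?R (\<tau> ''r'') (\<lambda>u v. u \<in> {0..<j} \<or> u = j \<and> v \<in> {0..<i})"],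
        goal_cases)
      case 4
      then show ?case using 5(5) t1 by simp
    next
      case (5 i \<tau>')
      have eq': "\<tau>' ''n'' 0 = n" "\<tau>' ''u'' 0 = j" using 5(3) t1 by simp_all
      have i: "i \<in> {0..<n}" using 5 by simp
      have r': "upd ''v'' 0 (i + 1) (sem (HAssign ''r'' (Add (Mul (V ''u'') (V ''n'')) (V ''v''))
         (Add (cell ''r'' (V ''u'') (V ''v'')) (cell ''r'' (V ''u'') (V ''v'')))) \<tau>') ''r'' (u * n + v) =
         (if u = j \<and> v = i then \<tau>' ''r'' (j * n + i) + \<tau>' ''r'' (j * n + i) else \<tau>' ''r'' (u * n + v))"
        if "v \<in> {0..<n}" for u v
        using index_inj[of v n i u j] that i by (simp add: eq' 5(4))
      show ?case
      proof (intro allI ballI)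
        fix u v assume v: "v \<in> {0..<n}"
        show "upd ''v'' 0 (i + 1) (sem (HAssign ''r'' (Add (Mul (V ''u'') (V ''n'')) (V ''v''))
          (Add (cell ''r'' (V ''u'') (V ''v'')) (cell ''r'' (V ''u'') (V ''v'')))) \<tau>') ''r'' (u * n + v) =
          (if u \<in> {0..<j} \<or> u = j \<and> v \<in> {0..<i + 1} then \<sigma> ''r'' (u * n + v) + \<sigma> ''r'' (u * n + v)
           else \<sigma> ''r'' (u * n + v))"
          unfolding r'[OF v] using 5(1,5) v i by auto
      qed
    qed (use n t1 in simp_all)
    moreover have "\<tau>2 x = \<tau>1 x" if "x \<noteq> ''v''" "x \<noteq> ''r''" for x
      unfolding \<tau>2_def using that by (intro sem_frame) simp
    moreover have "sem (?A ;; ?B ;; ?V) \<tau> = \<tau>2" by (simp only: \<tau>2_def \<tau>1_def sem.simps)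
    ultimately show ?case using 5(1,5) a1 by auto
  qed (use n in \<open>simp_all add: \<sigma>1_def\<close>)
  have "sem ?F \<sigma>1 ''q'' = \<sigma>1 ''q''" by (intro sem_frame) simp
  then have q: "sem ?F \<sigma>1 ''q'' 0 = h" by (simp add: \<sigma>1_def)
  have "sem (HAssign ''q'' (N 0) (Div (V ''p'') (N 2))) \<sigma> = \<sigma>1" using p by (simp add: \<sigma>1_def)
  then have \<sigma>': "\<sigma>' = upd ''p'' 0 h (sem ?F \<sigma>1)"
    unfolding \<sigma>'_def double_def using q by (simp only: sem.simps(2,3) aval.simps)
  have eq: "\<sigma>' ''a'' = sem ?F \<sigma>1 ''a''" "\<sigma>' ''b'' = sem ?F \<sigma>1 ''b''" "\<sigma>' ''r'' = sem ?F \<sigma>1 ''r''"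
    unfolding \<sigma>' by (rule upd_other; simp)+
  show "\<sigma>' ''p'' 0 = h" unfolding \<sigma>' by simp
  show "\<forall>u\<in>{0..<n}. \<sigma>' ''a'' u = ?a u" "\<forall>v\<in>{0..<n}. \<sigma>' ''b'' v = ?b v"
    "\<forall>u\<in>{0..<n}. \<forall>v\<in>{0..<n}. \<sigma>' ''r'' (u * n + v) = \<sigma> ''r'' (u * n + v) + \<sigma> ''r'' (u * n + v)"
    unfolding eq using I by auto
qed

text \<open>The state between two phases, at scale \<open>h\<close>. At \<open>h = 1\<close> the
  quotients are the degrees themselves.\<close>

definition phase_ok :: "int \<Rightarrow> int \<Rightarrow> state \<Rightarrow> bool" where
  "phase_ok n h \<sigma> \<longleftrightarrow> \<sigma> ''n'' 0 = n \<and> \<sigma> ''p'' 0 = h \<and>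
    opt_state (\<lambda>u. \<sigma> ''out'' u div h) (\<lambda>v. \<sigma> ''in'' v div h) \<sigma> \<and>
    (sum (\<sigma> ''a'') {0..<n} = 0 \<or> sum (\<sigma> ''b'') {0..<n} = 0)"

lemma phase_correct:
  assumes ok: "phase_ok n (2 * h) \<sigma>" and h: "0 < h" and n: "0 \<le> n"
  shows "phase_ok n h (sem phase \<sigma>)"
proof -
  have s: "\<sigma> ''n'' 0 = n" "\<sigma> ''p'' 0 = 2 * h" using ok by (simp_all add: phase_ok_def)
  define \<sigma>1 where "\<sigma>1 = sem double \<sigma>"
  note d = double_correct[of \<sigma> n, OF s(1) n s(2), folded \<sigma>1_def]
  have fr1: "\<sigma>1 x = \<sigma> x" if "x \<notin> set (mods double)" for x
    unfolding \<sigma>1_def using that by (rule sem_frame)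
  have eq1: "\<sigma>1 ''n'' = \<sigma> ''n''" "\<sigma>1 ''c'' = \<sigma> ''c''" "\<sigma>1 ''y'' = \<sigma> ''y''" "\<sigma>1 ''z'' = \<sigma> ''z''"
    "\<sigma>1 ''out'' = \<sigma> ''out''" "\<sigma>1 ''in'' = \<sigma> ''in''"
    by (rule fr1; simp add: double_def)+
  have po: "partial_opt n (\<sigma> ''c'') (\<lambda>u. \<sigma> ''out'' u div (2 * h)) (\<lambda>v. \<sigma> ''in'' v div (2 * h))
      (\<sigma> ''y'') (\<sigma> ''z'') (\<sigma> ''r'') (\<sigma> ''a'') (\<sigma> ''b'')"
    and fin: "sum (\<sigma> ''a'') {0..<n} = 0 \<or> sum (\<sigma> ''b'') {0..<n} = 0"
    using ok s by (simp_all add: phase_ok_def)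
  have 1: "opt_state (\<lambda>u. \<sigma> ''out'' u div h) (\<lambda>v. \<sigma> ''in'' v div h) \<sigma>1"
      "sum (\<sigma>1 ''a'') {0..<n} \<le> n \<or> sum (\<sigma>1 ''b'') {0..<n} \<le> n"
    using partial_opt_double[OF po h _ _ d(4,2,3) fin n] unfolding eq1 s by simp_all
  let ?B = "init_search ;; search ;; augment"
  \<comment> \<open>An attempt either lowers both sums by one or leaves one of them at 0. Either way
    a bound \<open>n - j - 1\<close> holds afterwards, though not always on the same side.\<close>
  let ?I = "\<lambda>j \<tau>. opt_state (\<lambda>u. \<sigma> ''out'' u div h) (\<lambda>v. \<sigma> ''in'' v div h) \<tau> \<and>
    (sum (\<tau> ''a'') {0..<n} \<le> n - j \<or> sum (\<tau> ''b'') {0..<n} \<le> n - j)"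
  define \<sigma>2 where "\<sigma>2 = sem (HFor ''h'' ?B) \<sigma>1"
  have "?I n \<sigma>2"
    unfolding \<sigma>2_def
  proof (rule sem_HFor_rule[where I = ?I], goal_cases)
    case 1
    then show ?case
      by (simp add: init_search_def search_def augment_def find_min_def shift_duals_def grow_def)
  next
    case 4
    then show ?case using 1 by simp
  next
    case (5 j \<tau>)
    have "\<tau> ''n'' 0 = n"
      using 5(3)[of "''n''"] eq1 s
      by (simp add: init_search_def search_def augment_def find_min_def shift_duals_def grow_def)
    note at = attempt_correct[of \<tau> n, OF this n conjunct1[OF 5(5)]]
    show ?case using at 5(1,2,5) by (simp del: sem.simps; linarith)
  qed (use n eq1 s in simp_all)
  then have 2: "opt_state (\<lambda>u. \<sigma> ''out'' u div h) (\<lambda>v. \<sigma> ''in'' v div h) \<sigma>2"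
      "sum (\<sigma>2 ''a'') {0..<n} \<le> 0 \<or> sum (\<sigma>2 ''b'') {0..<n} \<le> 0"
    by simp_all
  have fr2: "\<sigma>2 x = \<sigma>1 x" if "x \<notin> set (mods (HFor ''h'' ?B))" for x
    unfolding \<sigma>2_def using that by (rule sem_frame)
  have eq2: "\<sigma>2 ''n'' = \<sigma>1 ''n''" "\<sigma>2 ''p'' = \<sigma>1 ''p''" "\<sigma>2 ''out'' = \<sigma>1 ''out''" "\<sigma>2 ''in'' = \<sigma>1 ''in''"
    by (rule fr2; simp add: init_search_def search_def augment_def find_min_def shift_duals_def grow_def)+
  have "0 \<le> sum (\<sigma>2 ''a'') {0..<n}" "0 \<le> sum (\<sigma>2 ''b'') {0..<n}"
    using 2(1) eq1 eq2 s by (auto simp: partial_opt_def intro!: sum_nonneg)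
  then have "phase_ok n h \<sigma>2"
    unfolding phase_ok_def using 2 eq1 eq2 s d(1) by auto
  then show ?thesis unfolding phase_def \<sigma>2_def \<sigma>1_def by (simp only: sem.simps)
qed

text \<open>\<open>m\<close> becomes \<open>big_cost\<close> and \<open>c\<close> the matrix
  \<open>int_cost\<close>. The total \<open>t\<close> serves as a common upper bound on all
  degrees.\<close>

definition prepare :: hcom where
  "prepare =
    HAssign ''m'' (N 0) (N 1) ;;
    HFor ''u'' (HFor ''v'' (HIf (Less (cell ''d'' (V ''u'') (V ''v'')) (N 0)) HSkip
      (HAssign ''m'' (N 0) (Add (V ''m'') (cell ''d'' (V ''u'') (V ''v'')))))) ;;
    HFor ''u'' (HFor ''v'' (HIf (Less (cell ''d'' (V ''u'') (V ''v'')) (N 0))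
      (HAssign ''c'' (Add (Mul (V ''u'') (V ''n'')) (V ''v'')) (V ''m''))
      (HAssign ''c'' (Add (Mul (V ''u'') (V ''n'')) (V ''v'')) (cell ''d'' (V ''u'') (V ''v''))))) ;;
    HFor ''u'' (HAssign ''t'' (N 0) (Add (V ''t'') (Add (Idx ''in'' (V ''u'')) (Idx ''out'' (V ''u''))))) ;;
    HAssign ''p'' (N 0) (N 1)"

text \<open>A remaining supply or demand shows that the degrees are unbalanced. Then one indegree is
  increased, which makes the output instance unsolvable.\<close>

definition write_output :: hcom where
  "write_output =
    HFor ''u'' (HFor ''v''
      (HIf (Less (Add (V ''s'') (V ''s'')) (cell ''r'' (V ''u'') (V ''v'')))
        (HAssign ''f'' (Add (Mul (V ''u'') (V ''n'')) (V ''v''))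
          (Sub (cell ''r'' (V ''u'') (V ''v'')) (Add (V ''s'') (V ''s''))))
        (HAssign ''f'' (Add (Mul (V ''u'') (V ''n'')) (V ''v'')) (N 0)) ;;
       HAssign ''in_new'' (V ''v'') (Add (Idx ''in_new'' (V ''v''))
         (Sub (cell ''r'' (V ''u'') (V ''v'')) (cell ''f'' (V ''u'') (V ''v'')))) ;;
       HAssign ''out_new'' (V ''u'') (Add (Idx ''out_new'' (V ''u''))
         (Sub (cell ''r'' (V ''u'') (V ''v'')) (cell ''f'' (V ''u'') (V ''v'')))))) ;;
    HFor ''u'' (HIf (Less (N 0) (Add (Idx ''a'' (V ''u'')) (Idx ''b'' (V ''u''))))
      (HAssign ''l'' (N 0) (N 1)) HSkip) ;;
    HAssign ''in_new'' (N 0) (Add (V ''in_new'') (V ''l''))"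

text \<open>Finds the first power of two above \<open>t\<close>. All quotients of degrees are then
  0, so the zero matrix with zero prices, which are feasible for nonnegative costs, starts the
  phases. The number of iterations depends on the lengths of the degrees, so this loop and
  \<open>phase_loop\<close> lie outside \<open>hcom\<close>.\<close>

definition scale_loop :: com where
  "scale_loop = While (Not (Less (V ''t'') (V ''p''))) (Assign ''p'' (N 0) (Add (V ''p'') (V ''p'')))"

definition phase_loop :: com where
  "phase_loop = While (Less (N 1) (V ''p'')) (comp phase)"

definition kernel_program :: com where
  "kernel_program = Seq (comp prepare) (Seq scale_loop (Seq phase_loop (comp write_output)))"

lemma sum_int_eq: "(\<Sum>x\<in>{0..<int n}. g x) = (\<Sum>k<n. g (int k))"
  by (rule sum.reindex_bij_witness[of _ int nat]) auto

lemma atLeastLessThan_int_Suc: "0 \<le> i \<Longrightarrow> {0..<i + 1} = insert i {0..<i :: int}"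
  by auto

lemma sum_int_Suc: "0 \<le> i \<Longrightarrow> (\<Sum>x\<in>{0..<i + 1}. g x) = (\<Sum>x\<in>{0..<i :: int}. g x) + (g i :: int)"
  by (simp add: atLeastLessThan_int_Suc)

lemma prepare_correct:
  assumes n: "\<sigma> ''n'' 0 = n" "0 \<le> n" and t: "\<sigma> ''t'' 0 = 0"
  defines "\<sigma>' \<equiv> sem prepare \<sigma>"
  shows "\<forall>u\<in>{0..<n}. \<forall>v\<in>{0..<n}. \<sigma>' ''c'' (u * n + v) = (if \<sigma> ''d'' (u * n + v) < 0
      then 1 + (\<Sum>u\<in>{0..<n}. \<Sum>v\<in>{0..<n}. max 0 (\<sigma> ''d'' (u * n + v))) else \<sigma> ''d'' (u * n + v))"
    "\<sigma>' ''t'' 0 = (\<Sum>u\<in>{0..<n}. \<sigma> ''in'' u + \<sigma> ''out'' u)" "\<sigma>' ''p'' 0 = 1"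
proof -
  let ?D = "\<lambda>u v. max 0 (\<sigma> ''d'' (u * n + v))"
  let ?M = "1 + (\<Sum>u\<in>{0..<n}. \<Sum>v\<in>{0..<n}. ?D u v)"
  let ?B1 = "HIf (Less (cell ''d'' (V ''u'') (V ''v'')) (N 0)) HSkip
      (HAssign ''m'' (N 0) (Add (V ''m'') (cell ''d'' (V ''u'') (V ''v''))))"
  let ?F1 = "HFor ''u'' (HFor ''v'' ?B1)"
  let ?B2 = "HIf (Less (cell ''d'' (V ''u'') (V ''v'')) (N 0))
      (HAssign ''c'' (Add (Mul (V ''u'') (V ''n'')) (V ''v'')) (V ''m''))
      (HAssign ''c'' (Add (Mul (V ''u'') (V ''n'')) (V ''v'')) (cell ''d'' (V ''u'') (V ''v'')))"
  let ?F2 = "HFor ''u'' (HFor ''v'' ?B2)"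
  let ?F3 = "HFor ''u'' (HAssign ''t'' (N 0) (Add (V ''t'') (Add (Idx ''in'' (V ''u'')) (Idx ''out'' (V ''u'')))))"
  define \<sigma>1 where "\<sigma>1 = upd ''m'' 0 1 \<sigma>"
  define \<sigma>2 where "\<sigma>2 = sem ?F1 \<sigma>1"
  define \<sigma>3 where "\<sigma>3 = sem ?F2 \<sigma>2"
  define \<sigma>4 where "\<sigma>4 = sem ?F3 \<sigma>3"
  have \<sigma>': "\<sigma>' = upd ''p'' 0 1 \<sigma>4"
    unfolding \<sigma>'_def prepare_def \<sigma>4_def \<sigma>3_def \<sigma>2_def \<sigma>1_def by (simp only: sem.simps(2,3) aval.simps)
  have fr2: "\<sigma>2 x = \<sigma> x" if "x \<notin> {''u'', ''v'', ''m''}" for x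
    unfolding \<sigma>2_def using that by (subst sem_frame) (simp_all add: \<sigma>1_def)
  have fr3: "\<sigma>3 x = \<sigma>2 x" if "x \<notin> {''u'', ''v'', ''c''}" for x
    unfolding \<sigma>3_def using that by (subst sem_frame) simp_all
  have fr4: "\<sigma>4 x = \<sigma>3 x" if "x \<notin> {''u'', ''t''}" for x
    unfolding \<sigma>4_def using that by (subst sem_frame) simp_all
  have m: "\<sigma>2 ''m'' 0 = ?M"
    unfolding \<sigma>2_def
  proof (rule sem_HFor_rule[where I = "\<lambda>j \<tau>. \<tau> ''m'' 0 = 1 + (\<Sum>u\<in>{0..<j}. \<Sum>v\<in>{0..<n}. ?D u v)"], goal_cases)
    case (5 j \<tau>)
    have eq: "\<tau> ''n'' 0 = n" "\<tau> ''d'' = \<sigma> ''d''" using 5(3) n by (simp_all add: \<sigma>1_def)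
    let ?S = "1 + (\<Sum>u\<in>{0..<j}. \<Sum>v\<in>{0..<n}. ?D u v)"
    have "sem (HFor ''v'' ?B1) \<tau> ''m'' 0 = ?S + (\<Sum>v\<in>{0..<n}. ?D j v)"
    proof (rule sem_HFor_rule[where I = "\<lambda>i \<tau>. \<tau> ''m'' 0 = ?S + (\<Sum>v\<in>{0..<i}. ?D j v)"], goal_cases)
      case (5 i \<tau>')
      have eq': "\<tau>' ''n'' 0 = n" "\<tau>' ''d'' = \<sigma> ''d''" "\<tau>' ''u'' 0 = j"
        using 5(3) eq \<open>\<tau> ''u'' 0 = j\<close> by simp_all
      show ?case using 5(1,4,5) by (simp add: eq' sum_int_Suc)
    qed (use n eq 5 in simp_all)
    then show ?case using 5(1) by (simp add: sum_int_Suc del: sem.simps)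
  qed (use n in \<open>simp_all add: \<sigma>1_def\<close>)
  let ?C = "\<lambda>u v. if \<sigma> ''d'' (u * n + v) < 0 then ?M else \<sigma> ''d'' (u * n + v)"
  have s2: "\<sigma>2 ''n'' 0 = n" "\<sigma>2 ''d'' = \<sigma> ''d''" using fr2 n by simp_all
  have c: "\<forall>u\<in>{0..<n}. \<forall>v\<in>{0..<n}. \<sigma>3 ''c'' (u * n + v) = ?C u v"
    unfolding \<sigma>3_def
  proof (rule sem_HFor_rule[where I = "\<lambda>j \<tau>. \<forall>u\<in>{0..<j}. \<forall>v\<in>{0..<n}. \<tau> ''c'' (u * n + v) = ?C u v"], goal_cases)
    case (5 j \<tau>)
    have eq: "\<tau> ''n'' 0 = n" "\<tau> ''d'' = \<sigma> ''d''" "\<tau> ''m'' 0 = ?M" using 5(3) s2 m by simp_all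
    have "\<forall>u. \<forall>v\<in>{0..<n}. u \<in> {0..<j} \<or> u = j \<and> v \<in> {0..<n} \<longrightarrow> sem (HFor ''v'' ?B2) \<tau> ''c'' (u * n + v) = ?C u v"
    proof (rule sem_HFor_rule[where I = "\<lambda>i \<tau>. \<forall>u. \<forall>v\<in>{0..<n}. u \<in> {0..<j} \<or> u = j \<and> v \<in> {0..<i} \<longrightarrow>
        \<tau> ''c'' (u * n + v) = ?C u v"], goal_cases)
      case 4
      then show ?case using 5(5) by simp
    next
      case (5 i \<tau>')
      have eq': "\<tau>' ''n'' 0 = n" "\<tau>' ''d'' = \<sigma> ''d''" "\<tau>' ''m'' 0 = ?M" "\<tau>' ''u'' 0 = j"
        using 5(3) eq \<open>\<tau> ''u'' 0 = j\<close> by simp_all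
      have i: "i \<in> {0..<n}" using 5 by simp
      have upd: "sem ?B2 \<tau>' ''c'' = (\<tau>' ''c'')(j * n + i := ?C j i)"
        by (rule ext) (simp add: eq' 5(4))
      show ?case
      proof (intro allI ballI impI)
        fix u v assume v: "v \<in> {0..<n}" and uv: "u \<in> {0..<j} \<or> u = j \<and> v \<in> {0..<i + 1}"
        have "sem ?B2 \<tau>' ''c'' (u * n + v) = ?C u v"
          unfolding upd matrix_update_apply[OF i v] using 5(1,5) v uv by auto
        then show "upd ''v'' 0 (i + 1) (sem ?B2 \<tau>') ''c'' (u * n + v) = ?C u v" by (simp del: sem.simps)
      qed
    qed (use n eq in simp_all)
    note row = this
    show ?case
    proof (intro ballI)
      fix u v assume *: "u \<in> {0..<j + 1}" "v \<in> {0..<n}"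
      then have "u \<in> {0..<j} \<or> u = j \<and> v \<in> {0..<n}" by auto
      then have "sem (HFor ''v'' ?B2) \<tau> ''c'' (u * n + v) = ?C u v" using row *(2) by blast
      then show "upd ''u'' 0 (j + 1) (sem (HFor ''v'' ?B2) \<tau>) ''c'' (u * n + v) = ?C u v"
        by (simp del: sem.simps)
    qed
  qed (use n s2 in simp_all)
  have s3: "\<sigma>3 ''n'' 0 = n" "\<sigma>3 ''t'' 0 = 0" "\<sigma>3 ''in'' = \<sigma> ''in''" "\<sigma>3 ''out'' = \<sigma> ''out''"
    using fr2 fr3 n t by simp_all
  have t4: "\<sigma>4 ''t'' 0 = (\<Sum>u\<in>{0..<n}. \<sigma> ''in'' u + \<sigma> ''out'' u)"
    unfolding \<sigma>4_def
  proof (rule sem_HFor_rule[where I = "\<lambda>j \<tau>. \<tau> ''t'' 0 = (\<Sum>u\<in>{0..<j}. \<sigma> ''in'' u + \<sigma> ''out'' u)"], goal_cases)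
    case (5 j \<tau>)
    have eq: "\<tau> ''in'' = \<sigma> ''in''" "\<tau> ''out'' = \<sigma> ''out''" using 5(3) s3 by simp_all
    show ?case using 5(1,4,5) by (simp add: eq sum_int_Suc)
  qed (use n s3 in simp_all)
  show "\<forall>u\<in>{0..<n}. \<forall>v\<in>{0..<n}. \<sigma>' ''c'' (u * n + v) = ?C u v"
    unfolding \<sigma>' using c fr4[of "''c''"] by simp
  show "\<sigma>' ''t'' 0 = (\<Sum>u\<in>{0..<n}. \<sigma> ''in'' u + \<sigma> ''out'' u)" "\<sigma>' ''p'' 0 = 1"
    unfolding \<sigma>' using t4 by simp_all
qed

lemma write_output_correct:
  assumes n: "\<sigma> ''n'' 0 = n" "0 \<le> n" and s: "\<sigma> ''s'' 0 = s"
    and zero: "\<sigma> ''in_new'' = (\<lambda>_. 0)" "\<sigma> ''out_new'' = (\<lambda>_. 0)" "\<sigma> ''l'' 0 = 0"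
  defines "\<sigma>' \<equiv> sem write_output \<sigma>"
    and "excess \<equiv> \<lambda>u v. if s + s < \<sigma> ''r'' (u * n + v) then \<sigma> ''r'' (u * n + v) - (s + s) else 0"
  shows "\<forall>u\<in>{0..<n}. \<forall>v\<in>{0..<n}. \<sigma>' ''f'' (u * n + v) = excess u v"
    "\<forall>v\<in>{0..<n}. \<sigma>' ''in_new'' v = (\<Sum>u\<in>{0..<n}. \<sigma> ''r'' (u * n + v) - excess u v) +
      (if v = 0 \<and> (\<exists>u\<in>{0..<n}. 0 < \<sigma> ''a'' u + \<sigma> ''b'' u) then 1 else 0)"
    "\<forall>u\<in>{0..<n}. \<sigma>' ''out_new'' u = (\<Sum>v\<in>{0..<n}. \<sigma> ''r'' (u * n + v) - excess u v)"
proof -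
  let ?D = "\<lambda>u v. \<sigma> ''r'' (u * n + v) - excess u v"
  let ?B = "HIf (Less (Add (V ''s'') (V ''s'')) (cell ''r'' (V ''u'') (V ''v'')))
        (HAssign ''f'' (Add (Mul (V ''u'') (V ''n'')) (V ''v''))
          (Sub (cell ''r'' (V ''u'') (V ''v'')) (Add (V ''s'') (V ''s''))))
        (HAssign ''f'' (Add (Mul (V ''u'') (V ''n'')) (V ''v'')) (N 0)) ;;
       HAssign ''in_new'' (V ''v'') (Add (Idx ''in_new'' (V ''v''))
         (Sub (cell ''r'' (V ''u'') (V ''v'')) (cell ''f'' (V ''u'') (V ''v'')))) ;;
       HAssign ''out_new'' (V ''u'') (Add (Idx ''out_new'' (V ''u''))
         (Sub (cell ''r'' (V ''u'') (V ''v'')) (cell ''f'' (V ''u'') (V ''v''))))"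
  let ?F1 = "HFor ''u'' (HFor ''v'' ?B)"
  let ?F2 = "HFor ''u'' (HIf (Less (N 0) (Add (Idx ''a'' (V ''u'')) (Idx ''b'' (V ''u''))))
      (HAssign ''l'' (N 0) (N 1)) HSkip)"
  define \<sigma>1 where "\<sigma>1 = sem ?F1 \<sigma>"
  define \<sigma>2 where "\<sigma>2 = sem ?F2 \<sigma>1"
  have \<sigma>': "\<sigma>' = upd ''in_new'' 0 (\<sigma>2 ''in_new'' 0 + \<sigma>2 ''l'' 0) \<sigma>2"
    unfolding \<sigma>'_def write_output_def \<sigma>2_def \<sigma>1_def by (simp only: sem.simps(2,3) aval.simps)
  have fr1: "\<sigma>1 x = \<sigma> x" if "x \<notin> {''u'', ''v'', ''f'', ''in_new'', ''out_new''}" for x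
    unfolding \<sigma>1_def using that by (intro sem_frame) simp_all
  have fr2: "\<sigma>2 x = \<sigma>1 x" if "x \<notin> {''u'', ''l''}" for x
    unfolding \<sigma>2_def using that by (intro sem_frame) simp_all
  let ?I = "\<lambda>j \<tau>. (\<forall>u\<in>{0..<j}. \<forall>v\<in>{0..<n}. \<tau> ''f'' (u * n + v) = excess u v) \<and>
    (\<forall>v\<in>{0..<n}. \<tau> ''in_new'' v = (\<Sum>u\<in>{0..<j}. ?D u v)) \<and>
    (\<forall>u\<in>{0..<n}. \<tau> ''out_new'' u = (if u < j then \<Sum>v\<in>{0..<n}. ?D u v else 0))"
  have 1: "?I n \<sigma>1"
    unfolding \<sigma>1_def
  proof (rule sem_HFor_rule[where I = ?I], goal_cases)
    case (5 j \<tau>)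
    have eq: "\<tau> ''n'' 0 = n" "\<tau> ''s'' 0 = s" "\<tau> ''r'' = \<sigma> ''r''" using 5(3) n s by simp_all
    have j: "j \<in> {0..<n}" using 5 by simp
    let ?J = "\<lambda>i \<tau>. (\<forall>u. \<forall>v\<in>{0..<n}. u \<in> {0..<j} \<or> u = j \<and> v \<in> {0..<i} \<longrightarrow> \<tau> ''f'' (u * n + v) = excess u v) \<and>
      (\<forall>v\<in>{0..<n}. \<tau> ''in_new'' v = (\<Sum>u\<in>{0..<j}. ?D u v) + (if v < i then ?D j v else 0)) \<and>
      (\<forall>u\<in>{0..<n}. \<tau> ''out_new'' u = (if u < j then \<Sum>v\<in>{0..<n}. ?D u v else
        if u = j then \<Sum>v\<in>{0..<i}. ?D j v else 0))"
    have J: "?J n (sem (HFor ''v'' ?B) \<tau>)"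
    proof (rule sem_HFor_rule[where I = ?J], goal_cases)
      case 4
      then show ?case using 5(5) by simp
    next
      case (5 i \<tau>')
      have eq': "\<tau>' ''n'' 0 = n" "\<tau>' ''s'' 0 = s" "\<tau>' ''r'' = \<sigma> ''r''" "\<tau>' ''u'' 0 = j"
        using 5(3) eq \<open>\<tau> ''u'' 0 = j\<close> by simp_all
      have i: "i \<in> {0..<n}" using 5 by simp
      define \<rho> where "\<rho> = upd ''v'' 0 (i + 1) (sem ?B \<tau>')"
      have f: "\<rho> ''f'' = (\<tau>' ''f'')(j * n + i := excess j i)"
        by (rule ext) (simp add: \<rho>_def eq' 5(4) excess_def)
      have inn: "\<rho> ''in_new'' = (\<tau>' ''in_new'')(i := \<tau>' ''in_new'' i + ?D j i)"
        by (rule ext) (simp add: \<rho>_def eq' 5(4) excess_def)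
      have outn: "\<rho> ''out_new'' = (\<tau>' ''out_new'')(j := \<tau>' ''out_new'' j + ?D j i)"
        by (rule ext) (simp add: \<rho>_def eq' 5(4) excess_def)
      have "\<rho> ''f'' (u * n + v) = excess u v" if "v \<in> {0..<n}" "u \<in> {0..<j} \<or> u = j \<and> v \<in> {0..<i + 1}" for u v
        unfolding f matrix_update_apply[OF i that(1)] using 5(1,5) that by auto
      moreover have "\<rho> ''in_new'' v = (\<Sum>u\<in>{0..<j}. ?D u v) + (if v < i + 1 then ?D j v else 0)"
        if "v \<in> {0..<n}" for v
        unfolding inn using 5(5) that by auto
      moreover have "\<rho> ''out_new'' u = (if u < j then \<Sum>v\<in>{0..<n}. ?D u v else
          if u = j then \<Sum>v\<in>{0..<i + 1}. ?D j v else 0)" if "u \<in> {0..<n}" for u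
        unfolding outn using 5(1,5) that by (simp add: sum_int_Suc)
      ultimately show ?case unfolding \<rho>_def[symmetric] by blast
    qed (use n eq in simp_all)
    define \<rho> where "\<rho> = upd ''u'' 0 (j + 1) (sem (HFor ''v'' ?B) \<tau>)"
    have \<rho>: "\<rho> x = sem (HFor ''v'' ?B) \<tau> x" if "x \<noteq> ''u''" for x
      unfolding \<rho>_def using that by (rule upd_other)
    have J: "?J n \<rho>" using J by (simp add: \<rho> del: sem.simps)
    then have "\<forall>u\<in>{0..<j + 1}. \<forall>v\<in>{0..<n}. \<rho> ''f'' (u * n + v) = excess u v"
    proof (intro ballI)
      fix u v assume *: "u \<in> {0..<j + 1}" "v \<in> {0..<n}"
      then have "u \<in> {0..<j} \<or> u = j \<and> v \<in> {0..<n}" by auto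
      then show "\<rho> ''f'' (u * n + v) = excess u v" using J *(2) by blast
    qed
    moreover have "\<forall>v\<in>{0..<n}. \<rho> ''in_new'' v = (\<Sum>u\<in>{0..<j + 1}. ?D u v)"
      using J 5(1) by (simp add: sum_int_Suc)
    moreover have "\<forall>u\<in>{0..<n}. \<rho> ''out_new'' u = (if u < j + 1 then \<Sum>v\<in>{0..<n}. ?D u v else 0)"
      using J by auto
    ultimately show ?case unfolding \<rho>_def[symmetric] by blast
  qed (use n zero in simp_all)
  let ?L = "\<lambda>j. if \<exists>u\<in>{0..<j}. 0 < \<sigma> ''a'' u + \<sigma> ''b'' u then 1 else (0::int)"
  have s1: "\<sigma>1 ''n'' 0 = n" "\<sigma>1 ''a'' = \<sigma> ''a''" "\<sigma>1 ''b'' = \<sigma> ''b''" "\<sigma>1 ''l'' 0 = 0"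
    using fr1 n zero by simp_all
  have l: "\<sigma>2 ''l'' 0 = ?L n"
    unfolding \<sigma>2_def
  proof (rule sem_HFor_rule[where I = "\<lambda>j \<tau>. \<tau> ''l'' 0 = ?L j"], goal_cases)
    case (5 j \<tau>)
    have eq: "\<tau> ''a'' = \<sigma> ''a''" "\<tau> ''b'' = \<sigma> ''b''" using 5(3) s1 by simp_all
    show ?case using 5(1,4,5) by (simp add: eq atLeastLessThan_int_Suc)
  qed (use n s1 in simp_all)
  have eq2: "\<sigma>2 ''f'' = \<sigma>1 ''f''" "\<sigma>2 ''in_new'' = \<sigma>1 ''in_new''" "\<sigma>2 ''out_new'' = \<sigma>1 ''out_new''"
    using fr2 by simp_all
  show "\<forall>u\<in>{0..<n}. \<forall>v\<in>{0..<n}. \<sigma>' ''f'' (u * n + v) = excess u v"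
    "\<forall>v\<in>{0..<n}. \<sigma>' ''in_new'' v = (\<Sum>u\<in>{0..<n}. ?D u v) +
      (if v = 0 \<and> (\<exists>u\<in>{0..<n}. 0 < \<sigma> ''a'' u + \<sigma> ''b'' u) then 1 else 0)"
    "\<forall>u\<in>{0..<n}. \<sigma>' ''out_new'' u = (\<Sum>v\<in>{0..<n}. ?D u v)"
    unfolding \<sigma>' using 1 l eq2 by auto
qed

text \<open>\<open>L\<close> is an exponent known to suffice, \<kappa> the one that is reached. Each
  iteration counts two commands.\<close>

lemma scale_loop_correct:
  assumes "\<sigma> ''p'' 0 = 2 ^ i" "\<sigma> ''t'' 0 < 2 ^ L" "i \<le> L"
  shows "\<exists>k \<kappa> \<sigma>'. ucost scale_loop \<sigma> k \<sigma>' \<and> k \<le> 2 * (L - i) + 1 \<and> \<kappa> \<le> L \<and> \<sigma> ''t'' 0 < 2 ^ \<kappa> \<and>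
    \<sigma>' ''p'' 0 = 2 ^ \<kappa> \<and> (\<forall>x. x \<noteq> ''p'' \<longrightarrow> \<sigma>' x = \<sigma> x)"
  using assms
proof (induction "L - i" arbitrary: i \<sigma>)
  case 0
  then have "\<not> bval (Not (Less (V ''t'') (V ''p''))) \<sigma>" by simp
  then have "ucost scale_loop \<sigma> 1 \<sigma>" unfolding scale_loop_def by (rule ucost.WhileFalse)
  then show ?case using 0 by (intro exI[of _ 1] exI[of _ L] exI[of _ \<sigma>]) simp
next
  case (Suc m)
  show ?case
  proof (cases "\<sigma> ''t'' 0 < 2 ^ i")
    case True
    then have "\<not> bval (Not (Less (V ''t'') (V ''p''))) \<sigma>" using Suc.prems by simp
    then have "ucost scale_loop \<sigma> 1 \<sigma>" unfolding scale_loop_def by (rule ucost.WhileFalse)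
    then show ?thesis using Suc.prems True by (intro exI[of _ 1] exI[of _ i] exI[of _ \<sigma>]) simp
  next
    case False
    define \<sigma>1 where "\<sigma>1 = upd ''p'' 0 (2 ^ Suc i) \<sigma>"
    have b: "bval (Not (Less (V ''t'') (V ''p''))) \<sigma>" using False Suc.prems by simp
    have "ucost (Assign ''p'' (N 0) (Add (V ''p'') (V ''p''))) \<sigma> 1 \<sigma>1"
      using ucost.Assign[of "''p''" "N 0" "Add (V ''p'') (V ''p'')" \<sigma>] Suc.prems(1) by (simp add: \<sigma>1_def)
    note step = ucost.WhileTrue[OF b this, folded scale_loop_def]
    have "\<sigma>1 ''p'' 0 = 2 ^ Suc i" "\<sigma>1 ''t'' 0 < 2 ^ L" "Suc i \<le> L" "m = L - Suc i"
      using Suc by (simp_all add: \<sigma>1_def)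
    from Suc.hyps(1)[of "Suc i" \<sigma>1, OF this(4,1,2,3)] obtain k \<kappa> \<sigma>' where
      IH: "ucost scale_loop \<sigma>1 k \<sigma>'" "k \<le> 2 * (L - Suc i) + 1" "\<kappa> \<le> L" "\<sigma>1 ''t'' 0 < 2 ^ \<kappa>"
        "\<sigma>' ''p'' 0 = 2 ^ \<kappa>" "\<forall>x. x \<noteq> ''p'' \<longrightarrow> \<sigma>' x = \<sigma>1 x" by blast
    have "1 + k + 1 \<le> 2 * (L - i) + 1" using IH(2) \<open>Suc i \<le> L\<close> by simp
    then show ?thesis using step[OF IH(1)] IH(3-6)
      by (intro exI[of _ "1 + k + 1"] exI[of _ \<kappa>] exI[of _ \<sigma>']) (simp add: \<sigma>1_def)
  qed
qed

lemma phase_loop_correct: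
  assumes "phase_ok n (2 ^ \<kappa>) \<sigma>" "0 \<le> n"
  shows "\<exists>k \<sigma>'. ucost phase_loop \<sigma> k \<sigma>' \<and> k \<le> \<kappa> * (steps phase (nat n) + 1) + 1 \<and> phase_ok n 1 \<sigma>' \<and>
    (\<forall>x. x \<notin> set (mods phase) \<longrightarrow> \<sigma>' x = \<sigma> x)"
  using assms(1)
proof (induction \<kappa> arbitrary: \<sigma>)
  case 0
  then have "\<not> bval (Less (N 1) (V ''p'')) \<sigma>" by (simp add: phase_ok_def)
  then have "ucost phase_loop \<sigma> 1 \<sigma>" unfolding phase_loop_def by (rule ucost.WhileFalse)
  then show ?case using 0 by (intro exI[of _ 1] exI[of _ \<sigma>]) simp
next
  case (Suc \<kappa>)
  have "(1::int) < 2 ^ Suc \<kappa>" by (rule one_less_power) auto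
  then have b: "bval (Less (N 1) (V ''p'')) \<sigma>" using Suc.prems by (simp add: phase_ok_def)
  have "wf_hcom phase" "''n'' \<notin> set (mods phase)"
    by (simp_all add: phase_def double_def init_search_def search_def augment_def find_min_def
        shift_duals_def grow_def)
  from ucost_comp[OF this, of \<sigma>] obtain k1 where k1: "k1 \<le> steps phase (nat n)" "ucost (comp phase) \<sigma> k1 (sem phase \<sigma>)"
    using Suc.prems by (auto simp: phase_ok_def)
  note step = ucost.WhileTrue[OF b k1(2), folded phase_loop_def]
  have "phase_ok n (2 ^ \<kappa>) (sem phase \<sigma>)"
    using Suc.prems assms(2) by (intro phase_correct) simp_all
  from Suc.IH[OF this] obtain k \<sigma>' where IH: "ucost phase_loop (sem phase \<sigma>) k \<sigma>'"
    "k \<le> \<kappa> * (steps phase (nat n) + 1) + 1" "phase_ok n 1 \<sigma>'"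
    "\<forall>x. x \<notin> set (mods phase) \<longrightarrow> \<sigma>' x = sem phase \<sigma> x" by blast
  have "\<forall>x. x \<notin> set (mods phase) \<longrightarrow> \<sigma>' x = \<sigma> x" using IH(4) sem_frame by auto
  then show ?case using step[OF IH(1)] IH(2,3) k1(1)
    by (intro exI[of _ "k1 + k + 1"] exI[of _ \<sigma>']) simp
qed

subsection \<open>Correctness and running time of the kernelization\<close>

lemma abs_less_of_bits: "bits z \<le> k \<Longrightarrow> \<bar>z\<bar> < 2 ^ k"
proof -
  assume "bits z \<le> k"
  then have "(2::int) ^ bits z \<le> 2 ^ k" by (intro power_increasing) auto
  then show ?thesis using abs_less_bits[of z] by linarith
qed

lemma input_state_simps:
  "input_state n d ind outd s ''n'' 0 = int n"
  "input_state n d ind outd s ''s'' 0 = int s"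
  "x \<notin> {''n'', ''s'', ''d'', ''in'', ''out''} \<Longrightarrow> input_state n d ind outd s x = (\<lambda>_. 0)"
  "v < n \<Longrightarrow> input_state n d ind outd s ''in'' (int v) = int (ind v)"
  "v < n \<Longrightarrow> input_state n d ind outd s ''out'' (int v) = int (outd v)"
  by (simp_all add: input_state_def)

lemma input_state_d:
  assumes "u < n" "v < n"
  shows "input_state n d ind outd s ''d'' (int u * int n + int v) = cost_code (d u v)"
proof -
  have "u * n + v < (u + 1) * n" using assms by simp
  also have "\<dots> \<le> n * n" using assms by (intro mult_le_mono) auto
  finally have less: "u * n + v < n * n" .
  have eq: "int u * int n + int v = int (u * n + v)" by simp
  show ?thesis unfolding eq using less assms by (simp add: input_state_def del: of_nat_add of_nat_mult)
qed

lemma cost_code_bounds: "max 0 (cost_code e) = (case e of enat k \<Rightarrow> int k | \<infinity> \<Rightarrow> 0)"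
  "cost_code e < 0 \<longleftrightarrow> e = \<infinity>"
  by (cases e; simp)+

context
  fixes n :: nat and d :: "nat \<Rightarrow> nat \<Rightarrow> enat" and ind outd :: "nat \<Rightarrow> nat" and s :: nat
begin

abbreviation (input) "\<sigma>0 \<equiv> input_state n d ind outd s"
abbreviation (input) "L \<equiv> input_size n d ind outd s"

lemma input_size_ge:
  "2 \<le> L" "n \<le> L" "bits (int n) \<le> L" "bits (int s) \<le> L"
  "u < n \<Longrightarrow> v < n \<Longrightarrow> bits (cost_code (d u v)) \<le> L"
  "v < n \<Longrightarrow> bits (int (ind v)) \<le> L" "v < n \<Longrightarrow> bits (int (outd v)) \<le> L"
proof -
  show "2 \<le> L" "bits (int n) \<le> L" "bits (int s) \<le> L" by (simp_all add: input_size_def)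
  have "n \<le> (\<Sum>v<n. 1 + bits (int (ind v)))" using sum_mono[of "{..<n}" "\<lambda>_. 1" "\<lambda>v. 1 + bits (int (ind v))"] by simp
  then show "n \<le> L" by (simp add: input_size_def)
  show "bits (int (ind v)) \<le> L" if "v < n"
    using member_le_sum[of v "{..<n}" "\<lambda>v. 1 + bits (int (ind v))"] that by (simp add: input_size_def)
  show "bits (int (outd v)) \<le> L" if "v < n"
    using member_le_sum[of v "{..<n}" "\<lambda>v. 1 + bits (int (outd v))"] that by (simp add: input_size_def)
  show "bits (cost_code (d u v)) \<le> L" if "u < n" "v < n"
    using member_le_sum[of v "{..<n}" "\<lambda>v. 1 + bits (cost_code (d u v))"]
      member_le_sum[of u "{..<n}" "\<lambda>u. \<Sum>v<n. 1 + bits (cost_code (d u v))"] that by (simp add: input_size_def)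
qed

lemma input_bounded: "bounded L L \<sigma>0"
proof -
  have "bits (\<sigma>0 x i) \<le> L" for x i
  proof -
    have zero: "bits 0 \<le> L" by (simp add: bits_def floorlog_def)
    have dcell: "bits (cost_code (d (nat i div n) (nat i mod n))) \<le> L" if "0 \<le> i" "i < int (n * n)" for i
    proof -
      have "nat i < n * n" using that by linarith
      then have "nat i div n < n" "nat i mod n < n" by (simp_all add: less_mult_imp_div_less) (cases n; simp)
      then show ?thesis using input_size_ge(5) by blast
    qed
    have nat: "nat i < n" if "0 \<le> i" "i < int n" using that by linarith
    have ite: "bits ((if P then g else h) i) \<le> L"
      if "P \<Longrightarrow> bits (g i) \<le> L" "\<not> P \<Longrightarrow> bits (h i) \<le> L" for P and g h :: "int \<Rightarrow> int"
      using that by simp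
    have ite': "bits (if P then a else b) \<le> L" if "P \<Longrightarrow> bits a \<le> L" "bits b \<le> L" for P a b
      using that by simp
    show ?thesis unfolding input_state_def fun_upd_apply
      by (intro ite ite' zero dcell input_size_ge(3,4,6,7) nat) auto
  qed
  then have "\<bar>\<sigma>0 x i\<bar> \<le> 2 ^ L" for x i using abs_less_of_bits less_imp_le by blast
  then show ?thesis using input_size_ge(1) by (simp add: bounded_def)
qed

text \<open>Fewer than \<open>2 ^ L\<close> vertices contribute at most \<open>2 * 2 ^ L\<close>
  each. The exponent, linear in the input size, will bound the number of phases.\<close>

lemma total_degree_less: "(\<Sum>u\<in>{0..<int n}. \<sigma>0 ''in'' u + \<sigma>0 ''out'' u) < 2 ^ (2 * L + 1)"
proof -
  have "(\<Sum>u\<in>{0..<int n}. \<sigma>0 ''in'' u + \<sigma>0 ''out'' u) = (\<Sum>u<n. int (ind u) + int (outd u))"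
    unfolding sum_int_eq by (intro sum.cong) (simp_all add: input_state_simps)
  also have "\<dots> \<le> (\<Sum>u<n. 2 * 2 ^ L)"
  proof (intro sum_mono)
    fix u assume "u \<in> {..<n}"
    then have "u < n" by simp
    then show "int (ind u) + int (outd u) \<le> 2 * 2 ^ L"
      using abs_less_of_bits[OF input_size_ge(6)] abs_less_of_bits[OF input_size_ge(7)]
      by (smt (verit, best))
  qed
  also have "\<dots> = int n * (2 * 2 ^ L)" by simp
  also have "\<dots> < 2 ^ L * (2 * 2 ^ L)"
    using abs_less_of_bits[OF input_size_ge(3)] by (intro mult_strict_right_mono) auto
  also have "\<dots> = 2 ^ (L + L + 1)" unfolding power_add by simp
  also have "L + L + 1 = 2 * L + 1" by simp
  finally show ?thesis .
qed

definition final_ok :: "state \<Rightarrow> bool" where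
  "final_ok \<tau> \<longleftrightarrow> phase_ok (int n) 1 \<tau> \<and> \<tau> ''s'' 0 = int s \<and> \<tau> ''in_new'' = (\<lambda>_. 0) \<and>
    \<tau> ''out_new'' = (\<lambda>_. 0) \<and> \<tau> ''l'' 0 = 0 \<and> \<tau> ''in'' = \<sigma>0 ''in'' \<and> \<tau> ''out'' = \<sigma>0 ''out'' \<and>
    (\<forall>u<n. \<forall>v<n. \<tau> ''c'' (int u * int n + int v) = int_cost n d u v)"

text \<open>One summand for each of the four parts of the program, with at most
  \<open>2 * x + 1\<close> doublings of \<open>p\<close> and as many phases, and \<open>3\<close>
  for the sequential compositions.\<close>

definition run_bound :: "nat \<Rightarrow> nat" where
  "run_bound x = steps prepare x + (2 * (2 * x + 1) + 1) + ((2 * x + 1) * (steps phase x + 1) + 1) +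
    steps write_output x + 3"

lemma kernel_program_run:
  "\<exists>k \<tau>. ucost kernel_program \<sigma>0 k (sem write_output \<tau>) \<and> k \<le> run_bound L \<and> final_ok \<tau>"
proof -
  have n: "\<sigma>0 ''n'' 0 = int n" "0 \<le> int n" by (simp_all add: input_state_simps)
  define \<sigma>1 where "\<sigma>1 = sem prepare \<sigma>0"
  have "wf_hcom prepare" "''n'' \<notin> set (mods prepare)" by (simp_all add: prepare_def)
  from ucost_comp[OF this, of \<sigma>0] obtain k1 where
    k1: "k1 \<le> steps prepare n" "ucost (comp prepare) \<sigma>0 k1 \<sigma>1" by (auto simp: \<sigma>1_def n)
  have fr1: "\<sigma>1 x = \<sigma>0 x" if "x \<notin> set (mods prepare)" for x
    unfolding \<sigma>1_def using that by (rule sem_frame)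
  have t0: "\<sigma>0 ''t'' 0 = 0" by (simp add: input_state_simps)
  note p1 = prepare_correct[of \<sigma>0 "int n", OF n t0, folded \<sigma>1_def]
  have "\<sigma>1 ''p'' 0 = 2 ^ 0" "\<sigma>1 ''t'' 0 < 2 ^ (2 * L + 1)"
    using p1 total_degree_less by simp_all
  from scale_loop_correct[of \<sigma>1 0 "2 * L + 1", OF this] obtain k2 \<kappa> \<sigma>2 where
    k2: "ucost scale_loop \<sigma>1 k2 \<sigma>2" "k2 \<le> 2 * (2 * L + 1) + 1" and
    \<kappa>: "\<kappa> \<le> 2 * L + 1" "\<sigma>1 ''t'' 0 < 2 ^ \<kappa>" "\<sigma>2 ''p'' 0 = 2 ^ \<kappa>" and
    fr2: "\<And>x. x \<noteq> ''p'' \<Longrightarrow> \<sigma>2 x = \<sigma>1 x" by auto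
  have eq2: "\<sigma>2 x = \<sigma>0 x" if "x \<notin> set (mods prepare)" for x
    using fr1[OF that] fr2[of x] that by (auto simp: prepare_def)
  have c2: "\<sigma>2 ''c'' (int u * int n + int v) = int_cost n d u v" if "u < n" "v < n" for u v
  proof -
    have "(\<Sum>u\<in>{0..<int n}. \<Sum>v\<in>{0..<int n}. max 0 (\<sigma>0 ''d'' (u * int n + v))) =
        (\<Sum>u<n. \<Sum>v<n. case d u v of enat k \<Rightarrow> int k | \<infinity> \<Rightarrow> 0)"
      unfolding sum_int_eq by (intro sum.cong refl) (simp add: input_state_d cost_code_bounds)
    moreover have "\<sigma>2 ''c'' = \<sigma>1 ''c''" by (rule fr2) simp
    ultimately have "\<sigma>2 ''c'' (int u * int n + int v) =
        (if cost_code (d u v) < 0 then big_cost n d else cost_code (d u v))"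
      using p1(1) that by (simp add: input_state_d big_cost_def)
    then show ?thesis by (cases "d u v") (simp_all add: int_cost_def)
  qed
  have zero: "\<sigma>2 ''y'' = (\<lambda>_. 0)" "\<sigma>2 ''z'' = (\<lambda>_. 0)" "\<sigma>2 ''r'' = (\<lambda>_. 0)" "\<sigma>2 ''a'' = (\<lambda>_. 0)"
    "\<sigma>2 ''b'' = (\<lambda>_. 0)" "\<sigma>2 ''in_new'' = (\<lambda>_. 0)" "\<sigma>2 ''out_new'' = (\<lambda>_. 0)" "\<sigma>2 ''l'' = (\<lambda>_. 0)"
    by (subst eq2; simp add: prepare_def input_state_simps)+
  have same: "\<sigma>2 ''n'' = \<sigma>0 ''n''" "\<sigma>2 ''s'' = \<sigma>0 ''s''" "\<sigma>2 ''in'' = \<sigma>0 ''in''" "\<sigma>2 ''out'' = \<sigma>0 ''out''"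
    by (rule eq2; simp add: prepare_def)+
  have nonneg: "0 \<le> \<sigma>0 ''in'' u" "0 \<le> \<sigma>0 ''out'' u" for u by (simp_all add: input_state_def)
  have less: "\<sigma>0 ''in'' u < 2 ^ \<kappa>" "\<sigma>0 ''out'' u < 2 ^ \<kappa>" if "u \<in> {0..<int n}" for u
  proof -
    have "\<sigma>0 ''in'' u + \<sigma>0 ''out'' u \<le> (\<Sum>u\<in>{0..<int n}. \<sigma>0 ''in'' u + \<sigma>0 ''out'' u)"
      using that nonneg by (intro member_le_sum[of u _ "\<lambda>u. \<sigma>0 ''in'' u + \<sigma>0 ''out'' u"]) (auto intro: add_nonneg_nonneg)
    then have "\<sigma>0 ''in'' u + \<sigma>0 ''out'' u < 2 ^ \<kappa>" using \<kappa>(2) p1(2) by simp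
    then show "\<sigma>0 ''in'' u < 2 ^ \<kappa>" "\<sigma>0 ''out'' u < 2 ^ \<kappa>" using nonneg[of u] by linarith+
  qed
  have "0 \<le> \<sigma>2 ''c'' (u * int n + v)" if "u \<in> {0..<int n}" "v \<in> {0..<int n}" for u v
    using c2[of "nat u" "nat v"] int_cost_nonneg[of n d "nat u" "nat v"] that by (simp add: nat_less_iff)
  then have "phase_ok (int n) (2 ^ \<kappa>) \<sigma>2"
    using n nonneg less \<kappa>(3)
    by (simp add: phase_ok_def zero same partial_opt_def duals_ok_def slack_def row_sum_def col_sum_def
        div_pos_pos_trivial)
  from phase_loop_correct[OF this n(2)] obtain k3 \<tau> where
    k3: "ucost phase_loop \<sigma>2 k3 \<tau>" "k3 \<le> \<kappa> * (steps phase n + 1) + 1" and ok: "phase_ok (int n) 1 \<tau>"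
    and fr3: "\<And>x. x \<notin> set (mods phase) \<Longrightarrow> \<tau> x = \<sigma>2 x" by auto
  have eq3: "\<tau> ''n'' = \<sigma>2 ''n''" "\<tau> ''s'' = \<sigma>2 ''s''" "\<tau> ''in'' = \<sigma>2 ''in''" "\<tau> ''out'' = \<sigma>2 ''out''" "\<tau> ''c'' = \<sigma>2 ''c''"
    "\<tau> ''in_new'' = \<sigma>2 ''in_new''" "\<tau> ''out_new'' = \<sigma>2 ''out_new''" "\<tau> ''l'' = \<sigma>2 ''l''"
    by (rule fr3; simp add: phase_def double_def init_search_def search_def augment_def find_min_def
        shift_duals_def grow_def)+
  have fin: "final_ok \<tau>"
    unfolding final_ok_def using ok c2 by (simp add: eq3 zero same input_state_simps)
  have "wf_hcom write_output" "''n'' \<notin> set (mods write_output)" by (simp_all add: write_output_def)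
  from ucost_comp[OF this, of \<tau>] obtain k4 where
    k4: "k4 \<le> steps write_output n" "ucost (comp write_output) \<tau> k4 (sem write_output \<tau>)"
    using ok by (auto simp: phase_ok_def)
  have "ucost kernel_program \<sigma>0 (k1 + (k2 + (k3 + k4 + 1) + 1) + 1) (sem write_output \<tau>)"
    unfolding kernel_program_def by (intro ucost.Seq[OF k1(2)] ucost.Seq[OF k2(1)] ucost.Seq[OF k3(1)] k4(2))
  moreover have "k1 + (k2 + (k3 + k4 + 1) + 1) + 1 \<le> run_bound L"
  proof -
    have "k3 \<le> (2 * L + 1) * (steps phase L + 1) + 1"
    proof -
      have "\<kappa> * (steps phase n + 1) \<le> (2 * L + 1) * (steps phase L + 1)"
        using \<kappa>(1) steps_mono[OF input_size_ge(2), of phase] by (intro mult_le_mono) auto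
      then show ?thesis using k3(2) by linarith
    qed
    then show ?thesis
      using k1(1) k2(2) k4(1) steps_mono[OF input_size_ge(2), of prepare]
        steps_mono[OF input_size_ge(2), of write_output] unfolding run_bound_def by linarith
  qed
  ultimately show ?thesis using fin by blast
qed

end

lemma ok_kernel_program: "ok_com kernel_program"
  by (simp add: kernel_program_def scale_loop_def phase_loop_def prepare_def write_output_def phase_def double_def
      init_search_def search_def augment_def find_min_def shift_duals_def grow_def)

text \<open>The bound of \<open>exec_of_ucost\<close> for \<open>B = D = x\<close>,
  \<open>K = csize kernel_program\<close>, \<open>k = run_bound x\<close> and the smallest
  admissible \<open>Bf\<close>.\<close>

definition time_bound :: "nat \<Rightarrow> nat" where
  "time_bound x = run_bound x * (csize kernel_program *
    (x + x * csize kernel_program * run_bound x + x * csize kernel_program + 2) + 1)"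

lemma poly_bounded_time: "poly_bounded time_bound"
  unfolding time_bound_def run_bound_def by (intro poly_bounded_intros poly_bounded_steps)

lemma kernel_program_exec:
  "\<exists>t \<tau>. exec kernel_program (input_state n d ind outd s) t (sem write_output \<tau>) \<and>
    t \<le> time_bound (input_size n d ind outd s) \<and> final_ok n d ind outd s \<tau>"
proof -
  let ?K = "csize kernel_program" and ?L = "input_size n d ind outd s"
  obtain k \<tau> where k: "ucost kernel_program (input_state n d ind outd s) k (sem write_output \<tau>)"
      "k \<le> run_bound ?L" "final_ok n d ind outd s \<tau>"
    using kernel_program_run by blast
  from exec_of_ucost[OF k(1) ok_kernel_program order_refl input_bounded order_refl] obtain t where
    t: "exec kernel_program (input_state n d ind outd s) t (sem write_output \<tau>)"
      "t \<le> k * (?K * (?L + ?L * ?K * k + ?L * ?K + 2) + 1)" by blast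
  note t(2)
  also have "k * (?K * (?L + ?L * ?K * k + ?L * ?K + 2) + 1) \<le> time_bound ?L"
    unfolding time_bound_def using k(2) by (intro mult_le_mono add_mono order_refl)
  finally show ?thesis using t(1) k(3) by blast
qed

theorem theorem5:
  shows "\<exists>(P :: com) (p :: nat poly) (C :: nat).
    \<forall>(F :: nat pair_pre_digraph set) (n :: nat) (d :: nat \<Rightarrow> nat \<Rightarrow> enat)
      (ind :: nat \<Rightarrow> nat) (outd :: nat \<Rightarrow> nat).
      (\<forall>G\<in>F. pair_digraph G) \<longrightarrow>
      (\<exists>t \<sigma> ind' outd' f.
        exec P (input_state n d ind outd (max_arcs F n)) t \<sigma> \<and>
        t \<le> poly p (input_size n d ind outd (max_arcs F n)) \<and>
        output_state n ind' outd' f \<sigma> \<and>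
        (\<forall>v<n. ind' v \<le> degree_bound C n ind outd (max_arcs F n) \<and>
               outd' v \<le> degree_bound C n ind outd (max_arcs F n)) \<and>
        (\<forall>m. is_optimal F n d ind' outd' m \<longrightarrow>
             is_optimal F n d ind outd (\<lambda>u v. f u v + m u v)))"
proof -
  obtain p where p: "\<And>x. time_bound x \<le> poly p x"
    using poly_bounded_time unfolding poly_bounded_def by blast
  have "\<exists>t \<sigma> ind' outd' f.
        exec kernel_program (input_state n d ind outd (max_arcs F n)) t \<sigma> \<and>
        t \<le> poly p (input_size n d ind outd (max_arcs F n)) \<and>
        output_state n ind' outd' f \<sigma> \<and>
        (\<forall>v<n. ind' v \<le> degree_bound 2 n ind outd (max_arcs F n) \<and>
               outd' v \<le> degree_bound 2 n ind outd (max_arcs F n)) \<and>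
        (\<forall>m. is_optimal F n d ind' outd' m \<longrightarrow>
             is_optimal F n d ind outd (\<lambda>u v. f u v + m u v))"
    if F: "\<forall>G\<in>F. pair_digraph G" for F n d ind outd
  proof -
    let ?s = "max_arcs F n"
    obtain t \<tau> where exec: "exec kernel_program (input_state n d ind outd ?s) t (sem write_output \<tau>)"
      "t \<le> time_bound (input_size n d ind outd ?s)" and fin: "final_ok n d ind outd ?s \<tau>"
      using kernel_program_exec by blast
    define \<sigma> where "\<sigma> = sem write_output \<tau>"
    define r where "r u v = nat (\<tau> ''r'' (int u * int n + int v))" for u v
    define f where "f u v = r u v - 2 * ?s" for u v
    define leftover where "leftover \<longleftrightarrow> (\<exists>u\<in>{0..<int n}. 0 < \<tau> ''a'' u + \<tau> ''b'' u)"
    define ind' where "ind' v = (\<Sum>u<n. r u v - f u v) + (if v = 0 \<and> leftover then 1 else 0)" for v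
    define outd' where "outd' u = (\<Sum>v<n. r u v - f u v)" for u
    have \<tau>: "\<tau> ''n'' 0 = int n" "\<tau> ''s'' 0 = int ?s" "\<tau> ''in_new'' = (\<lambda>_. 0)" "\<tau> ''out_new'' = (\<lambda>_. 0)"
      "\<tau> ''l'' 0 = 0" and c: "\<And>u v. u < n \<Longrightarrow> v < n \<Longrightarrow> \<tau> ''c'' (int u * int n + int v) = int_cost n d u v"
      using fin by (simp_all add: final_ok_def phase_ok_def)
    have io: "input_state n d ind outd ?s ''out'' = \<tau> ''out''" "input_state n d ind outd ?s ''in'' = \<tau> ''in''"
      using fin by (simp_all add: final_ok_def)
    have "opt_state (\<tau> ''out'') (\<tau> ''in'') \<tau>"
      and empty: "sum (\<tau> ''a'') {0..<int n} = 0 \<or> sum (\<tau> ''b'') {0..<int n} = 0"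
      using fin unfolding final_ok_def phase_ok_def div_by_1 by blast+
    then have po: "partial_opt (int n) (\<tau> ''c'') (input_state n d ind outd ?s ''out'')
        (input_state n d ind outd ?s ''in'') (\<tau> ''y'') (\<tau> ''z'') (\<tau> ''r'') (\<tau> ''a'') (\<tau> ''b'')"
      unfolding io \<tau>(1) by simp
    have duals: "duals_ok (int n) (\<tau> ''c'') (\<tau> ''y'') (\<tau> ''z'') (\<tau> ''r'')"
      using po by (simp add: partial_opt_def)
    have r: "int (r u v) = \<tau> ''r'' (int u * int n + int v)" if "u < n" "v < n" for u v
      using duals that by (simp add: r_def duals_ok_def)
    have a: "0 \<le> \<tau> ''a'' (int u)" "\<tau> ''a'' (int u) + int (\<Sum>v<n. r u v) = int (outd u)" if "u < n" for u
    proof -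
      have "row_sum (int n) (\<tau> ''r'') (int u) = int (\<Sum>v<n. r u v)"
        unfolding row_sum_def sum_int_eq of_nat_sum using r that by (intro sum.cong) auto
      moreover have "0 \<le> \<tau> ''a'' (int u) \<and> \<tau> ''a'' (int u) + row_sum (int n) (\<tau> ''r'') (int u) =
          input_state n d ind outd ?s ''out'' (int u)"
        using po that by (simp add: partial_opt_def)
      ultimately show "0 \<le> \<tau> ''a'' (int u)" "\<tau> ''a'' (int u) + int (\<Sum>v<n. r u v) = int (outd u)"
        using that by (simp_all add: input_state_simps)
    qed
    have b: "0 \<le> \<tau> ''b'' (int v)" "\<tau> ''b'' (int v) + int (\<Sum>u<n. r u v) = int (ind v)" if "v < n" for v
    proof -
      have "col_sum (int n) (\<tau> ''r'') (int v) = int (\<Sum>u<n. r u v)"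
        unfolding col_sum_def sum_int_eq of_nat_sum using r that by (intro sum.cong) auto
      moreover have "0 \<le> \<tau> ''b'' (int v) \<and> \<tau> ''b'' (int v) + col_sum (int n) (\<tau> ''r'') (int v) =
          input_state n d ind outd ?s ''in'' (int v)"
        using po that by (simp add: partial_opt_def)
      ultimately show "0 \<le> \<tau> ''b'' (int v)" "\<tau> ''b'' (int v) + int (\<Sum>u<n. r u v) = int (ind v)"
        using that by (simp_all add: input_state_simps)
    qed
    have totals: "(\<Sum>u<n. \<tau> ''a'' (int u)) + int (\<Sum>u<n. \<Sum>v<n. r u v) = int (\<Sum>u<n. outd u)"
        "(\<Sum>v<n. \<tau> ''b'' (int v)) + int (\<Sum>u<n. \<Sum>v<n. r u v) = int (\<Sum>v<n. ind v)"
    proof -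
      show "(\<Sum>u<n. \<tau> ''a'' (int u)) + int (\<Sum>u<n. \<Sum>v<n. r u v) = int (\<Sum>u<n. outd u)"
        using a(2) by (simp flip: sum.distrib)
      have "(\<Sum>v<n. \<tau> ''b'' (int v)) + int (\<Sum>v<n. \<Sum>u<n. r u v) = int (\<Sum>v<n. ind v)"
        using b(2) by (simp flip: sum.distrib)
      then show "(\<Sum>v<n. \<tau> ''b'' (int v)) + int (\<Sum>u<n. \<Sum>v<n. r u v) = int (\<Sum>v<n. ind v)"
        by (subst sum.swap)
    qed
    \<comment> \<open>One of the two remainders adds up to 0. So the totals agree exactly if both
      do, that is, if nothing is left over.\<close>
    have full: "leftover \<longleftrightarrow> (\<Sum>v<n. ind v) \<noteq> (\<Sum>v<n. outd v)"
      and assigned: "\<not> leftover \<Longrightarrow> u < n \<Longrightarrow> \<tau> ''a'' (int u) = 0 \<and> \<tau> ''b'' (int u) = 0" for u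
    proof -
      have nonneg: "0 \<le> (\<Sum>u<n. \<tau> ''a'' (int u))" "0 \<le> (\<Sum>u<n. \<tau> ''b'' (int u))"
        using a(1) b(1) by (auto intro!: sum_nonneg)
      have iff: "leftover \<longleftrightarrow> (\<exists>u<n. 0 < \<tau> ''a'' (int u) + \<tau> ''b'' (int u))"
        unfolding leftover_def
        by (metis atLeastLessThan_iff nonneg_int_cases of_nat_0_le_iff of_nat_less_iff)
      have pos: "0 < \<tau> ''a'' (int u) + \<tau> ''b'' (int u) \<longleftrightarrow> \<not> (\<tau> ''a'' (int u) = 0 \<and> \<tau> ''b'' (int u) = 0)"
        if "u < n" for u using a(1)[OF that] b(1)[OF that] by auto
      show "\<not> leftover \<Longrightarrow> u < n \<Longrightarrow> \<tau> ''a'' (int u) = 0 \<and> \<tau> ''b'' (int u) = 0" for u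
        using iff pos by blast
      have "(\<Sum>u<n. \<tau> ''a'' (int u)) = 0 \<longleftrightarrow> (\<forall>u<n. \<tau> ''a'' (int u) = 0)"
        using a(1) by (subst sum_nonneg_eq_0_iff) auto
      moreover have "(\<Sum>u<n. \<tau> ''b'' (int u)) = 0 \<longleftrightarrow> (\<forall>u<n. \<tau> ''b'' (int u) = 0)"
        using b(1) by (subst sum_nonneg_eq_0_iff) auto
      ultimately have "\<not> leftover \<longleftrightarrow> (\<Sum>u<n. \<tau> ''a'' (int u)) = 0 \<and> (\<Sum>u<n. \<tau> ''b'' (int u)) = 0"
        using iff pos by blast
      then show "leftover \<longleftrightarrow> (\<Sum>v<n. ind v) \<noteq> (\<Sum>v<n. outd v)"
        using totals empty unfolding sum_int_eq by linarith
    qed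
    note out = write_output_correct[of \<tau> "int n", OF \<tau>(1) of_nat_0_le_iff \<tau>(2-5), folded \<sigma>_def]
    have fi: "int (f u v) = (if int ?s + int ?s < \<tau> ''r'' (int u * int n + int v)
        then \<tau> ''r'' (int u * int n + int v) - (int ?s + int ?s) else 0)" if "u < n" "v < n" for u v
      using r[OF that] by (simp add: f_def)
    have rf: "int (r u v - f u v) = \<tau> ''r'' (int u * int n + int v) - (if int ?s + int ?s < \<tau> ''r'' (int u * int n + int v)
        then \<tau> ''r'' (int u * int n + int v) - (int ?s + int ?s) else 0)" if "u < n" "v < n" for u v
      using r[OF that] fi[OF that] by (simp add: f_def of_nat_diff)
    have out_f: "\<sigma> ''f'' (int (u * n + v)) = int (f u v)" if "u < n" "v < n" for u v
      unfolding fi[OF that] using out(1) that by simp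
    have out_in: "\<sigma> ''in_new'' (int v) = int (ind' v)" if "v < n" for v
    proof -
      have "\<sigma> ''in_new'' (int v) = (\<Sum>u<n. int (r u v - f u v)) + (if int v = 0 \<and> leftover then 1 else 0)"
        using out(2) that rf unfolding leftover_def sum_int_eq by simp
      then show ?thesis by (simp add: ind'_def)
    qed
    have out_out: "\<sigma> ''out_new'' (int u) = int (outd' u)" if "u < n" for u
    proof -
      have "\<sigma> ''out_new'' (int u) = (\<Sum>v<n. int (r u v - f u v))"
        using out(3) that rf unfolding sum_int_eq by simp
      then show ?thesis by (simp add: outd'_def)
    qed
    have "output_state n ind' outd' f \<sigma>"
      unfolding output_state_def using out_f out_in out_out by blast
    \<comment> \<open>Each of the \<open>n\<close> entries of \<open>r - f\<close> in a row or
      column is at most \<open>2 * s\<close>, hence \<open>C = 2\<close>. The extra unit at vertex 0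
      matches the extra term of \<open>degree_bound\<close>.\<close>
    moreover have "ind' v \<le> degree_bound 2 n ind outd ?s \<and> outd' v \<le> degree_bound 2 n ind outd ?s" for v
    proof -
      have "(\<Sum>u<n. r u v - f u v) \<le> (\<Sum>u<n. 2 * ?s)" "(\<Sum>u<n. r v u - f v u) \<le> (\<Sum>u<n. 2 * ?s)"
        by (intro sum_mono; simp add: f_def)+
      then show ?thesis using full unfolding ind'_def outd'_def degree_bound_def by auto
    qed
    moreover have "is_optimal F n d ind outd (\<lambda>u v. f u v + m u v)" if opt: "is_optimal F n d ind' outd' m" for m
    proof (cases leftover)
      \<comment> \<open>The matrix \<open>r - f\<close> alone would give balanced degrees, which may
        have solutions although the given instance has none. The extra unit destroys the balance, so
        there is no optimal \<open>m\<close> to lift.\<close>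
      case True
      have "0 < n" using True by (auto simp: leftover_def)
      then have "(\<Sum>v<n. ind' v) = (\<Sum>v<n. \<Sum>u<n. r u v - f u v) + 1"
        using True by (simp add: ind'_def sum.distrib)
      also have "(\<Sum>v<n. \<Sum>u<n. r u v - f u v) = (\<Sum>u<n. outd' u)"
        unfolding outd'_def by (rule sum.swap)
      finally have "(\<Sum>v<n. ind' v) \<noteq> (\<Sum>u<n. outd' u)" by simp
      then show ?thesis using opt not_optimal_unbalanced by blast
    next
      case False
      have "transport_duals n (int_cost n d) (\<lambda>u. \<tau> ''y'' (int u)) (\<lambda>v. \<tau> ''z'' (int v)) r"
      proof
        fix u v assume uv: "u < n" "v < n"
        have *: "0 \<le> slack (int n) (\<tau> ''c'') (\<tau> ''y'') (\<tau> ''z'') (int u) (int v) \<and>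
            (0 < \<tau> ''r'' (int u * int n + int v) \<longrightarrow> slack (int n) (\<tau> ''c'') (\<tau> ''y'') (\<tau> ''z'') (int u) (int v) = 0)"
          using duals uv by (simp add: duals_ok_def)
        show "0 \<le> int_cost n d u v - \<tau> ''y'' (int u) - \<tau> ''z'' (int v)"
          using * c[OF uv] by (simp add: slack_def)
        show "int_cost n d u v - \<tau> ''y'' (int u) - \<tau> ''z'' (int v) = 0" if "0 < r u v"
          using * c[OF uv] r[OF uv] that by (simp add: slack_def)
      qed
      moreover have "(\<Sum>u<n. r u v) = ind v" if "v < n" for v
        using b(2)[OF that] assigned[OF False that] by linarith
      moreover have "(\<Sum>v<n. r u v) = outd u" if "u < n" for u
        using a(2)[OF that] assigned[OF False that] by linarith
      ultimately show ?thesis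
        by (rule optimal_lift[OF _ F]) (use False opt in \<open>simp_all add: f_def ind'_def outd'_def\<close>)
    qed
    ultimately show ?thesis
      using exec p[of "input_size n d ind outd ?s"] unfolding \<sigma>_def[symmetric] by (meson order_trans)
  qed
  then show ?thesis by blast
qed

end
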